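(* There exists a set $W$ of $23$ Wang tiles such that the tiling problem for finite simply connected regions with the fixed set $W$ is $\mathsf{NP}$-complete.
   Context: A Wang tile is a unit square with each of its four edges (north, south, west, east) assigned a color. Tiles are used only by translation (no rotation or reflection), and each tile of a set may be used an unlimited number of times (including zero). A polyomino is a simply connected shape obtained by gluing finitely many unit squares of the square grid together edge-to-edge. A finite simply connected region (for Wang tiles) is a finite simply connected polyomino region $D$ (i.e. without holes) together with a color assigned to each unit segment of its boundary. A set $W$ of Wang tiles tiles $D$ if every unit square of $D$ can be covered by a translated copy of a tile of $W$ so that any two copies sharing an edge have the same color on that edge, and every tile edge lying on the boundary of $D$ has the color assigned to that boundary segment. For a fixed set $W$ of Wang tiles, the tiling problem for finite simply connected regions with $W$ is the decision problem: given an arbitrary finite simply connected region $D$ (with its boundary colors), can $D$ be tiled with translated copies of tiles from $W$? The set $W$ is not part of the input; the region $D$ is given explicitly, as a list of its unit squares together with the colors of its boundary segments. *)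

theory Defs
  imports "HOL-Analysis.Analysis" "HOL-Computational_Algebra.Polynomial"
begin

section \<open>Polynomial time and NP\<close>

text \<open>
  Nondeterministic Turing machines with any fixed positive number of two-way infinite tapes.
  States and tape symbols are natural numbers; only the finitely many that occur in the
  finite transition table matter. Symbol 0 is the blank, 1 and 2 are the input bits.
  A transition \<open>(q, rs, q', as)\<close> applies in state \<open>q\<close> when the heads read \<open>rs\<close>; it goes to
  state \<open>q'\<close> and tells each head what to write and where to move afterwards.
\<close>

datatype move = Left_Move | No_Move | Right_Move

type_synonym transition = "nat \<times> nat list \<times> nat \<times> (nat \<times> move) list"

record tm =
  tapes :: nat
  delta :: "transition set"
  start :: nat
  accept :: nat

definition wf_tm :: "tm \<Rightarrow> bool" where
  "wf_tm M \<longleftrightarrow> tapes M \<ge> 1 \<and> finite (delta M) \<and>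
     (\<forall>(q, rs, q', as) \<in> delta M. length rs = tapes M \<and> length as = tapes M)"

definition deterministic :: "tm \<Rightarrow> bool" where
  "deterministic M \<longleftrightarrow>
     (\<forall>q rs q1 as1 q2 as2. (q, rs, q1, as1) \<in> delta M \<longrightarrow> (q, rs, q2, as2) \<in> delta M \<longrightarrow>
        q1 = q2 \<and> as1 = as2)"

text \<open>A tape is its head position together with its contents.\<close>

type_synonym tape = "int \<times> (int \<Rightarrow> nat)"
type_synonym config = "nat \<times> tape list"

fun read_tape :: "tape \<Rightarrow> nat" where
  "read_tape (h, t) = t h"

fun displacement :: "move \<Rightarrow> int" where
  "displacement Left_Move = -1"
| "displacement No_Move = 0"
| "displacement Right_Move = 1"

fun act :: "nat \<times> move \<Rightarrow> tape \<Rightarrow> tape" where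
  "act (s, d) (h, t) = (h + displacement d, t(h := s))"

inductive step :: "tm \<Rightarrow> config \<Rightarrow> config \<Rightarrow> bool" for M where
  "(q, map read_tape ts, q', as) \<in> delta M \<Longrightarrow> step M (q, ts) (q', map2 act as ts)"

definition halted :: "tm \<Rightarrow> config \<Rightarrow> bool" where
  "halted M c \<longleftrightarrow> (\<nexists>c'. step M c c')"

definition bit_symbol :: "bool \<Rightarrow> nat" where
  "bit_symbol b = (if b then 2 else 1)"

definition word_contents :: "bool list \<Rightarrow> int \<Rightarrow> nat" where
  "word_contents w i = (if 0 \<le> i \<and> i < int (length w) then bit_symbol (w ! nat i) else 0)"

definition initial :: "tm \<Rightarrow> bool list \<Rightarrow> config" where
  "initial M w = (start M, (0, word_contents w) # replicate (tapes M - 1) (0, \<lambda>_. 0))"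

text \<open>Every computation path halts within the time bound; some path halts in the accepting
  state exactly for the words of the language.\<close>

definition decides_in_time :: "tm \<Rightarrow> bool list set \<Rightarrow> (nat \<Rightarrow> nat) \<Rightarrow> bool" where
  "decides_in_time M L T \<longleftrightarrow>
     (\<forall>w. (\<forall>n c. (step M ^^ n) (initial M w) c \<longrightarrow> n \<le> T (length w)) \<and>
          (w \<in> L \<longleftrightarrow> (\<exists>c. (step M)\<^sup>*\<^sup>* (initial M w) c \<and> halted M c \<and> fst c = accept M)))"

definition NP :: "bool list set set" where
  "NP = {L. \<exists>M (p :: nat poly). wf_tm M \<and> decides_in_time M L (poly p)}"

text \<open>The output is the whole content of the last tape; the head may be anywhere.\<close>

definition computes_in_time :: "tm \<Rightarrow> (bool list \<Rightarrow> bool list) \<Rightarrow> (nat \<Rightarrow> nat) \<Rightarrow> bool" where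
  "computes_in_time M f T \<longleftrightarrow>
     (\<forall>w. \<exists>n \<le> T (length w). \<exists>c. (step M ^^ n) (initial M w) c \<and> halted M c \<and>
        snd (last (snd c)) = word_contents (f w))"

definition poly_time_computable :: "(bool list \<Rightarrow> bool list) \<Rightarrow> bool" where
  "poly_time_computable f \<longleftrightarrow>
     (\<exists>M (p :: nat poly). wf_tm M \<and> deterministic M \<and> computes_in_time M f (poly p))"

definition poly_reducible :: "bool list set \<Rightarrow> bool list set \<Rightarrow> bool" (infix "\<le>\<^sub>p" 50) where
  "A \<le>\<^sub>p B \<longleftrightarrow> (\<exists>f. poly_time_computable f \<and> (\<forall>w. w \<in> A \<longleftrightarrow> f w \<in> B))"

definition NP_complete :: "bool list set \<Rightarrow> bool" where
  "NP_complete L \<longleftrightarrow> L \<in> NP \<and> (\<forall>A \<in> NP. A \<le>\<^sub>p L)"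


section \<open>Polyominoes and Wang tiles\<close>

text \<open>The cell \<open>(x, y)\<close> stands for the unit square with lower left corner \<open>(x, y)\<close>.\<close>

type_synonym cell = "int \<times> int"

fun unit_square :: "cell \<Rightarrow> (real \<times> real) set" where
  "unit_square (x, y) = cbox (of_int x, of_int y) (of_int x + 1, of_int y + 1)"

text \<open>\<open>Horizontal x y\<close> joins \<open>(x, y)\<close> to \<open>(x + 1, y)\<close>, \<open>Vertical x y\<close> joins \<open>(x, y)\<close> to
  \<open>(x, y + 1)\<close>.\<close>

datatype segment = Horizontal int int | Vertical int int

datatype side = North | South | West | East

fun segment_of :: "cell \<Rightarrow> side \<Rightarrow> segment" where
  "segment_of (x, y) North = Horizontal x (y + 1)"
| "segment_of (x, y) South = Horizontal x y"
| "segment_of (x, y) West = Vertical x y"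
| "segment_of (x, y) East = Vertical (x + 1) y"

definition share_edge :: "cell \<Rightarrow> cell \<Rightarrow> bool" where
  "share_edge p q \<longleftrightarrow> p \<noteq> q \<and> (\<exists>s t. segment_of p s = segment_of q t)"

definition edge_connected :: "cell set \<Rightarrow> bool" where
  "edge_connected D \<longleftrightarrow>
     (\<forall>p \<in> D. \<forall>q \<in> D. (\<lambda>a b. a \<in> D \<and> b \<in> D \<and> share_edge a b)\<^sup>*\<^sup>* p q)"

text \<open>Simple connectedness alone would admit squares glued only at a corner.\<close>

definition polyomino :: "cell set \<Rightarrow> bool" where
  "polyomino D \<longleftrightarrow> finite D \<and> D \<noteq> {} \<and> edge_connected D \<and>
     simply_connected (\<Union>p \<in> D. unit_square p)"

definition boundary :: "cell set \<Rightarrow> segment set" where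
  "boundary D = {e. \<exists>!p. p \<in> D \<and> (\<exists>s. e = segment_of p s)}"

datatype wang_tile = Wang_Tile (north: nat) (south: nat) (west: nat) (east: nat)

fun side_color :: "wang_tile \<Rightarrow> side \<Rightarrow> nat" where
  "side_color t North = north t"
| "side_color t South = south t"
| "side_color t West = west t"
| "side_color t East = east t"

definition tiles_region :: "wang_tile set \<Rightarrow> cell set \<Rightarrow> (segment \<Rightarrow> nat) \<Rightarrow> bool" where
  "tiles_region W D \<kappa> \<longleftrightarrow>
     (\<exists>f :: cell \<Rightarrow> wang_tile.
        (\<forall>p \<in> D. f p \<in> W) \<and>
        (\<forall>p \<in> D. \<forall>q \<in> D. \<forall>s t. segment_of p s = segment_of q t \<longrightarrow>
            side_color (f p) s = side_color (f q) t) \<and>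
        (\<forall>p \<in> D. \<forall>s. segment_of p s \<in> boundary D \<longrightarrow>
            side_color (f p) s = \<kappa> (segment_of p s)))"


section \<open>The tiling problem for a fixed tile set\<close>

text \<open>An instance lists the squares of the region and the colors of its boundary segments.\<close>

type_synonym instance_data = "cell list \<times> (segment \<times> nat) list"

fun valid_instance :: "instance_data \<Rightarrow> bool" where
  "valid_instance (cs, bs) \<longleftrightarrow>
     distinct cs \<and> polyomino (set cs) \<and>
     distinct (map fst bs) \<and> fst ` set bs = boundary (set cs)"

fun tileable :: "wang_tile set \<Rightarrow> instance_data \<Rightarrow> bool" where
  "tileable W (cs, bs) \<longleftrightarrow> tiles_region W (set cs) (\<lambda>e. the (map_of bs e))"

text \<open>A self-delimiting binary code: numbers are in binary, least significant bit first;
  each bit of a number and each item of a list is preceded by \<open>True\<close>, and \<open>False\<close> ends the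
  number or list.\<close>

definition encode_list :: "('a \<Rightarrow> bool list) \<Rightarrow> 'a list \<Rightarrow> bool list" where
  "encode_list e xs = concat (map (\<lambda>x. True # e x) xs) @ [False]"

fun binary_digits :: "nat \<Rightarrow> bool list" where
  "binary_digits n = (if n = 0 then [] else odd n # binary_digits (n div 2))"

declare binary_digits.simps [simp del]

definition encode_nat :: "nat \<Rightarrow> bool list" where
  "encode_nat n = encode_list (\<lambda>b. [b]) (binary_digits n)"

definition encode_int :: "int \<Rightarrow> bool list" where
  "encode_int i = (i < 0) # encode_nat (nat \<bar>i\<bar>)"

fun encode_cell :: "cell \<Rightarrow> bool list" where
  "encode_cell (x, y) = encode_int x @ encode_int y"

fun encode_segment :: "segment \<Rightarrow> bool list" where
  "encode_segment (Horizontal x y) = False # encode_int x @ encode_int y"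
| "encode_segment (Vertical x y) = True # encode_int x @ encode_int y"

fun encode_colored_segment :: "segment \<times> nat \<Rightarrow> bool list" where
  "encode_colored_segment (e, k) = encode_segment e @ encode_nat k"

fun encode_instance :: "instance_data \<Rightarrow> bool list" where
  "encode_instance (cs, bs) = encode_list encode_cell cs @ encode_list encode_colored_segment bs"

definition tiling_problem :: "wang_tile set \<Rightarrow> bool list set" where
  "tiling_problem W = {encode_instance I | I. valid_instance I \<and> tileable W I}"


subsection \<open>The encoding is injective\<close>

definition prefix_code :: "('a \<Rightarrow> bool list) \<Rightarrow> bool" where
  "prefix_code e \<longleftrightarrow> (\<forall>x y u v. e x @ u = e y @ v \<longrightarrow> x = y \<and> u = v)"

lemma prefix_codeD: "prefix_code e \<Longrightarrow> e x @ u = e y @ v \<Longrightarrow> x = y \<and> u = v"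
  unfolding prefix_code_def by blast

lemma prefix_code_list:
  assumes "prefix_code e"
  shows "prefix_code (encode_list e)"
proof -
  have "xs = ys \<and> u = v" if "encode_list e xs @ u = encode_list e ys @ v" for xs ys u v
    using that
  proof (induction xs arbitrary: ys)
    case Nil
    then show ?case by (cases ys) (auto simp: encode_list_def)
  next
    case (Cons x xs)
    show ?case
    proof (cases ys)
      case Nil
      with Cons.prems show ?thesis by (auto simp: encode_list_def)
    next
      case (Cons y ys')
      with Cons.prems have "e x @ encode_list e xs @ u = e y @ encode_list e ys' @ v"
        by (auto simp: encode_list_def)
      from prefix_codeD[OF assms this] Cons.IH Cons show ?thesis by auto
    qed
  qed
  then show ?thesis unfolding prefix_code_def by blast
qed

lemma binary_digits_inject: "binary_digits m = binary_digits n \<Longrightarrow> m = n"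
proof (induction m arbitrary: n rule: less_induct)
  case (less m)
  show ?case
  proof (cases "m = 0 \<or> n = 0")
    case True
    with less.prems show ?thesis
      by (auto simp: binary_digits.simps[of m] binary_digits.simps[of n] split: if_splits)
  next
    case False
    with less.prems have "odd m = odd n" "binary_digits (m div 2) = binary_digits (n div 2)"
      by (auto simp: binary_digits.simps[of m] binary_digits.simps[of n])
    with False less.IH[of "m div 2" "n div 2"] have "m mod 2 = n mod 2" "m div 2 = n div 2"
      by (auto simp: parity_cases odd_iff_mod_2_eq_one mod2_eq_if)
    then show ?thesis by (metis div_mult_mod_eq)
  qed
qed

lemma prefix_code_nat: "prefix_code encode_nat"
proof -
  have "prefix_code (\<lambda>b. [b])" by (simp add: prefix_code_def)
  from prefix_codeD[OF prefix_code_list[OF this]] show ?thesis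
    unfolding prefix_code_def encode_nat_def using binary_digits_inject by blast
qed

lemma prefix_code_int: "prefix_code encode_int"
  unfolding prefix_code_def
proof (intro allI impI)
  fix i j u v
  assume "encode_int i @ u = encode_int j @ v"
  then have "(i < 0) = (j < 0)" and "encode_nat (nat \<bar>i\<bar>) @ u = encode_nat (nat \<bar>j\<bar>) @ v"
    by (simp_all add: encode_int_def)
  from this(1) prefix_codeD[OF prefix_code_nat this(2)] show "i = j \<and> u = v" by linarith
qed

lemma prefix_code_pair:
  assumes "prefix_code d" "prefix_code e" "d x @ e y @ u = d x' @ e y' @ v"
  shows "x = x' \<and> y = y' \<and> u = v"
  using prefix_codeD[OF assms(1,3)] prefix_codeD[OF assms(2)] by blast

lemma prefix_code_cell: "prefix_code encode_cell"
  unfolding prefix_code_def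
proof (intro allI impI)
  fix p q :: cell and u v
  assume "encode_cell p @ u = encode_cell q @ v"
  then show "p = q \<and> u = v"
    by (cases p; cases q) (auto dest: prefix_code_pair[OF prefix_code_int prefix_code_int])
qed

lemma prefix_code_segment: "prefix_code encode_segment"
  unfolding prefix_code_def
proof (intro allI impI)
  fix e e' u v
  assume "encode_segment e @ u = encode_segment e' @ v"
  then show "e = e' \<and> u = v"
    by (cases e; cases e') (auto dest: prefix_code_pair[OF prefix_code_int prefix_code_int])
qed

lemma prefix_code_colored_segment: "prefix_code encode_colored_segment"
  unfolding prefix_code_def
proof (intro allI impI)
  fix a b :: "segment \<times> nat" and u v
  assume "encode_colored_segment a @ u = encode_colored_segment b @ v"
  then show "a = b \<and> u = v"
    by (cases a; cases b) (auto dest: prefix_code_pair[OF prefix_code_segment prefix_code_nat])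
qed

lemma inj_encode_instance: "inj encode_instance"
proof (rule injI)
  fix I J
  assume eq: "encode_instance I = encode_instance J"
  obtain cs bs where I: "I = (cs, bs)" by force
  obtain cs' bs' where J: "J = (cs', bs')" by force
  have 1: "cs = cs'" and 2: "encode_list encode_colored_segment bs = encode_list encode_colored_segment bs'"
    using prefix_codeD[OF prefix_code_list[OF prefix_code_cell]] eq I J by auto
  have "bs = bs'"
    using prefix_codeD[OF prefix_code_list[OF prefix_code_colored_segment], of bs "[]" bs' "[]"] 2
    by simp
  with 1 I J show "I = J" by simp
qed

end

theory Submission
  imports Defs "HOL-Complex_Analysis.Riemann_Mapping"
begin

text \<open>Hardness. An accepting computation of a nondeterministic machine is a solution of a
  constraint satisfaction problem in which every constraint says that exactly one of two
  conditions on two variables holds. With one column of unit squares per pair of a variable and a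
  value, each constraint becomes a requirement that exactly one of a given set of columns is true.
  A rectangle can check a list of such requirements with a fixed tile set: the truth values travel
  north along the columns, and the colors on the west side are a program that shifts marks into
  the columns and then has one row count the columns that are both true and marked.

  Membership. A guessed tiling is verified by a function that is polynomial-time by closure
  properties, which hold because stack programs on serialised trees can be compiled to
  Turing machines. That the region has no holes is decided through the connectivity of its
  complement.\<close>

section \<open>Stack programs and their compilation to Turing machines\<close>

text \<open>A row visits every column, so a requirement may concern columns that lie far apart:
  nothing has to be routed or crossed, and a rectangle suffices. "Exactly one" is the right kind of
  requirement for two reasons. A row can count to one with two horizontal colors. And it expresses
  equality: a = b holds iff, for every c, exactly one of a = c and b \<noteq> c holds. So a
  computation has to be described by conditions on one cell and equations between functions of two
  cells; for this reason a tableau cell also records whether a head is on one of its neighbours.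

  Membership meets two obstacles. The machine guesses one symbol per input position, so certificates
  must be linear in the word: coordinates stay binary, and colors may be unary because in a tileable
  instance they are bounded by the tile set. And a region with binary coordinates could have a huge
  bounding box; but a connected region of n cells spans at most n columns and n rows, so its
  complement need only be explored in a box of quadratic size.\<close>

datatype reg = RI | RM | RA | RB | RC | RG | RO

definition regs :: "reg list" where "regs = [RI, RM, RA, RB, RC, RG, RO]"

lemma set_regs: "set regs = UNIV"
proof -
  have "r \<in> set regs" for r by (cases r) (auto simp: regs_def)
  then show ?thesis by auto
qed

lemma regs_nonempty: "regs \<noteq> []"
  by (simp add: regs_def)

type_synonym store = "reg \<Rightarrow> nat list"

definition peek :: "nat list \<Rightarrow> nat" where
  "peek xs = (case xs of [] \<Rightarrow> 0 | x # _ \<Rightarrow> x)"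

lemma peek_simps[simp]: "peek [] = 0" "peek (x # xs) = x"
  by (simp_all add: peek_def)

datatype cmd = Push reg bool | Pop reg | Seq cmd cmd
  | If reg "nat \<Rightarrow> bool" cmd cmd | While reg "nat \<Rightarrow> bool" cmd

text \<open>The last argument is the exact number of machine steps of the compiled code: a push
  takes one step to reach the blank cell above the top and one to write, and every test costs a
  step. A pop from an empty stack has no execution.\<close>

inductive exec :: "cmd \<Rightarrow> store \<Rightarrow> store \<Rightarrow> nat \<Rightarrow> bool" where
  Push: "exec (Push r b) S (S(r := bit_symbol b # S r)) 2"
| Pop: "S r = x # xs \<Longrightarrow> exec (Pop r) S (S(r := xs)) 1"
| Seq: "exec c1 S S1 t1 \<Longrightarrow> exec c2 S1 S2 t2 \<Longrightarrow> exec (Seq c1 c2) S S2 (t1 + t2)"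
| If_True: "P (peek (S r)) \<Longrightarrow> exec c1 S S1 t \<Longrightarrow> exec (If r P c1 c2) S S1 (Suc t)"
| If_False: "\<not> P (peek (S r)) \<Longrightarrow> exec c2 S S1 t \<Longrightarrow> exec (If r P c1 c2) S S1 (Suc t)"
| While_False: "\<not> P (peek (S r)) \<Longrightarrow> exec (While r P c) S S 1"
| While_True: "P (peek (S r)) \<Longrightarrow> exec c S S1 t1 \<Longrightarrow> exec (While r P c) S1 S2 t2 \<Longrightarrow>
    exec (While r P c) S S2 (Suc (t1 + t2))"

text \<open>A stack occupies the cells 0, 1, ... of its tape, bottom first; the head is on the top
  element, hence at -1 when the stack is empty.\<close>

definition stk :: "nat list \<Rightarrow> tape" where
  "stk xs = (int (length xs) - 1,
     \<lambda>i. if 0 \<le> i \<and> i < int (length xs) then rev xs ! nat i else 0)"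

lemma read_stk [simp]: "read_tape (stk xs) = peek xs"
  by (cases xs) (auto simp: stk_def nth_append nat_diff_distrib)

lemma act_stay [simp]: "act (read_tape T, No_Move) T = T"
  by (cases T) auto

lemma act_peek_stay [simp]: "act (peek xs, No_Move) (stk xs) = stk xs"
  by (metis act_stay read_stk)

lemma act_pop: "act (0, Left_Move) (stk (x # xs)) = stk xs"
  by (auto simp: stk_def nth_append fun_eq_iff)

lemma act_push: "act (s, No_Move) (act (peek xs, Right_Move) (stk xs)) = stk (s # xs)"
  by (cases xs) (auto simp: stk_def nth_append fun_eq_iff nat_less_iff)

lemma read_gap: "read_tape (act (peek xs, Right_Move) (stk xs)) = 0"
  by (cases xs) (auto simp: stk_def)

text \<open>A transition table is finite, so a generic instruction is tabulated for every joint
  reading with symbols up to \<open>A\<close>. The next state may depend on all symbols read, the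
  action on a tape only on its own symbol.\<close>

definition trans_of :: "nat \<Rightarrow> nat \<Rightarrow> ((reg \<Rightarrow> nat) \<Rightarrow> nat) \<Rightarrow> (reg \<Rightarrow> nat \<Rightarrow> nat \<times> move) \<Rightarrow> transition set" where
  "trans_of A a z g = {(a, map \<rho> regs, z \<rho>, map (\<lambda>r. g r (\<rho> r)) regs) |\<rho>. \<forall>r. \<rho> r \<le> A}"

definition only :: "reg \<Rightarrow> (nat \<Rightarrow> nat \<times> move) \<Rightarrow> reg \<Rightarrow> nat \<Rightarrow> nat \<times> move" where
  "only r f r' s = (if r' = r then f s else (s, No_Move))"

fun csize :: "cmd \<Rightarrow> nat" where
  "csize (Push r b) = 2"
| "csize (Pop r) = 1"
| "csize (Seq c1 c2) = csize c1 + csize c2"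
| "csize (If r P c1 c2) = 1 + csize c1 + csize c2"
| "csize (While r P c) = 1 + csize c"

text \<open>\<open>compile A c a z\<close> enters at state \<open>a\<close>, leaves at state \<open>z\<close> and owns the states from
  \<open>a\<close> to \<open>a + csize c - 1\<close>.\<close>

fun compile :: "nat \<Rightarrow> cmd \<Rightarrow> nat \<Rightarrow> nat \<Rightarrow> transition set" where
  "compile A (Push r b) a z =
     trans_of A a (\<lambda>_. a + 1) (only r (\<lambda>s. (s, Right_Move))) \<union>
     trans_of A (a + 1) (\<lambda>_. z) (only r (\<lambda>s. (bit_symbol b, No_Move)))"
| "compile A (Pop r) a z = trans_of A a (\<lambda>_. z) (only r (\<lambda>s. (0, Left_Move)))"
| "compile A (Seq c1 c2) a z = compile A c1 a (a + csize c1) \<union> compile A c2 (a + csize c1) z"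
| "compile A (If r P c1 c2) a z =
     trans_of A a (\<lambda>\<rho>. if P (\<rho> r) then a + 1 else a + 1 + csize c1) (\<lambda>_ s. (s, No_Move)) \<union>
     compile A c1 (a + 1) z \<union> compile A c2 (a + 1 + csize c1) z"
| "compile A (While r P c) a z =
     trans_of A a (\<lambda>\<rho>. if P (\<rho> r) then a + 1 else z) (\<lambda>_ s. (s, No_Move)) \<union> compile A c (a + 1) a"

lemma csize_pos: "csize c > 0"
  by (induction c) auto

lemma finite_bounded_readings: "finite {\<rho> :: reg \<Rightarrow> nat. \<forall>r. \<rho> r \<le> A}"
proof (rule inj_on_finite)
  show "inj_on (\<lambda>\<rho>. map \<rho> regs) {\<rho> :: reg \<Rightarrow> nat. \<forall>r. \<rho> r \<le> A}"
    by (auto simp: inj_on_def set_regs fun_eq_iff)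
  show "(\<lambda>\<rho>. map \<rho> regs) ` {\<rho> :: reg \<Rightarrow> nat. \<forall>r. \<rho> r \<le> A} \<subseteq> {xs. set xs \<subseteq> {..A} \<and> length xs = length regs}"
    by auto
  show "finite {xs. set xs \<subseteq> {..A} \<and> length xs = length regs}"
    by (rule finite_lists_length_eq) simp
qed

lemma finite_trans_of: "finite (trans_of A a z g)"
proof -
  have "trans_of A a z g = (\<lambda>\<rho>. (a, map \<rho> regs, z \<rho>, map (\<lambda>r. g r (\<rho> r)) regs)) ` {\<rho>. \<forall>r. \<rho> r \<le> A}"
    by (auto simp: trans_of_def)
  then show ?thesis using finite_bounded_readings by simp
qed

lemma finite_compile: "finite (compile A c a z)"
  by (induction c arbitrary: a z) (auto simp: finite_trans_of)

definition wf_trans :: "transition \<Rightarrow> bool" where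
  "wf_trans \<equiv> \<lambda>(q, rs, q', as). length rs = length regs \<and> length as = length regs"

lemma wf_trans_of: "\<tau> \<in> trans_of A a z g \<Longrightarrow> wf_trans \<tau>"
  by (auto simp: trans_of_def wf_trans_def)

lemma wf_compile: "\<tau> \<in> compile A c a z \<Longrightarrow> wf_trans \<tau>"
  by (induction c arbitrary: a z) (auto dest: wf_trans_of)

text \<open>Subprograms own disjoint intervals of source states. This makes the union of their
  tables deterministic and lets a machine halt in an exit state outside the interval.\<close>

lemma compile_source:
  "(q, rs, q', as) \<in> compile A c a z \<Longrightarrow> a \<le> q \<and> q < a + csize c"
proof (induction c arbitrary: a z)
  case (Seq c1 c2)
  then show ?case using csize_pos[of c1] csize_pos[of c2] by fastforce
next
  case (If r P c1 c2)
  then show ?case using csize_pos[of c1] csize_pos[of c2] by (fastforce simp: trans_of_def)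
next
  case (While r P c)
  then show ?case using csize_pos[of c] by (fastforce simp: trans_of_def)
qed (auto simp: trans_of_def)

lemma compile_target:
  "(q, rs, q', as) \<in> compile A c a z \<Longrightarrow> q' = z \<or> a \<le> q' \<and> q' < a + csize c"
proof (induction c arbitrary: a z)
  case (Seq c1 c2)
  then show ?case using csize_pos[of c1] csize_pos[of c2] by fastforce
next
  case (If r P c1 c2)
  then show ?case using csize_pos[of c1] csize_pos[of c2] by (fastforce simp: trans_of_def)
next
  case (While r P c)
  then show ?case using csize_pos[of c] by (fastforce simp: trans_of_def)
qed (auto simp: trans_of_def)

definition functional :: "transition set \<Rightarrow> bool" where
  "functional D \<longleftrightarrow> (\<forall>q rs q1 as1 q2 as2. (q, rs, q1, as1) \<in> D \<longrightarrow> (q, rs, q2, as2) \<in> D \<longrightarrow>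
     q1 = q2 \<and> as1 = as2)"

lemma functionalD: "functional D \<Longrightarrow> (q, rs, q1, as1) \<in> D \<Longrightarrow> (q, rs, q2, as2) \<in> D \<Longrightarrow> q1 = q2 \<and> as1 = as2"
  unfolding functional_def by blast

lemma functional_Un:
  assumes "functional D" "functional E"
    and "\<And>q rs q1 as1 rs' q2 as2. (q, rs, q1, as1) \<in> D \<Longrightarrow> (q, rs', q2, as2) \<in> E \<Longrightarrow> False"
  shows "functional (D \<union> E)"
  using assms unfolding functional_def by (metis UnE)

lemma functional_trans_of: "functional (trans_of A a z g)"
proof -
  have "\<rho> = \<rho>'" if "map \<rho> regs = map \<rho>' regs" for \<rho> \<rho>' :: "reg \<Rightarrow> nat"
    using that by (auto simp: set_regs fun_eq_iff)
  then show ?thesis unfolding functional_def trans_of_def by blast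
qed

lemma functional_compile: "functional (compile A c a z)"
proof (induction c arbitrary: a z)
  case (Push r b)
  show ?case by (auto intro!: functional_Un functional_trans_of) (auto simp: trans_of_def)
next
  case (Seq c1 c2)
  show ?case
    by (simp, rule functional_Un[OF Seq.IH]) (fastforce dest: compile_source)
next
  case (If r P c1 c2)
  have 1: "functional (trans_of A a zz gg \<union> compile A c1 (a + 1) z)" for zz gg
    by (rule functional_Un[OF functional_trans_of If.IH(1)])
       (auto simp: trans_of_def dest: compile_source)
  show ?case
    by (simp only: compile.simps, rule functional_Un[OF 1 If.IH(2)])
       (auto simp: trans_of_def dest!: compile_source)
next
  case (While r P c)
  show ?case
    by (simp, rule functional_Un[OF functional_trans_of While.IH])
       (auto simp: trans_of_def dest: compile_source)
qed (simp add: functional_trans_of)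

section \<open>Simulation of programs by machine steps\<close>

definition conf :: "store \<Rightarrow> tape list" where
  "conf S = map (\<lambda>r. stk (S r)) regs"

definition bounded_store :: "nat \<Rightarrow> store \<Rightarrow> bool" where
  "bounded_store A S \<longleftrightarrow> (\<forall>r. set (S r) \<subseteq> {..A})"

lemma bounded_store_peek: "bounded_store A S \<Longrightarrow> peek (S r) \<le> A"
  by (cases "S r") (auto simp: bounded_store_def dest: spec[of _ r])

lemma map2_map_same: "map2 f (map g xs) (map h xs) = map (\<lambda>x. f (g x) (h x)) xs"
  by (induction xs) auto

lemma step_trans_of:
  assumes "trans_of A a z g \<subseteq> delta M" "\<forall>r. read_tape (T r) \<le> A"
  shows "step M (a, map T regs)
    (z (\<lambda>r. read_tape (T r)), map (\<lambda>r. act (g r (read_tape (T r))) (T r)) regs)"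
proof -
  let ?\<rho> = "\<lambda>r. read_tape (T r)"
  have "(a, map ?\<rho> regs, z ?\<rho>, map (\<lambda>r. g r (?\<rho> r)) regs) \<in> delta M"
    by (rule subsetD[OF assms(1)]) (use assms(2) in \<open>auto simp: trans_of_def intro: exI[of _ ?\<rho>]\<close>)
  then have "step M (a, map T regs) (z ?\<rho>, map2 act (map (\<lambda>r. g r (?\<rho> r)) regs) (map T regs))"
    by (intro step.intros) (simp add: comp_def)
  then show ?thesis by (simp add: map2_map_same)
qed

lemma step_test:
  assumes "trans_of A a z (\<lambda>_ s. (s, No_Move)) \<subseteq> delta M" "bounded_store A S"
  shows "step M (a, conf S) (z (\<lambda>r. peek (S r)), conf S)"
  using step_trans_of[OF assms(1), of "\<lambda>r. stk (S r)"] assms(2)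
  by (simp add: conf_def bounded_store_peek)

text \<open>Induction on the execution and not on the program, since a loop reenters its own code.
  The store has to stay bounded because the table only answers readings up to \<open>A\<close>;
  \<open>A \<ge> 2\<close> covers the symbols 1 and 2 that a push writes.\<close>

lemma exec_compile:
  assumes "exec c S S' t" "bounded_store A S" "A \<ge> 2" "compile A c a z \<subseteq> delta M"
  shows "(step M ^^ t) (a, conf S) (z, conf S') \<and> bounded_store A S'"
  using assms
proof (induction arbitrary: a z rule: exec.induct)
  case (Push r b S)
  \<comment> \<open>Between the two steps of a push the head is on the blank cell above the top, so
    this configuration is not of the form \<open>conf S\<close>.\<close>
  let ?T = "\<lambda>r'. if r' = r then act (peek (S r), Right_Move) (stk (S r)) else stk (S r')"
  have 1: "step M (a, conf S) (a + 1, map ?T regs)"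
    using step_trans_of[of A a "\<lambda>_. a + 1" "only r (\<lambda>s. (s, Right_Move))" M "\<lambda>r. stk (S r)"] Push
    by (auto simp: conf_def bounded_store_peek only_def if_distrib if_distribR cong: if_cong)
  have m: "map (\<lambda>r'. act (only r (\<lambda>s. (bit_symbol b, No_Move)) r' (read_tape (?T r'))) (?T r')) regs
      = conf (S(r := bit_symbol b # S r))"
    by (auto simp: conf_def only_def act_push)
  have 2: "step M (a + 1, map ?T regs) (z, conf (S(r := bit_symbol b # S r)))"
    using step_trans_of[of A "a + 1" "\<lambda>_. z" "only r (\<lambda>s. (bit_symbol b, No_Move))" M ?T] Push
    unfolding m by (auto simp: bounded_store_peek read_gap)
  have "(step M ^^ 2) (a, conf S) (z, conf (S(r := bit_symbol b # S r)))"
    using 1 2 by (auto simp: numeral_2_eq_2)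
  moreover have "bounded_store A (S(r := bit_symbol b # S r))"
    using Push by (auto simp: bounded_store_def bit_symbol_def)
  ultimately show ?case by blast
next
  case (Pop S r x xs)
  have m: "map (\<lambda>r'. act (only r (\<lambda>s. (0, Left_Move)) r' (read_tape (stk (S r')))) (stk (S r'))) regs
      = conf (S(r := xs))"
    using Pop by (auto simp: conf_def only_def act_pop)
  have "set (S r) \<subseteq> {..A}"
    using Pop.prems(1) by (simp only: bounded_store_def)
  then have "bounded_store A (S(r := xs))"
    using Pop by (simp add: bounded_store_def)
  moreover have "step M (a, conf S) (z, conf (S(r := xs)))"
    using step_trans_of[of A a "\<lambda>_. z" "only r (\<lambda>s. (0, Left_Move))" M "\<lambda>r. stk (S r)"] Pop
    unfolding m by (simp add: conf_def[of S] bounded_store_peek)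
  ultimately show ?case unfolding relpowp_1 by blast
next
  case (Seq c1 S S1 t1 c2 S2 t2)
  then have "compile A c1 a (a + csize c1) \<subseteq> delta M" "compile A c2 (a + csize c1) z \<subseteq> delta M"
    by auto
  with Seq have 1: "(step M ^^ t1) (a, conf S) (a + csize c1, conf S1) \<and> bounded_store A S1" by blast
  with Seq have 2: "(step M ^^ t2) (a + csize c1, conf S1) (z, conf S2) \<and> bounded_store A S2" by auto
  show ?case using 1 2 unfolding relpowp_add by blast
next
  case (If_True P S r c1 S1 t c2)
  have "step M (a, conf S) (a + 1, conf S)"
    using step_test[of A a _ M S] If_True by fastforce
  moreover have "(step M ^^ t) (a + 1, conf S) (z, conf S1) \<and> bounded_store A S1"
    using If_True by auto
  ultimately show ?case by (blast intro: relpowp_Suc_I2)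
next
  case (If_False P S r c2 S1 t c1)
  have "step M (a, conf S) (a + 1 + csize c1, conf S)"
    using step_test[of A a _ M S] If_False by fastforce
  moreover have "(step M ^^ t) (a + 1 + csize c1, conf S) (z, conf S1) \<and> bounded_store A S1"
    using If_False by auto
  ultimately show ?case by (blast intro: relpowp_Suc_I2)
next
  case (While_False P S r c)
  then have "step M (a, conf S) (z, conf S)"
    using step_test[of A a _ M S] by fastforce
  with While_False show ?case by (simp add: relpowp_1 del: relpowp.simps)
next
  case (While_True P S r c S1 t1 S2 t2)
  have s: "step M (a, conf S) (a + 1, conf S)"
    using step_test[of A a _ M S] While_True by fastforce
  have "compile A c (a + 1) a \<subseteq> delta M" using While_True.prems by auto
  with While_True have 1: "(step M ^^ t1) (a + 1, conf S) (a, conf S1) \<and> bounded_store A S1"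
    by blast
  with While_True have 2: "(step M ^^ t2) (a, conf S1) (z, conf S2) \<and> bounded_store A S2"
    by blast
  have "(step M ^^ (t1 + t2)) (a + 1, conf S) (z, conf S2)"
    using 1 2 unfolding relpowp_add by blast
  with s 2 show ?case by (blast intro: relpowp_Suc_I2)
qed

text \<open>A step lengthens a stack by at most one symbol. Hence polynomial time implies polynomial
  output size, on which the closure under composition rests.\<close>

lemma exec_length: "exec c S S' t \<Longrightarrow> length (S' r) \<le> length (S r) + t"
  by (induction rule: exec.induct) auto

text \<open>From here on times are only bounded from above, so that branches of different cost share
  one bound.\<close>

definition ex :: "cmd \<Rightarrow> store \<Rightarrow> store \<Rightarrow> nat \<Rightarrow> bool" where
  "ex c S S' T \<longleftrightarrow> (\<exists>t \<le> T. exec c S S' t)"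

lemma ex_mono: "ex c S S' T \<Longrightarrow> T \<le> T' \<Longrightarrow> ex c S S' T'"
  unfolding ex_def by (meson le_trans)

lemma ex_Seq: "ex c1 S S1 U \<Longrightarrow> ex c2 S1 S2 V \<Longrightarrow> U + V \<le> T \<Longrightarrow> ex (Seq c1 c2) S S2 T"
  unfolding ex_def by (meson exec.Seq add_mono le_trans)

lemma ex_If_True: "P (peek (S r)) \<Longrightarrow> ex c1 S S1 U \<Longrightarrow> U + 1 \<le> T \<Longrightarrow> ex (If r P c1 c2) S S1 T"
  unfolding ex_def by (metis exec.If_True Suc_eq_plus1 add_le_mono1 le_trans)

lemma ex_If_False: "\<not> P (peek (S r)) \<Longrightarrow> ex c2 S S1 U \<Longrightarrow> U + 1 \<le> T \<Longrightarrow> ex (If r P c1 c2) S S1 T"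
  unfolding ex_def by (metis exec.If_False Suc_eq_plus1 add_le_mono1 le_trans)

lemma ex_While_False: "\<not> P (peek (S r)) \<Longrightarrow> 1 \<le> T \<Longrightarrow> ex (While r P c) S S T"
  unfolding ex_def by (metis exec.While_False)

lemma ex_While_True:
  assumes "P (peek (S r))" "ex c S S1 U" "ex (While r P c) S1 S2 V" "U + V + 1 \<le> T"
  shows "ex (While r P c) S S2 T"
proof -
  obtain t1 t2 where t: "t1 \<le> U" "exec c S S1 t1" "t2 \<le> V" "exec (While r P c) S1 S2 t2"
    using assms(2,3) unfolding ex_def by blast
  have "exec (While r P c) S S2 (Suc (t1 + t2))"
    by (rule exec.While_True[OF assms(1) t(2) t(4)])
  moreover have "Suc (t1 + t2) \<le> T" using t assms(4) by linarith
  ultimately show ?thesis unfolding ex_def by blast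
qed

lemma ex_Push: "S' = S(r := bit_symbol b # S r) \<Longrightarrow> 2 \<le> T \<Longrightarrow> ex (Push r b) S S' T"
  unfolding ex_def by (metis exec.Push)

lemma ex_Pop: "S r = x # xs \<Longrightarrow> S' = S(r := xs) \<Longrightarrow> 1 \<le> T \<Longrightarrow> ex (Pop r) S S' T"
  unfolding ex_def by (metis exec.Pop)

section \<open>Programs on serialised binary trees\<close>

datatype data = Leaf | Node data data

text \<open>Preorder notation over the symbols 1 and 2. It is self-delimiting, so several trees can
  lie on one stack, and joining two trees or splitting a node amounts to pushing or popping a single
  symbol.\<close>

primrec ser :: "data \<Rightarrow> nat list" where
  "ser Leaf = [1]"
| "ser (Node a b) = 2 # ser a @ ser b"

abbreviation sz :: "data \<Rightarrow> nat" where
  "sz d \<equiv> length (ser d)"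

definition symbols :: "nat list \<Rightarrow> bool" where
  "symbols xs \<longleftrightarrow> set xs \<subseteq> {1, 2}"

lemma symbols_simps [simp]: "symbols []" "symbols (x # xs) \<longleftrightarrow> (x = 1 \<or> x = 2) \<and> symbols xs"
  "symbols (xs @ ys) \<longleftrightarrow> symbols xs \<and> symbols ys" "symbols (rev xs) \<longleftrightarrow> symbols xs"
  by (auto simp: symbols_def)

lemma symbols_ser [simp]: "symbols (ser d)"
  by (induction d) auto

lemma sz_pos [simp]: "0 < sz d"
  by (cases d) auto

lemma bit_symbol_simps [simp]: "bit_symbol False = 1" "bit_symbol True = 2"
  by (simp_all add: bit_symbol_def)

fun st :: "nat list \<Rightarrow> nat list \<Rightarrow> nat list \<Rightarrow> nat list \<Rightarrow> store" where
  "st m a b c RM = m"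
| "st m a b c RA = a"
| "st m a b c RB = b"
| "st m a b c RC = c"
| "st m a b c r = []"

lemma st_upd [simp]:
  "(st m a b c)(RM := x) = st x a b c"
  "(st m a b c)(RA := x) = st m x b c"
  "(st m a b c)(RB := x) = st m a x c"
  "(st m a b c)(RC := x) = st m a b x"
proof -
  have "st x a b c r = ((st m a b c)(RM := x)) r" "st m x b c r = ((st m a b c)(RA := x)) r"
    "st m a x c r = ((st m a b c)(RB := x)) r" "st m a b x r = ((st m a b c)(RC := x)) r" for r
    by (cases r; simp)+
  then show "(st m a b c)(RM := x) = st x a b c" "(st m a b c)(RA := x) = st m x b c"
    "(st m a b c)(RB := x) = st m a x c" "(st m a b c)(RC := x) = st m a b x"
    by (metis ext)+
qed

section \<open>Moving symbols and trees between stacks\<close>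

definition mv :: "reg \<Rightarrow> reg \<Rightarrow> cmd" where
  "mv r r' = If r (\<lambda>s. s = 1) (Seq (Pop r) (Push r' False)) (Seq (Pop r) (Push r' True))"

lemma ex_mv:
  assumes "S r = x # xs" "x = 1 \<or> x = 2" "r \<noteq> r'" "S' = S(r := xs, r' := x # S r')" "4 \<le> T"
  shows "ex (mv r r') S S' T"
proof -
  have p: "ex (Pop r) S (S(r := xs)) 1" by (rule ex_Pop) (use assms in auto)
  have "ex (mv r r') S (S(r := xs, r' := x # S r')) 4"
  proof (cases "x = 1")
    case True
    show ?thesis unfolding mv_def
      by (rule ex_If_True[where U = 3], use assms True in simp,
          rule ex_Seq[OF p ex_Push[OF _ order_refl]])
         (use assms True in auto)
  next
    case False
    show ?thesis unfolding mv_def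
      by (rule ex_If_False[where U = 3], use assms False in simp,
          rule ex_Seq[OF p ex_Push[OF _ order_refl]])
         (use assms False in auto)
  qed
  then show ?thesis using assms ex_mono by blast
qed

definition pour :: "reg \<Rightarrow> reg \<Rightarrow> cmd" where
  "pour r r' = While r (\<lambda>s. s \<noteq> 0) (mv r r')"

lemma ex_pour:
  assumes "S r = xs" "symbols xs" "r \<noteq> r'" "S' = S(r := [], r' := rev xs @ S r')" "5 * length xs + 1 \<le> T"
  shows "ex (pour r r') S S' T"
proof -
  have "ex (pour r r') S (S(r := [], r' := rev xs @ S r')) (5 * length xs + 1)"
    using assms(1,2)
  proof (induction xs arbitrary: S)
    case Nil
    then have "S = S(r := [], r' := rev [] @ S r')" by auto
    then show ?case unfolding pour_def using Nil by (metis One_nat_def ex_While_False le_add2 peek_simps(1))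
  next
    case (Cons x xs)
    let ?S = "S(r := xs, r' := x # S r')"
    have 1: "ex (mv r r') S ?S 4" by (rule ex_mv) (use Cons assms in auto)
    have 2: "ex (pour r r') ?S (?S(r := [], r' := rev xs @ ?S r')) (5 * length xs + 1)"
      by (rule Cons.IH) (use Cons assms in auto)
    have 3: "?S(r := [], r' := rev xs @ ?S r') = S(r := [], r' := rev (x # xs) @ S r')"
      using assms(3) by auto
    show ?case unfolding pour_def
      by (rule ex_While_True[OF _ 1 2[unfolded pour_def 3]]) (use Cons.prems in auto)
  qed
  then show ?thesis using assms ex_mono by blast
qed

definition clear :: "reg \<Rightarrow> cmd" where
  "clear r = While r (\<lambda>s. s \<noteq> 0) (Pop r)"

lemma ex_clear:
  assumes "S r = xs" "symbols xs" "S' = S(r := [])" "2 * length xs + 1 \<le> T"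
  shows "ex (clear r) S S' T"
proof -
  have "ex (clear r) S (S(r := [])) (2 * length xs + 1)"
    using assms(1,2)
  proof (induction xs arbitrary: S)
    case Nil
    then have "S = S(r := [])" by auto
    then show ?case unfolding clear_def using Nil by (metis One_nat_def ex_While_False le_add2 peek_simps(1))
  next
    case (Cons x xs)
    have p: "ex (Pop r) S (S(r := xs)) 1" by (rule ex_Pop) (use Cons.prems in auto)
    have 2: "ex (clear r) (S(r := xs)) (S(r := [])) (2 * length xs + 1)"
      by (rule Cons.IH[of "S(r := xs)", unfolded fun_upd_same fun_upd_upd, OF refl]) (use Cons.prems(2) in simp)
    show ?case unfolding clear_def
      by (rule ex_While_True[OF _ p 2[unfolded clear_def]])
         (use Cons.prems in auto)
  qed
  then show ?thesis using assms ex_mono by blast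
qed

text \<open>\<open>RC\<close> holds one symbol for each tree that is still to be read from \<open>RM\<close>.\<close>

definition take_loop :: "reg \<Rightarrow> cmd" where
  "take_loop r = While RC (\<lambda>s. s \<noteq> 0)
     (If RM (\<lambda>s. s = 1) (Seq (Pop RC) (mv RM r)) (Seq (Push RC False) (mv RM r)))"

definition takev :: "reg \<Rightarrow> cmd" where
  "takev r = Seq (Push RC False) (take_loop r)"

text \<open>Generalised to a list of pending trees: a leaf completes one of them, and a node
  replaces one by its two children, so it adds one to the counter. The induction is on the total
  length of the pending trees.\<close>

lemma ex_take_loop:
  assumes "S RM = concat (map ser ds) @ rest" "S RC = replicate (length ds) 1" "r \<noteq> RM" "r \<noteq> RC"
  shows "ex (take_loop r) S (S(RM := rest, RC := [], r := rev (concat (map ser ds)) @ S r))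
    (8 * length (concat (map ser ds)) + 1)"
  using assms(1,2)
proof (induction "length (concat (map ser ds))" arbitrary: ds S rule: less_induct)
  case less
  show ?case
  proof (cases ds)
    case Nil
    then have "S(RM := rest, RC := [], r := rev (concat (map ser ds)) @ S r) = S"
      using less.prems assms by auto
    then show ?thesis unfolding take_loop_def using Nil less.prems by (auto intro: ex_While_False)
  next
    case (Cons d ds')
    show ?thesis
    proof (cases d)
      case Leaf
      let ?S1 = "S(RC := replicate (length ds') 1)"
      let ?S = "?S1(RM := concat (map ser ds') @ rest, r := 1 # S r)"
      have b: "ex (If RM (\<lambda>s. s = 1) (Seq (Pop RC) (mv RM r)) (Seq (Push RC False) (mv RM r))) S ?S 7"
        by (rule ex_If_True[where U = 5], use less.prems Cons Leaf in simp,
            rule ex_Seq[where ?S1.0 = ?S1, OF ex_Pop[OF _ _ order_refl] ex_mv[where T = 4]])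
           (use less.prems Cons Leaf assms in auto)
      have "ex (take_loop r) ?S (?S(RM := rest, RC := [], r := rev (concat (map ser ds')) @ ?S r))
          (8 * length (concat (map ser ds')) + 1)"
        by (rule less.hyps) (use Cons Leaf assms in auto)
      also have "?S(RM := rest, RC := [], r := rev (concat (map ser ds')) @ ?S r)
          = S(RM := rest, RC := [], r := rev (concat (map ser ds)) @ S r)"
        using Cons Leaf assms by auto
      finally have l: "ex (take_loop r) ?S \<dots> (8 * length (concat (map ser ds')) + 1)" .
      show ?thesis
        unfolding take_loop_def
        by (rule ex_While_True[OF _ b l[unfolded take_loop_def]]) (use less.prems Cons Leaf in auto)
    next
      case (Node a e)
      let ?S1 = "S(RC := replicate (length ds' + 2) 1)"
      let ?S = "?S1(RM := concat (map ser (a # e # ds')) @ rest, r := 2 # S r)"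
      have b: "ex (If RM (\<lambda>s. s = 1) (Seq (Pop RC) (mv RM r)) (Seq (Push RC False) (mv RM r))) S ?S 7"
        by (rule ex_If_False[where U = 6], use less.prems Cons Node in simp,
            rule ex_Seq[where ?S1.0 = ?S1, OF ex_Push[OF _ order_refl] ex_mv[where T = 4]])
           (use less.prems Cons Node assms in auto)
      have "ex (take_loop r) ?S (?S(RM := rest, RC := [], r := rev (concat (map ser (a # e # ds'))) @ ?S r))
          (8 * length (concat (map ser (a # e # ds'))) + 1)"
        by (rule less.hyps) (use Cons Node assms in auto)
      also have "?S(RM := rest, RC := [], r := rev (concat (map ser (a # e # ds'))) @ ?S r)
          = S(RM := rest, RC := [], r := rev (concat (map ser ds)) @ S r)"
        using Cons Node assms by auto
      finally have l: "ex (take_loop r) ?S \<dots> (8 * length (concat (map ser (a # e # ds'))) + 1)" .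
      show ?thesis
        unfolding take_loop_def
        by (rule ex_While_True[OF _ b l[unfolded take_loop_def]]) (use less.prems Cons Node in auto)
    qed
  qed
qed

lemma ex_takev:
  assumes "S RM = ser d @ rest" "S RC = []" "r \<noteq> RM" "r \<noteq> RC"
    "S' = S(RM := rest, r := rev (ser d) @ S r)" "8 * sz d + 3 \<le> T"
  shows "ex (takev r) S S' T"
proof -
  let ?S = "S(RC := [1])"
  have 1: "ex (Push RC False) S ?S 2" by (rule ex_Push) (use assms in auto)
  have 2: "ex (take_loop r) ?S (?S(RM := rest, RC := [], r := rev (ser d) @ ?S r)) (8 * sz d + 1)"
    using ex_take_loop[of ?S "[d]" rest r] assms by simp
  have 3: "?S(RM := rest, RC := [], r := rev (ser d) @ ?S r) = S'"
    using assms by (auto simp: fun_eq_iff)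
  show ?thesis unfolding takev_def by (rule ex_Seq[OF 1 2[unfolded 3]]) (use assms in auto)
qed

text \<open>The main stack is viewed as a stack of trees, with the scratch stacks empty before and
  after. Quantifying over the rest of the main stack builds in the frame rule.\<close>

definition run :: "cmd \<Rightarrow> data list \<Rightarrow> data list \<Rightarrow> nat \<Rightarrow> bool" where
  "run c ds es T \<longleftrightarrow> (\<forall>rest. ex c (st (concat (map ser ds) @ rest) [] [] [])
     (st (concat (map ser es) @ rest) [] [] []) T)"

lemma run_mono: "run c ds es T \<Longrightarrow> T \<le> T' \<Longrightarrow> run c ds es T'"
  unfolding run_def using ex_mono by blast

lemma run_Seq: "run c ds es T \<Longrightarrow> run c' es fs T' \<Longrightarrow> T + T' \<le> U \<Longrightarrow> run (Seq c c') ds fs U"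
  unfolding run_def using ex_Seq by blast

lemma run_frame: "run c ds es T \<Longrightarrow> run c (ds @ fs) (es @ fs) T"
  unfolding run_def by simp

lemma run_frame1: "run c [d] es T \<Longrightarrow> run c (d # fs) (es @ fs) T"
  using run_frame[of c "[d]" es T fs] by simp

lemma run_length: "run c ds es T \<Longrightarrow> length (concat (map ser es)) \<le> length (concat (map ser ds)) + T"
proof -
  assume "run c ds es T"
  then have "ex c (st (concat (map ser ds) @ []) [] [] []) (st (concat (map ser es) @ []) [] [] []) T"
    unfolding run_def by blast
  then show ?thesis unfolding ex_def using exec_length[of c _ _ _ RM] by fastforce
qed

definition drop_top :: cmd where
  "drop_top = Seq (takev RA) (clear RA)"

lemma run_drop_top: "10 * sz d + 4 \<le> T \<Longrightarrow> run drop_top [d] [] T"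
  unfolding run_def drop_top_def
  by (intro allI, rule ex_Seq, rule ex_takev[OF _ _ _ _ refl order_refl], (simp; fail)+,
      rule ex_clear[OF refl _ _ order_refl]) auto

definition swap_top :: cmd where
  "swap_top = Seq (takev RA) (Seq (takev RB) (Seq (pour RA RM) (pour RB RM)))"

lemma run_swap_top: "13 * (sz d + sz e) + 8 \<le> T \<Longrightarrow> run swap_top [d, e] [e, d] T"
  unfolding run_def swap_top_def
  by (intro allI, rule ex_Seq, rule ex_takev[OF _ _ _ _ refl order_refl], (simp; fail)+,
      rule ex_Seq, rule ex_takev[OF _ _ _ _ refl order_refl], (simp; fail)+,
      rule ex_Seq, rule ex_pour[OF refl _ _ refl order_refl], (simp; fail)+,
      rule ex_pour[OF refl _ _ _ order_refl]) auto

definition dup_loop :: cmd where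
  "dup_loop = While RA (\<lambda>s. s \<noteq> 0) (If RA (\<lambda>s. s = 1)
     (Seq (Pop RA) (Seq (Push RM False) (Push RB False)))
     (Seq (Pop RA) (Seq (Push RM True) (Push RB True))))"

lemma ex_dup_loop:
  "symbols as \<Longrightarrow> ex dup_loop (st m as bs []) (st (rev as @ m) [] (rev as @ bs) []) (7 * length as + 1)"
proof (induction as arbitrary: m bs)
  case Nil
  then show ?case unfolding dup_loop_def by (auto intro: ex_While_False)
next
  case (Cons a as)
  have 1: "ex (If RA (\<lambda>s. s = 1)
     (Seq (Pop RA) (Seq (Push RM False) (Push RB False)))
     (Seq (Pop RA) (Seq (Push RM True) (Push RB True)))) (st m (a # as) bs []) (st (a # m) as (a # bs) []) 6"
  proof (cases "a = 1")
    case True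
    show ?thesis
      by (rule ex_If_True[where U = 5], use True in simp,
          rule ex_Seq[OF ex_Pop[OF _ refl order_refl] ex_Seq[OF ex_Push[OF refl order_refl] ex_Push[OF _ order_refl] order_refl]])
         (use True in auto)
  next
    case False
    show ?thesis
      by (rule ex_If_False[where U = 5], use False in simp,
          rule ex_Seq[OF ex_Pop[OF _ refl order_refl] ex_Seq[OF ex_Push[OF refl order_refl] ex_Push[OF _ order_refl] order_refl]])
         (use False Cons.prems in auto)
  qed
  have 2: "ex dup_loop (st (a # m) as (a # bs) []) (st (rev as @ a # m) [] (rev as @ a # bs) []) (7 * length as + 1)"
    using Cons by auto
  show ?case unfolding dup_loop_def
    by (rule ex_While_True[OF _ 1]) (use 2 Cons.prems in \<open>auto simp: dup_loop_def\<close>)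
qed

text \<open>The loop leaves the second copy on \<open>RB\<close> in reading order. Each pour
  reverses it, so it takes two pours to bring it onto \<open>RM\<close> the right way round.\<close>

definition dup_top :: cmd where
  "dup_top = Seq (takev RA) (Seq dup_loop (Seq (pour RB RA) (pour RA RM)))"

lemma run_dup_top: "25 * sz d + 6 \<le> T \<Longrightarrow> run dup_top [d] [d, d] T"
  unfolding run_def dup_top_def
  by (intro allI, rule ex_Seq, rule ex_takev[OF _ _ _ _ refl order_refl], (simp; fail)+,
      rule ex_Seq, simp, rule ex_dup_loop, (simp; fail)+,
      rule ex_Seq, rule ex_pour[OF refl _ _ refl order_refl], (simp; fail)+,
      rule ex_pour[OF refl _ _ _ order_refl]) auto

lemma run_join: "run (Push RM True) [a, b] [Node a b] 2"
  unfolding run_def by (auto intro!: ex_Push)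

lemma run_split: "run (Pop RM) [Node a b] [a, b] 1"
  unfolding run_def by (auto intro!: ex_Pop)

lemma run_unleaf: "run (Pop RM) [Leaf] [] 1"
  unfolding run_def by (auto intro!: ex_Pop)

primrec const_cmd :: "data \<Rightarrow> cmd" where
  "const_cmd Leaf = Push RM False"
| "const_cmd (Node a b) = Seq (const_cmd b) (Seq (const_cmd a) (Push RM True))"

lemma ex_const: "S' = S(RM := ser d @ S RM) \<Longrightarrow> 2 * sz d \<le> T \<Longrightarrow> ex (const_cmd d) S S' T"
proof (induction d arbitrary: S S' T)
  case Leaf
  show ?case unfolding const_cmd.simps by (rule ex_Push) (use Leaf in auto)
next
  case (Node a b)
  show ?case unfolding const_cmd.simps
    by (rule ex_Seq[OF Node.IH(2)[OF refl order_refl] ex_Seq[OF Node.IH(1)[OF refl order_refl]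
          ex_Push[OF _ order_refl] order_refl]]) (use Node.prems in auto)
qed

lemma run_const: "run (const_cmd d) [] [d] (2 * sz d)"
  unfolding run_def by (auto intro!: ex_const)

lemma run_if_Leaf: "run c ds es T \<Longrightarrow> T + 1 \<le> U \<Longrightarrow> ds = Leaf # ds' \<Longrightarrow> run (If RM (\<lambda>s. s = 1) c c') ds es U"
  unfolding run_def by (auto intro!: ex_If_True)

lemma run_if_Node: "run c' ds es T \<Longrightarrow> T + 1 \<le> U \<Longrightarrow> ds = Node a b # ds' \<Longrightarrow> run (If RM (\<lambda>s. s = 1) c c') ds es U"
  unfolding run_def by (auto intro!: ex_If_False)

lemma run_while_Leaf: "run (While RM (\<lambda>s. s = 2) c) (Leaf # ds) (Leaf # ds) 1"
  unfolding run_def by (auto intro!: ex_While_False)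

lemma run_while_Node:
  "run c (Node a b # ds) es T1 \<Longrightarrow> run (While RM (\<lambda>s. s = 2) c) es fs T2 \<Longrightarrow> T1 + T2 + 1 \<le> T \<Longrightarrow>
   run (While RM (\<lambda>s. s = 2) c) (Node a b # ds) fs T"
  unfolding run_def by (auto intro: ex_While_True)

text \<open>The flag on \<open>RC\<close> is 2 while no difference has been found. A push followed
  by a pop of the same stack serves as the command that does nothing.\<close>

definition eq_loop :: cmd where
  "eq_loop = While RA (\<lambda>s. s \<noteq> 0) (Seq
     (If RA (\<lambda>s. s = 1)
       (If RB (\<lambda>s. s = 1) (Pop RB) (Seq (Seq (Pop RC) (Push RC False)) (If RB (\<lambda>s. s \<noteq> 0) (Pop RB) (Seq (Push RB True) (Pop RB)))))
       (If RB (\<lambda>s. s = 2) (Pop RB) (Seq (Seq (Pop RC) (Push RC False)) (If RB (\<lambda>s. s \<noteq> 0) (Pop RB) (Seq (Push RB True) (Pop RB))))))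
     (Pop RA))"

definition eq_top :: cmd where
  "eq_top = Seq (takev RA) (Seq (takev RB) (Seq (Push RC True) (Seq eq_loop
     (Seq (If RB (\<lambda>s. s = 0) (Seq (Push RB True) (Pop RB)) (Seq (Pop RC) (Push RC False)))
     (Seq (clear RB)
       (If RC (\<lambda>s. s = 1) (Seq (Pop RC) (const_cmd Leaf))
          (Seq (Pop RC) (const_cmd (Node Leaf Leaf)))))))))"

lemma ex_eq_loop:
  assumes "symbols as" "symbols bs"
  shows "ex eq_loop (st m as bs [bit_symbol f])
    (st m [] (drop (length as) bs) [bit_symbol (f \<and> (take (length as) bs = as))]) (12 * length as + 1)"
  using assms
proof (induction as arbitrary: bs f)
  case Nil
  then show ?case unfolding eq_loop_def by (auto intro: ex_While_False)
next
  case (Cons a as)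
  let ?bad = "Seq (Seq (Pop RC) (Push RC False)) (If RB (\<lambda>s. s \<noteq> 0) (Pop RB) (Seq (Push RB True) (Pop RB)))"
  let ?f = "f \<and> bs \<noteq> [] \<and> hd bs = a"
  have flag: "ex (Seq (Pop RC) (Push RC False)) (st m (a # as) bs [bit_symbol f]) (st m (a # as) bs [1]) 3"
    by (rule ex_Seq[OF ex_Pop[OF _ refl order_refl] ex_Push[OF _ order_refl]]) auto
  have bad: "ex ?bad (st m (a # as) bs [bit_symbol f]) (st m (a # as) (tl bs) [1]) 8"
  proof (cases bs)
    case Nil
    show ?thesis
      by (rule ex_Seq[OF flag
            ex_If_False[OF _ ex_Seq[OF ex_Push[OF refl order_refl] ex_Pop[OF _ _ order_refl] order_refl] order_refl]])
         (use Nil in auto)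
  next
    case (Cons b bs')
    show ?thesis
      by (rule ex_Seq[OF flag
            ex_If_True[OF _ ex_Pop[OF _ _ order_refl] order_refl]])
         (use Cons Cons.prems in auto)
  qed
  have t: "ex (If RB (\<lambda>s. s = a) (Pop RB) ?bad) (st m (a # as) bs [bit_symbol f]) (st m (a # as) (tl bs) [bit_symbol ?f]) 9"
  proof (cases "peek bs = a")
    case True
    then obtain bs' where "bs = a # bs'" using Cons.prems by (cases bs) auto
    then show ?thesis by (intro ex_If_True[where U = 1] ex_Pop[OF _ _ order_refl]) auto
  next
    case False
    then have "\<not> ?f" by (cases bs) auto
    then show ?thesis using False bad by (intro ex_If_False[where U = 8]) auto
  qed
  have 1: "ex (If RA (\<lambda>s. s = 1) (If RB (\<lambda>s. s = 1) (Pop RB) ?bad) (If RB (\<lambda>s. s = 2) (Pop RB) ?bad))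
     (st m (a # as) bs [bit_symbol f]) (st m (a # as) (tl bs) [bit_symbol ?f]) 10"
  proof (cases "a = 1")
    case True
    show ?thesis by (rule ex_If_True[where U = 9]) (use t True in auto)
  next
    case False
    show ?thesis by (rule ex_If_False[where U = 9]) (use t False Cons.prems in auto)
  qed
  have 2: "ex (Pop RA) (st m (a # as) (tl bs) [bit_symbol ?f]) (st m as (tl bs) [bit_symbol ?f]) 1"
    by (auto intro!: ex_Pop)
  have 3: "ex eq_loop (st m as (tl bs) [bit_symbol ?f])
      (st m [] (drop (length as) (tl bs)) [bit_symbol (?f \<and> take (length as) (tl bs) = as)]) (12 * length as + 1)"
  proof (rule Cons.IH)
    show "symbols as" "symbols (tl bs)" using Cons.prems by (simp, cases bs, auto)
  qed
  have 4: "(?f \<and> take (length as) (tl bs) = as) \<longleftrightarrow> (f \<and> take (length (a # as)) bs = a # as)"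
    by (cases bs) auto
  have 5: "drop (length as) (tl bs) = drop (length (a # as)) bs" by (cases bs) auto
  show ?case unfolding eq_loop_def
    by (rule ex_While_True[OF _ ex_Seq[OF 1 2 order_refl] 3[unfolded eq_loop_def 4 5]])
       (use Cons.prems in auto)
qed

lemma ser_prefix: "ser d @ xs = ser e @ ys \<Longrightarrow> d = e \<and> xs = ys"
proof (induction d arbitrary: e xs ys)
  case Leaf
  then show ?case by (cases e) auto
next
  case (Node a b)
  show ?case
  proof (cases e)
    case Leaf
    then show ?thesis using Node.prems by simp
  next
    case e: (Node a' b')
    then have "ser a @ (ser b @ xs) = ser a' @ (ser b' @ ys)" using Node.prems by simp
    from Node.IH(1)[OF this] Node.IH(2)[of xs b' ys] e show ?thesis by simp
  qed
qed

lemma ser_inject [simp]: "ser d = ser e \<longleftrightarrow> d = e"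
  using ser_prefix[of d "[]" e "[]"] by auto

lemma run_eq_top:
  "run eq_top [d, e] [if d = e then Node Leaf Leaf else Leaf] (50 * (sz d + sz e) + 50)"
  unfolding run_def
proof
  fix rest
  let ?a = "rev (ser d)" and ?b = "rev (ser e)"
  let ?f = "take (length ?a) ?b = ?a" and ?r = "drop (length ?a) ?b"
  have 1: "ex (takev RA) (st (concat (map ser [d, e]) @ rest) [] [] []) (st (ser e @ rest) ?a [] []) (8 * sz d + 3)"
    by (rule ex_takev) auto
  have 2: "ex (takev RB) (st (ser e @ rest) ?a [] []) (st rest ?a ?b []) (8 * sz e + 3)"
    by (rule ex_takev) auto
  have 3: "ex (Push RC True) (st rest ?a ?b []) (st rest ?a ?b [bit_symbol True]) 2"
    by (rule ex_Push) auto
  have 4: "ex eq_loop (st rest ?a ?b [bit_symbol True]) (st rest [] ?r [bit_symbol ?f]) (12 * sz d + 1)"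
    using ex_eq_loop[of ?a ?b rest True] by auto
  \<comment> \<open>\<open>eq_loop\<close> compares only as many symbols as the first tree has;
    symbols left over on \<open>RB\<close> also mean that the trees differ.\<close>
  have 5: "ex (If RB (\<lambda>s. s = 0) (Seq (Push RB True) (Pop RB)) (Seq (Pop RC) (Push RC False)))
      (st rest [] ?r [bit_symbol ?f]) (st rest [] ?r [bit_symbol (d = e)]) 4"
  proof (cases "?r = []")
    case True
    then have "?f \<longleftrightarrow> d = e" by auto
    then show ?thesis using True
      by (intro ex_If_True[where U = 3] ex_Seq[OF ex_Push[OF refl order_refl] ex_Pop[OF _ _ order_refl]])
         auto
  next
    case False
    then have "d \<noteq> e" by auto
    moreover have "peek ?r \<noteq> 0"
    proof -
      have "symbols ?r" using symbols_ser[of e] by (metis append_take_drop_id symbols_simps(3,4))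
      then show ?thesis using False by (cases ?r) auto
    qed
    ultimately show ?thesis
      by (intro ex_If_False[where U = 3] ex_Seq[OF ex_Pop[OF _ refl order_refl] ex_Push[OF _ order_refl]])
         auto
  qed
  have 6: "ex (clear RB) (st rest [] ?r [bit_symbol (d = e)]) (st rest [] [] [bit_symbol (d = e)]) (2 * sz e + 1)"
  proof (rule ex_clear[OF refl])
    show "symbols (st rest [] ?r [bit_symbol (d = e)] RB)"
      using symbols_ser[of e] by (simp, metis append_take_drop_id symbols_simps(3,4))
  qed auto
  have 7: "ex (If RC (\<lambda>s. s = 1) (Seq (Pop RC) (const_cmd Leaf)) (Seq (Pop RC) (const_cmd (Node Leaf Leaf))))
     (st rest [] [] [bit_symbol (d = e)])
     (st (concat (map ser [if d = e then Node Leaf Leaf else Leaf]) @ rest) [] [] []) 10"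
  proof (cases "d = e")
    case True
    show ?thesis
      by (rule ex_If_False[OF _ ex_Seq[OF ex_Pop[OF _ refl order_refl] _ order_refl]])
         (use True run_const[of "Node Leaf Leaf"] in \<open>auto simp: run_def\<close>)
  next
    case False
    show ?thesis
      by (rule ex_If_True[OF _ ex_Seq[OF ex_Pop[OF _ refl order_refl] _ order_refl]])
         (use False run_const[of "Leaf"] in \<open>auto simp: run_def\<close>)
  qed
  show "ex eq_top (st (concat (map ser [d, e]) @ rest) [] [] [])
     (st (concat (map ser [if d = e then Node Leaf Leaf else Leaf]) @ rest) [] [] []) (50 * (sz d + sz e) + 50)"
    unfolding eq_top_def
    by (rule ex_Seq[OF 1 ex_Seq[OF 2 ex_Seq[OF 3 ex_Seq[OF 4 ex_Seq[OF 5 ex_Seq[OF 6 7 order_refl] order_refl] order_refl] order_refl] order_refl]])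
       auto
qed

section \<open>Polynomial-time functions between encodable types\<close>

text \<open>With base n + 2 \<ge> 2 a single exponent absorbs all constants and coefficients, so
  sums, products and compositions of bounds need only one parameter.\<close>

definition pb :: "(nat \<Rightarrow> nat) \<Rightarrow> bool" where
  "pb f \<longleftrightarrow> (\<exists>k. \<forall>n. f n \<le> (n + 2) ^ k)"

named_theorems pb_intros
named_theorems fp_intros

lemma pbI: "(\<And>n. f n \<le> (n + 2) ^ k) \<Longrightarrow> pb f"
  unfolding pb_def by blast

lemma pb_const [pb_intros]: "pb (\<lambda>n. c)"
proof (rule pbI)
  fix n :: nat
  have "c \<le> 2 ^ c" by (simp add: less_imp_le)
  also have "\<dots> \<le> (n + 2) ^ c" by (rule power_mono) auto
  finally show "c \<le> (n + 2) ^ c" .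
qed

lemma pb_id [pb_intros]: "pb (\<lambda>n. n)"
  by (rule pbI[where k = 1]) simp

lemma pb_mult [pb_intros]:
  assumes "pb f" "pb g" shows "pb (\<lambda>n. f n * g n)"
proof -
  obtain a b where "\<And>n. f n \<le> (n + 2) ^ a" "\<And>n. g n \<le> (n + 2) ^ b"
    using assms unfolding pb_def by blast
  then have "f n * g n \<le> (n + 2) ^ (a + b)" for n
    by (simp add: power_add mult_le_mono)
  then show ?thesis by (rule pbI)
qed

lemma pb_add [pb_intros]:
  assumes "pb f" "pb g" shows "pb (\<lambda>n. f n + g n)"
proof -
  obtain a b where ab: "\<And>n. f n \<le> (n + 2) ^ a" "\<And>n. g n \<le> (n + 2) ^ b"
    using assms unfolding pb_def by blast
  have "f n + g n \<le> (n + 2) ^ (Suc (a + b))" for n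
  proof -
    have "f n \<le> (n + 2) ^ (a + b)" "g n \<le> (n + 2) ^ (a + b)"
      by (rule order_trans[OF ab(1) power_increasing] order_trans[OF ab(2) power_increasing]; simp)+
    then have "f n + g n \<le> 2 * (n + 2) ^ (a + b)" by simp
    also have "\<dots> \<le> (n + 2) * (n + 2) ^ (a + b)" by (rule mult_le_mono1) simp
    finally show ?thesis by simp
  qed
  then show ?thesis by (rule pbI)
qed

lemma pb_Suc [pb_intros]: "pb f \<Longrightarrow> pb (\<lambda>n. Suc (f n))"
  using pb_add[OF _ pb_const[of 1], of f] by simp

lemma pb_power [pb_intros]: "pb f \<Longrightarrow> pb (\<lambda>n. f n ^ k)"
  by (induction k) (auto intro: pb_intros)

text \<open>Injectivity is what allows equality of values to be decided by comparing trees.\<close>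

class enc =
  fixes enc :: "'a \<Rightarrow> data"
  assumes enc_inject [simp]: "enc x = enc y \<longleftrightarrow> x = y"

instantiation data :: enc begin
definition [simp]: "enc (d :: data) = d"
instance by standard simp
end

instantiation unit :: enc begin
definition [simp]: "enc (u :: unit) = Leaf"
instance by standard simp
end

instantiation bool :: enc begin
definition enc_bool where "enc b = (if b then Node Leaf Leaf else Leaf)"
instance by standard (auto simp: enc_bool_def)
end

lemma enc_bool_simps [simp]: "enc False = Leaf" "enc True = Node Leaf Leaf"
  by (simp_all add: enc_bool_def)

instantiation prod :: (enc, enc) enc begin
definition "enc p = Node (enc (fst p)) (enc (snd p))"
instance by standard (auto simp: enc_prod_def prod_eq_iff)
end

lemma enc_Pair [simp]: "enc (x, y) = Node (enc x) (enc y)"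
  by (simp add: enc_prod_def)

instantiation list :: (enc) enc begin
primrec enc_list where
  "enc_list [] = Leaf"
| "enc_list (x # xs) = Node (enc x) (enc_list xs)"
instance
proof
  fix xs ys :: "'a list"
  show "enc xs = enc ys \<longleftrightarrow> xs = ys"
  proof (induction xs arbitrary: ys)
    case Nil
    then show ?case by (cases ys) auto
  next
    case (Cons x xs)
    then show ?case by (cases ys) auto
  qed
qed
end

text \<open>Unary, because natural numbers occur as lengths, indices and time bounds, which are
  polynomial in the size of the input anyway. A number then acts as a loop counter.\<close>

instantiation nat :: enc begin
definition "enc (n :: nat) = enc (replicate n ())"
instance by standard (auto simp: enc_nat_def)
end

definition fp :: "('a::enc \<Rightarrow> 'b::enc) \<Rightarrow> bool" where
  "fp f \<longleftrightarrow> (\<exists>c k. \<forall>x. run c [enc x] [enc (f x)] ((sz (enc x) + 2) ^ k))"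

lemma fpI: "pb T \<Longrightarrow> (\<And>x. run c [enc x] [enc (f x)] (T (sz (enc x)))) \<Longrightarrow> fp f"
  unfolding fp_def pb_def using run_mono by blast

lemma fpE:
  assumes "fp f"
  obtains c k where "\<And>x. run c [enc x] [enc (f x)] ((sz (enc x) + 2) ^ k)"
  using assms unfolding fp_def by blast

text \<open>A program sees only trees. Functions whose values have the same codes are computed by
  the same program, which transfers results between pairs and conses, or between numbers and lists
  of units.\<close>

lemma fp_retype: "fp g \<Longrightarrow> (\<And>x. enc (f x) = enc (g x)) \<Longrightarrow> fp f"
  unfolding fp_def by simp

lemma fp_size:
  assumes "fp f"
  obtains k where "\<And>x. sz (enc (f x)) \<le> (sz (enc x) + 2) ^ k"
proof -
  from assms obtain c k where c: "\<And>x. run c [enc x] [enc (f x)] ((sz (enc x) + 2) ^ k)"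
    by (rule fpE) blast
  have "pb (\<lambda>n. n + (n + 2) ^ k)" by (intro pb_intros)
  then obtain k' where "\<And>n :: nat. n + (n + 2) ^ k \<le> (n + 2) ^ k'" unfolding pb_def by blast
  with run_length[OF c] show ?thesis using that by simp (meson le_trans)
qed

lemma run_skip: "run (Seq (Push RM True) (Pop RM)) ds ds 3"
  unfolding run_def by (intro allI, rule ex_Seq[OF ex_Push[OF refl order_refl] ex_Pop[OF _ _ order_refl]]) auto

lemma fp_id [fp_intros]: "fp (\<lambda>x. x)"
  by (rule fpI[OF pb_const run_skip])

lemma fp_const [fp_intros]: "fp (\<lambda>x. c)"
proof -
  have "run (Seq drop_top (const_cmd (enc c))) [enc x] [enc c] (10 * sz (enc x) + (4 + 2 * sz (enc c)))"
    for x :: 'a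
    by (rule run_Seq[OF run_drop_top[OF order_refl] run_const]) simp
  moreover have "pb (\<lambda>n. 10 * n + (4 + 2 * sz (enc c)))" by (intro pb_intros)
  ultimately show ?thesis by (rule fpI[rotated])
qed

lemma fp_comp:
  assumes "fp f" "fp g" shows "fp (\<lambda>x. f (g x))"
proof -
  obtain c k where c: "\<And>x. run c [enc x] [enc (f x)] ((sz (enc x) + 2) ^ k)" using assms(1) by (rule fpE) blast
  obtain d l where d: "\<And>x. run d [enc x] [enc (g x)] ((sz (enc x) + 2) ^ l)" using assms(2) by (rule fpE) blast
  obtain m where m: "\<And>x. sz (enc (g x)) \<le> (sz (enc x) + 2) ^ m" using assms(2) by (rule fp_size) blast
  have "run (Seq d c) [enc x] [enc (f (g x))] ((sz (enc x) + 2) ^ l + ((sz (enc x) + 2) ^ m + 2) ^ k)" for x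
    by (rule run_Seq[OF d run_mono[OF c order_refl]]) (use m[of x] in \<open>auto intro!: power_mono\<close>)
  moreover have "pb (\<lambda>n. (n + 2) ^ l + ((n + 2) ^ m + 2) ^ k)" by (intro pb_intros)
  ultimately show ?thesis by (rule fpI[rotated])
qed

lemma fp_Pair [fp_intros]:
  assumes "fp f" "fp g" shows "fp (\<lambda>x. (f x, g x))"
proof -
  obtain c k where c: "\<And>x. run c [enc x] [enc (f x)] ((sz (enc x) + 2) ^ k)" using assms(1) by (rule fpE) blast
  obtain d l where d: "\<And>x. run d [enc x] [enc (g x)] ((sz (enc x) + 2) ^ l)" using assms(2) by (rule fpE) blast
  obtain i where i: "\<And>x. sz (enc (f x)) \<le> (sz (enc x) + 2) ^ i" using assms(1) by (rule fp_size) blast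
  obtain j where j: "\<And>x. sz (enc (g x)) \<le> (sz (enc x) + 2) ^ j" using assms(2) by (rule fp_size) blast
  let ?T = "\<lambda>n. (25 * n + 6) + ((n + 2) ^ k + ((13 * ((n + 2) ^ i + n) + 8) + ((n + 2) ^ l +
    ((13 * ((n + 2) ^ j + (n + 2) ^ i) + 8) + 2))))"
  have "run (Seq dup_top (Seq c (Seq swap_top (Seq d (Seq swap_top (Push RM True))))))
      [enc x] [enc (f x, g x)] (?T (sz (enc x)))" for x
  proof -
    have 1: "run dup_top [enc x] [enc x, enc x] (25 * sz (enc x) + 6)" by (rule run_dup_top) simp
    have 2: "run c [enc x, enc x] [enc (f x), enc x] ((sz (enc x) + 2) ^ k)"
      using run_frame1[OF c] by simp
    have 3: "run swap_top [enc (f x), enc x] [enc x, enc (f x)] (13 * ((sz (enc x) + 2) ^ i + sz (enc x)) + 8)"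
      by (rule run_swap_top) (use i[of x] in simp)
    have 4: "run d [enc x, enc (f x)] [enc (g x), enc (f x)] ((sz (enc x) + 2) ^ l)"
      using run_frame1[OF d] by simp
    have 5: "run swap_top [enc (g x), enc (f x)] [enc (f x), enc (g x)]
        (13 * ((sz (enc x) + 2) ^ j + (sz (enc x) + 2) ^ i) + 8)"
      by (rule run_swap_top) (use i[of x] j[of x] in simp)
    show ?thesis
      using run_Seq[OF 1 run_Seq[OF 2 run_Seq[OF 3 run_Seq[OF 4 run_Seq[OF 5 run_join order_refl]
        order_refl] order_refl] order_refl] order_refl]
      by simp
  qed
  moreover have "pb ?T" by (intro pb_intros)
  ultimately show ?thesis by (rule fpI[rotated])
qed

lemma fp_fst0: "fp fst"
proof (rule fpI)
  fix x :: "'a \<times> 'b"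
  obtain a b where x: "x = (a, b)" by force
  have 1: "run (Pop RM) [enc x] [enc a, enc b] 1" using run_split x by simp
  have 2: "run swap_top [enc a, enc b] [enc b, enc a] (26 * sz (enc x) + 8)"
    by (rule run_swap_top) (simp add: x)
  have "run drop_top [enc b] [] (10 * sz (enc x) + 4)" by (rule run_drop_top) (simp add: x)
  then have 3: "run drop_top [enc b, enc a] [enc a] (10 * sz (enc x) + 4)"
    using run_frame1 by fastforce
  show "run (Seq (Pop RM) (Seq swap_top drop_top)) [enc x] [enc (fst x)]
      (1 + ((26 * sz (enc x) + 8) + (10 * sz (enc x) + 4)))"
    using run_Seq[OF 1 run_Seq[OF 2 3 order_refl] order_refl] by (simp add: x)
qed (intro pb_intros)

lemma fp_snd0: "fp snd"
proof (rule fpI)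
  fix x :: "'a \<times> 'b"
  obtain a b where x: "x = (a, b)" by force
  have 1: "run (Pop RM) [enc x] [enc a, enc b] 1" using run_split x by simp
  have "run drop_top [enc a] [] (10 * sz (enc x) + 4)" by (rule run_drop_top) (simp add: x)
  then have 3: "run drop_top [enc a, enc b] [enc b] (10 * sz (enc x) + 4)"
    using run_frame1 by fastforce
  show "run (Seq (Pop RM) drop_top) [enc x] [enc (snd x)] (1 + (10 * sz (enc x) + 4))"
    using run_Seq[OF 1 3 order_refl] by (simp add: x)
qed (intro pb_intros)

lemmas fp_fst [fp_intros] = fp_comp[OF fp_fst0]
lemmas fp_snd [fp_intros] = fp_comp[OF fp_snd0]

lemma fp_if [fp_intros]:
  assumes "fp b" "fp f" "fp g" shows "fp (\<lambda>x. if b x then f x else g x)"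
proof -
  obtain e m where e: "\<And>x. run e [enc x] [enc (b x)] ((sz (enc x) + 2) ^ m)" using assms(1) by (rule fpE) blast
  obtain c k where c: "\<And>x. run c [enc x] [enc (f x)] ((sz (enc x) + 2) ^ k)" using assms(2) by (rule fpE) blast
  obtain d l where d: "\<And>x. run d [enc x] [enc (g x)] ((sz (enc x) + 2) ^ l)" using assms(3) by (rule fpE) blast
  let ?T = "\<lambda>n. (25 * n + 6) + ((n + 2) ^ m + ((n + 2) ^ k + (n + 2) ^ l + 50))"
  have "run (Seq dup_top (Seq e (If RM (\<lambda>s. s = 1) (Seq (Pop RM) d) (Seq drop_top c))))
      [enc x] [enc (if b x then f x else g x)] (?T (sz (enc x)))" for x
  proof -
    have 1: "run dup_top [enc x] [enc x, enc x] (25 * sz (enc x) + 6)" by (rule run_dup_top) simp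
    have 2: "run e [enc x, enc x] [enc (b x), enc x] ((sz (enc x) + 2) ^ m)"
      using run_frame1[OF e] by simp
    have 3: "run (If RM (\<lambda>s. s = 1) (Seq (Pop RM) d) (Seq drop_top c)) [enc (b x), enc x]
       [enc (if b x then f x else g x)] ((sz (enc x) + 2) ^ k + (sz (enc x) + 2) ^ l + 50)"
    proof (cases "b x")
      case True
      have "run drop_top [Node Leaf Leaf, enc x] [enc x] 34"
        using run_frame1[OF run_drop_top[of "Node Leaf Leaf" 34]] by simp
      then have "run (If RM (\<lambda>s. s = 1) (Seq (Pop RM) d) (Seq drop_top c)) [enc (b x), enc x]
          [enc (f x)] ((sz (enc x) + 2) ^ k + (sz (enc x) + 2) ^ l + 50)"
        by (intro run_if_Node[OF run_Seq[OF _ c order_refl]]) (auto simp: True)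
      then show ?thesis using True by simp
    next
      case False
      have "run (Pop RM) [Leaf, enc x] [enc x] 1" using run_frame1[OF run_unleaf] by simp
      then have "run (If RM (\<lambda>s. s = 1) (Seq (Pop RM) d) (Seq drop_top c)) [enc (b x), enc x]
          [enc (g x)] ((sz (enc x) + 2) ^ k + (sz (enc x) + 2) ^ l + 50)"
        by (intro run_if_Leaf[OF run_Seq[OF _ d order_refl]]) (auto simp: False)
      then show ?thesis using False by simp
    qed
    show ?thesis by (rule run_Seq[OF 1 run_Seq[OF 2 3 order_refl] order_refl])
  qed
  moreover have "pb ?T" by (intro pb_intros)
  ultimately show ?thesis by (rule fpI[rotated])
qed

text \<open>The code of a nonempty list is also the code of the pair of its head and tail. So
  pushing one symbol turns the list and \<open>x\<close> into the argument
  \<open>((a, as), x)\<close> of the second branch.\<close>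

lemma fp_case_list [fp_intros]:
  assumes "fp l" "fp f" "fp (\<lambda>z. g (snd z) (fst (fst z)) (snd (fst z)))"
  shows "fp (\<lambda>x. case l x of [] \<Rightarrow> f x | a # as \<Rightarrow> g x a as)"
proof -
  obtain e m where e: "\<And>x. run e [enc x] [enc (l x)] ((sz (enc x) + 2) ^ m)" using assms(1) by (rule fpE) blast
  obtain i where i: "\<And>x. sz (enc (l x)) \<le> (sz (enc x) + 2) ^ i" using assms(1) by (rule fp_size) blast
  obtain c k where c: "\<And>x. run c [enc x] [enc (f x)] ((sz (enc x) + 2) ^ k)" using assms(2) by (rule fpE) blast
  obtain d j where d: "\<And>z. run d [enc z] [enc (g (snd z) (fst (fst z)) (snd (fst z)))] ((sz (enc z) + 2) ^ j)"
    using assms(3) by (rule fpE) blast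
  let ?T = "\<lambda>n. (25 * n + 6) + ((n + 2) ^ m + ((n + 2) ^ k + ((n + 2) ^ i + n + 3) ^ j + 5))"
  have "run (Seq dup_top (Seq e (If RM (\<lambda>s. s = 1) (Seq (Pop RM) c) (Seq (Push RM True) d))))
      [enc x] [enc (case l x of [] \<Rightarrow> f x | a # as \<Rightarrow> g x a as)] (?T (sz (enc x)))" for x
  proof -
    have 1: "run dup_top [enc x] [enc x, enc x] (25 * sz (enc x) + 6)" by (rule run_dup_top) simp
    have 2: "run e [enc x, enc x] [enc (l x), enc x] ((sz (enc x) + 2) ^ m)"
      using run_frame1[OF e] by simp
    have 3: "run (If RM (\<lambda>s. s = 1) (Seq (Pop RM) c) (Seq (Push RM True) d)) [enc (l x), enc x]
       [enc (case l x of [] \<Rightarrow> f x | a # as \<Rightarrow> g x a as)]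
       ((sz (enc x) + 2) ^ k + ((sz (enc x) + 2) ^ i + sz (enc x) + 3) ^ j + 5)"
    proof (cases "l x")
      case Nil
      have "run (Pop RM) [Leaf, enc x] [enc x] 1" using run_frame1[OF run_unleaf] by simp
      then have "run (If RM (\<lambda>s. s = 1) (Seq (Pop RM) c) (Seq (Push RM True) d)) [enc (l x), enc x]
          [enc (f x)] ((sz (enc x) + 2) ^ k + ((sz (enc x) + 2) ^ i + sz (enc x) + 3) ^ j + 5)"
        by (intro run_if_Leaf[OF run_Seq[OF _ c order_refl]]) (auto simp: Nil)
      then show ?thesis using Nil by simp
    next
      case (Cons a as)
      have "run (Push RM True) [enc (l x), enc x] [enc ((a, as), x)] 2"
        using run_join[of "enc (l x)" "enc x"] Cons by simp
      moreover have "sz (enc ((a, as), x)) + 2 \<le> (sz (enc x) + 2) ^ i + sz (enc x) + 3"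
        using i[of x] Cons by simp
      then have "run d [enc ((a, as), x)] [enc (g x a as)] (((sz (enc x) + 2) ^ i + sz (enc x) + 3) ^ j)"
        using run_mono[OF d[of "((a, as), x)"]] by (simp add: power_mono)
      ultimately have "run (Seq (Push RM True) d) [enc (l x), enc x] [enc (g x a as)]
          (2 + ((sz (enc x) + 2) ^ i + sz (enc x) + 3) ^ j)"
        by (rule run_Seq) simp
      then have "run (If RM (\<lambda>s. s = 1) (Seq (Pop RM) c) (Seq (Push RM True) d)) [enc (l x), enc x]
         [enc (g x a as)] ((sz (enc x) + 2) ^ k + ((sz (enc x) + 2) ^ i + sz (enc x) + 3) ^ j + 5)"
        by (rule run_if_Node[where a = "enc a" and b = "enc as"]) (use Cons in auto)
      then show ?thesis using Cons by simp
    qed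
    show ?thesis by (rule run_Seq[OF 1 run_Seq[OF 2 3 order_refl] order_refl])
  qed
  moreover have "pb ?T" by (intro pb_intros)
  ultimately show ?thesis by (rule fpI[rotated])
qed

lemma fp_eq [fp_intros]:
  assumes "fp f" "fp g" shows "fp (\<lambda>x. f x = g x)"
proof -
  have "fp (\<lambda>p :: 'b \<times> 'b. fst p = snd p)"
  proof (rule fpI)
    fix x :: "'b \<times> 'b"
    obtain a b where x: "x = (a, b)" by force
    have 1: "run (Pop RM) [enc x] [enc a, enc b] 1" using run_split x by simp
    have 2: "run eq_top [enc a, enc b] [enc (a = b)] (50 * sz (enc x) + 50)"
      using run_mono[OF run_eq_top[of "enc a" "enc b"]] by (auto simp: enc_bool_def x)
    show "run (Seq (Pop RM) eq_top) [enc x] [enc (fst x = snd x)] (1 + (50 * sz (enc x) + 50))"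
      using run_Seq[OF 1 2 order_refl] by (simp add: x)
  qed (intro pb_intros)
  from fp_comp[OF this fp_Pair[OF assms]] show ?thesis by simp
qed

text \<open>The bound on the intermediate accumulators is essential: a polynomial-time function may
  double the size of its argument, and iterating it would then take exponential time. The argument
  \<open>x\<close> travels along with the accumulator so that the body can use it.\<close>

lemma fp_fold:
  fixes f :: "'a::enc \<Rightarrow> 'b::enc \<Rightarrow> 'c::enc \<Rightarrow> 'c"
  assumes "fp (\<lambda>z. f (fst z) (fst (snd z)) (snd (snd z)))" "fp l" "fp i" "pb b"
    and bound: "\<And>x j. j \<le> length (l x) \<Longrightarrow> sz (enc (fold (f x) (take j (l x)) (i x))) \<le> b (sz (enc x))"
  shows "fp (\<lambda>x. fold (\<lambda>a acc. f x a acc) (l x) (i x))"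
proof -
  have "fp (\<lambda>z :: ('b \<times> 'b list) \<times> ('a \<times> 'c). (snd (fst z), (fst (snd z), f (fst (snd z)) (fst (fst z)) (snd (snd z)))))"
  proof -
    have "fp (\<lambda>z :: ('b \<times> 'b list) \<times> ('a \<times> 'c). (fst (snd z), (fst (fst z), snd (snd z))))"
      by (intro fp_intros)
    from fp_comp[OF assms(1) this]
    have "fp (\<lambda>z :: ('b \<times> 'b list) \<times> ('a \<times> 'c). f (fst (snd z)) (fst (fst z)) (snd (snd z)))" by simp
    then show ?thesis by (intro fp_intros)
  qed
  then obtain c k where c: "\<And>z :: ('b \<times> 'b list) \<times> ('a \<times> 'c). run c [enc z] [enc (snd (fst z), (fst (snd z), f (fst (snd z)) (fst (fst z)) (snd (snd z))))]
      ((sz (enc z) + 2) ^ k)"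
    by (rule fpE) blast
  have "fp (\<lambda>x. (l x, (x, i x)))" by (intro fp_intros assms)
  then obtain d m where d: "\<And>x. run d [enc x] [enc (l x, (x, i x))] ((sz (enc x) + 2) ^ m)"
    by (rule fpE) blast
  obtain s where s: "\<And>x. sz (enc (l x)) \<le> (sz (enc x) + 2) ^ s" using assms(2) by (rule fp_size) blast
  \<comment> \<open>Each round joins the remaining list with \<open>(x, acc)\<close> to the argument
    of \<open>c\<close> and splits its result into the two trees again.\<close>
  let ?body = "Seq (Push RM True) (Seq c (Pop RM))"
  have loop: "run (While RM (\<lambda>s. s = 2) ?body) [enc as, enc (x, acc)] [Leaf, enc (x, fold (f x) as acc)]
      (length as * ((A + sz (enc x) + B + 4) ^ k + 4) + 1)"
    if "\<And>j. j \<le> length as \<Longrightarrow> sz (enc (fold (f x) (take j as) acc)) \<le> B" "sz (enc as) \<le> A" for as x acc A B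
    using that
  proof (induction as arbitrary: acc)
    case Nil
    then show ?case using run_while_Leaf[of ?body "[enc (x, acc)]"] by simp
  next
    case (Cons a as)
    let ?z = "((a, as), (x, acc))"
    have 1: "run (Push RM True) [enc (a # as), enc (x, acc)] [enc ?z] 2"
      using run_join by simp
    have "sz (enc ?z) + 2 \<le> A + sz (enc x) + B + 4"
      using Cons.prems(1)[of 0] Cons.prems(2) by simp
    then have "run c [enc ?z] [enc (as, (x, f x a acc))] ((A + sz (enc x) + B + 4) ^ k)"
      using run_mono[OF c[of ?z]] by (simp add: power_mono)
    moreover have "run (Pop RM) [enc (as, (x, f x a acc))] [enc as, enc (x, f x a acc)] 1"
      using run_split by simp
    ultimately have 2: "run ?body [enc (a # as), enc (x, acc)] [enc as, enc (x, f x a acc)]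
        ((A + sz (enc x) + B + 4) ^ k + 3)"
      by (intro run_Seq[OF 1 run_Seq]) auto
    have 3: "run (While RM (\<lambda>s. s = 2) ?body) [enc as, enc (x, f x a acc)]
        [Leaf, enc (x, fold (f x) as (f x a acc))] (length as * ((A + sz (enc x) + B + 4) ^ k + 4) + 1)"
    proof (rule Cons.IH)
      show "sz (enc (fold (f x) (take j as) (f x a acc))) \<le> B" if "j \<le> length as" for j
        using Cons.prems(1)[of "Suc j"] that by simp
      show "sz (enc as) \<le> A" using Cons.prems(2) by simp
    qed
    show ?case
      using run_while_Node[of ?body "enc a" "enc as" "[enc (x, acc)]", OF _ 3] 2 by simp
  qed
  let ?T = "\<lambda>n. (n + 2) ^ m + (1 + (((n + 2) ^ s * (((n + 2) ^ s + n + b n + 4) ^ k + 4) + 1) + 1))"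
  have "run (Seq d (Seq (Pop RM) (Seq (While RM (\<lambda>s. s = 2) ?body) (Pop RM))))
      [enc x] [enc (x, fold (f x) (l x) (i x))] (?T (sz (enc x)))" for x
  proof -
    let ?n = "sz (enc x)"
    have 1: "run (Pop RM) [enc (l x, (x, i x))] [enc (l x), enc (x, i x)] 1" using run_split by simp
    have len: "length xs \<le> sz (enc xs)" for xs :: "'b list" by (induction xs) auto
    have 2: "run (While RM (\<lambda>s. s = 2) ?body) [enc (l x), enc (x, i x)] [Leaf, enc (x, fold (f x) (l x) (i x))]
        ((?n + 2) ^ s * (((?n + 2) ^ s + ?n + b ?n + 4) ^ k + 4) + 1)"
      by (rule run_mono[OF loop[OF bound s]])
         (use len[of "l x"] s[of x] in \<open>auto intro: mult_le_mono1\<close>)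
    have 3: "run (Pop RM) [Leaf, enc (x, fold (f x) (l x) (i x))] [enc (x, fold (f x) (l x) (i x))] 1"
      using run_frame1[OF run_unleaf] by fastforce
    show ?thesis by (rule run_Seq[OF d run_Seq[OF 1 run_Seq[OF 2 3 order_refl] order_refl] order_refl])
  qed
  moreover have "pb ?T" by (intro pb_intros assms)
  ultimately have "fp (\<lambda>x. (x, fold (f x) (l x) (i x)))" by (rule fpI[rotated])
  from fp_snd[OF this] show ?thesis by simp
qed

section \<open>Closure properties of polynomial-time functions\<close>

lemma sz_list: "sz (enc (xs :: 'a::enc list)) = Suc (sum_list (map (\<lambda>a. Suc (sz (enc a))) xs))"
  by (induction xs) auto

lemma sz_append: "sz (enc (xs @ ys)) \<le> sz (enc xs) + sz (enc (ys :: 'a::enc list))"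
  by (simp add: sz_list)

lemma length_le_sz: "length (xs :: 'a::enc list) \<le> sz (enc xs)"
  by (induction xs) auto

lemma sz_list_le:
  assumes "\<And>a. a \<in> set xs \<Longrightarrow> sz (enc (a :: 'a::enc)) \<le> B"
  shows "sz (enc xs) \<le> Suc (length xs * Suc B)"
  using assms
proof (induction xs)
  case (Cons a xs)
  have "sz (enc a) \<le> B" "sz (enc xs) \<le> Suc (length xs * Suc B)" using Cons by auto
  then show ?case by simp
qed simp

lemma sz_mem: "a \<in> set xs \<Longrightarrow> sz (enc (a :: 'a::enc)) \<le> sz (enc xs)"
  by (induction xs) auto

lemma sz_take: "sz (enc (take j (xs :: 'a::enc list))) \<le> sz (enc xs)"
  by (induction xs arbitrary: j) (auto simp: take_Cons split: nat.splits)

lemma sz_rev: "sz (enc (rev (xs :: 'a::enc list))) = sz (enc xs)"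
  by (simp add: sz_list sum_list_rev flip: rev_map)

lemma fp_Cons [fp_intros]: "fp f \<Longrightarrow> fp g \<Longrightarrow> fp (\<lambda>x. f x # g x)"
  by (rule fp_retype[OF fp_Pair]) auto

lemma fp_rev [fp_intros]: assumes "fp l" shows "fp (\<lambda>x. rev (l x))"
proof -
  obtain k where k: "\<And>x. sz (enc (l x)) \<le> (sz (enc x) + 2) ^ k" using assms by (rule fp_size) blast
  have "fp (\<lambda>x. fold (\<lambda>a acc. a # acc) (l x) [])"
  proof (rule fp_fold[where b = "\<lambda>n. (n + 2) ^ k"])
    show "sz (enc (fold (\<lambda>a acc. a # acc) (take j (l x)) [])) \<le> (sz (enc x) + 2) ^ k" for x j
      using k[of x] sz_take[of j "l x"] by (simp add: fold_Cons_rev sz_rev)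
  qed (intro fp_intros pb_intros assms)+
  then show ?thesis by (simp add: fold_Cons_rev)
qed

lemma fp_map [fp_intros]:
  assumes "fp (\<lambda>z. f (fst z) (snd z))" "fp l" shows "fp (\<lambda>x. map (f x) (l x))"
proof -
  obtain k where k: "\<And>x. sz (enc (l x)) \<le> (sz (enc x) + 2) ^ k" using assms(2) by (rule fp_size) blast
  obtain m where m: "\<And>z. sz (enc (f (fst z) (snd z))) \<le> (sz (enc z) + 2) ^ m"
    using assms(1) by (rule fp_size) blast
  have e: "fold (\<lambda>a acc. f x a # acc) as acc = rev (map (f x) as) @ acc" for x as acc
    by (induction as arbitrary: acc) auto
  have "fp (\<lambda>x. fold (\<lambda>a acc. f x a # acc) (l x) [])"
  proof (rule fp_fold[where b = "\<lambda>n. Suc ((n + 2) ^ k * Suc ((n + (n + 2) ^ k + 3) ^ m))"])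
    have "fp (\<lambda>z. (fst z, fst (snd z)))" by (intro fp_intros)
    from fp_comp[OF assms(1) this] show "fp (\<lambda>z. f (fst z) (fst (snd z)) # snd (snd z))"
      by (simp, intro fp_intros)
    show "sz (enc (fold (\<lambda>a acc. f x a # acc) (take j (l x)) []))
      \<le> Suc ((sz (enc x) + 2) ^ k * Suc ((sz (enc x) + (sz (enc x) + 2) ^ k + 3) ^ m))" for x j
    proof -
      have "sz (enc b) \<le> (sz (enc x) + (sz (enc x) + 2) ^ k + 3) ^ m"
        if "b \<in> set (rev (map (f x) (take j (l x))))" for b
      proof -
        from that obtain a where a: "a \<in> set (l x)" "b = f x a" by (auto dest: in_set_takeD)
        have "sz (enc (x, a)) + 2 \<le> sz (enc x) + (sz (enc x) + 2) ^ k + 3"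
          using sz_mem[OF a(1)] k[of x] by simp
        then have "(sz (enc (x, a)) + 2) ^ m \<le> (sz (enc x) + (sz (enc x) + 2) ^ k + 3) ^ m"
          by (rule power_mono) simp
        moreover have "sz (enc b) \<le> (sz (enc (x, a)) + 2) ^ m" using m[of "(x, a)"] a(2) by simp
        ultimately show ?thesis by linarith
      qed
      from sz_list_le[OF this] have "sz (enc (rev (map (f x) (take j (l x)))))
        \<le> Suc (length (rev (map (f x) (take j (l x)))) * Suc ((sz (enc x) + (sz (enc x) + 2) ^ k + 3) ^ m))"
        by blast
      also have "\<dots> \<le> Suc ((sz (enc x) + 2) ^ k * Suc ((sz (enc x) + (sz (enc x) + 2) ^ k + 3) ^ m))"
      proof -
        have "length (rev (map (f x) (take j (l x)))) \<le> (sz (enc x) + 2) ^ k"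
          using length_le_sz[of "l x"] k[of x] by simp
        then show ?thesis by (simp only: Suc_le_mono mult_le_mono1)
      qed
      finally show ?thesis by (simp add: e)
    qed
  qed (intro fp_intros pb_intros assms)+
  from fp_rev[OF this] show ?thesis by (simp add: e)
qed

lemma fp_append [fp_intros]:
  assumes "fp f" "fp g" shows "fp (\<lambda>x. f x @ g x)"
proof -
  obtain k where k: "\<And>x. sz (enc (f x)) \<le> (sz (enc x) + 2) ^ k" using assms(1) by (rule fp_size) blast
  obtain m where m: "\<And>x. sz (enc (g x)) \<le> (sz (enc x) + 2) ^ m" using assms(2) by (rule fp_size) blast
  have e: "fold (\<lambda>a acc. a # acc) as acc = rev as @ acc" for as acc :: "'b list"
    by (induction as arbitrary: acc) auto
  have "fp (\<lambda>x. fold (\<lambda>a acc. a # acc) (rev (f x)) (g x))"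
  proof (rule fp_fold[where b = "\<lambda>n. (n + 2) ^ k + (n + 2) ^ m"])
    show "sz (enc (fold (\<lambda>a acc. a # acc) (take j (rev (f x))) (g x)))
        \<le> (sz (enc x) + 2) ^ k + (sz (enc x) + 2) ^ m" for x j
      using k[of x] m[of x] sz_take[of j "rev (f x)"] sz_append[of "rev (take j (rev (f x)))" "g x"]
      unfolding e sz_rev by linarith
  qed (intro fp_intros pb_intros assms)+
  then show ?thesis by (simp add: e)
qed

lemma fp_concat [fp_intros]:
  assumes "fp l" shows "fp (\<lambda>x. concat (l x))"
proof -
  obtain k where k: "\<And>x. sz (enc (l x)) \<le> (sz (enc x) + 2) ^ k" using assms by (rule fp_size) blast
  have e: "fold (\<lambda>a acc. acc @ a) as acc = acc @ concat as" for as and acc :: "'b list"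
    by (induction as arbitrary: acc) auto
  have s: "sz (enc (concat as)) \<le> sz (enc as)" for as :: "'b list list"
  proof (induction as)
    case (Cons a as)
    then show ?case using sz_append[of a "concat as"] by simp
  qed simp
  have "fp (\<lambda>x. fold (\<lambda>a acc. acc @ a) (l x) [])"
  proof (rule fp_fold[where b = "\<lambda>n. (n + 2) ^ k"])
    show "sz (enc (fold (\<lambda>a acc. acc @ a) (take j (l x)) [])) \<le> (sz (enc x) + 2) ^ k" for x j
      unfolding e using k[of x] sz_take[of j "l x"] s[of "take j (l x)"] by simp
  qed (intro fp_intros pb_intros assms)+
  then show ?thesis by (simp add: e)
qed

lemma fp_filter [fp_intros]:
  assumes "fp (\<lambda>z. P (fst z) (snd z))" "fp l" shows "fp (\<lambda>x. filter (P x) (l x))"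
proof -
  have "filter (P x) as = concat (map (\<lambda>a. if P x a then [a] else []) as)" for x as
    by (induction as) auto
  then show ?thesis by (simp, intro fp_intros assms)
qed

lemma fp_not [fp_intros]: "fp p \<Longrightarrow> fp (\<lambda>x. \<not> p x)"
proof -
  assume *: "fp p"
  have "(\<not> p x) = (if p x then False else True)" for x by simp
  then show ?thesis using fp_if[OF * fp_const[of False] fp_const[of True]] by presburger
qed

lemma fp_conj [fp_intros]: "fp p \<Longrightarrow> fp q \<Longrightarrow> fp (\<lambda>x. p x \<and> q x)"
proof -
  assume *: "fp p" "fp q"
  have "(p x \<and> q x) = (if p x then q x else False)" for x by simp
  then show ?thesis using fp_if[OF * fp_const[of False]] by presburger
qed

lemma fp_disj [fp_intros]: "fp p \<Longrightarrow> fp q \<Longrightarrow> fp (\<lambda>x. p x \<or> q x)"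
proof -
  assume *: "fp p" "fp q"
  have "(p x \<or> q x) = (if p x then True else q x)" for x by simp
  then show ?thesis using fp_if[OF *(1) fp_const[of True] *(2)] by presburger
qed

lemma fp_imp [fp_intros]: "fp p \<Longrightarrow> fp q \<Longrightarrow> fp (\<lambda>x. p x \<longrightarrow> q x)"
proof -
  assume *: "fp p" "fp q"
  have "(p x \<longrightarrow> q x) = (if p x then q x else True)" for x by simp
  then show ?thesis using fp_if[OF * fp_const[of True]] by presburger
qed

lemma fp_Bex [fp_intros]:
  assumes "fp (\<lambda>z. P (fst z) (snd z))" "fp l" shows "fp (\<lambda>x. \<exists>a\<in>set (l x). P x a)"
proof -
  have "(\<exists>a\<in>set as. P x a) = (filter (P x) as \<noteq> [])" for x as
    by (auto simp: filter_empty_conv)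
  then show ?thesis by (simp, intro fp_intros assms)
qed

lemma fp_Ball [fp_intros]:
  assumes "fp (\<lambda>z. P (fst z) (snd z))" "fp l" shows "fp (\<lambda>x. \<forall>a\<in>set (l x). P x a)"
  using fp_not[OF fp_Bex[OF fp_not[OF assms(1)] assms(2)]] by simp

lemma fp_mem [fp_intros]:
  assumes "fp f" "fp l" shows "fp (\<lambda>x. f x \<in> set (l x))"
proof -
  have "(a \<in> set as) = (\<exists>b\<in>set as. b = a)" for a :: 'b and as by auto
  then show ?thesis by (simp only:) (intro fp_intros assms fp_comp[OF assms(1)])
qed

lemma fp_funpow:
  fixes f :: "'b::enc \<Rightarrow> 'b" and l :: "'a::enc \<Rightarrow> 'c::enc list"
  assumes "fp f" "fp l" "fp i" "pb b"
    and "\<And>x j. j \<le> length (l x) \<Longrightarrow> sz (enc ((f ^^ j) (i x))) \<le> b (sz (enc x))"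
  shows "fp (\<lambda>x. (f ^^ length (l x)) (i x))"
proof -
  have e: "fold (\<lambda>a acc. f acc) as acc = (f ^^ length as) acc" for as :: "'c list" and acc
    by (induction as arbitrary: acc) (auto simp: funpow_swap1)
  have "fp (\<lambda>x. fold (\<lambda>a acc. f acc) (l x) (i x))"
  proof (rule fp_fold[OF _ assms(2-4)])
    show "sz (enc (fold (\<lambda>a acc. f acc) (take j (l x)) (i x))) \<le> b (sz (enc x))"
      if "j \<le> length (l x)" for x j
      using assms(5)[OF that] that by (simp add: e min_absorb2)
  qed (intro fp_intros fp_comp[OF assms(1)])
  then show ?thesis by (simp add: e)
qed

lemma fp_distinct [fp_intros]:
  assumes "fp l" shows "fp (\<lambda>x. distinct (l x))"
proof -
  obtain k where k: "\<And>x. sz (enc (l x)) \<le> (sz (enc x) + 2) ^ k" using assms by (rule fp_size) blast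
  let ?f = "\<lambda>a s. (fst s \<and> a \<notin> set (snd s), a # snd s)"
  have e: "fold ?f as (c, acc) = (c \<and> distinct as \<and> set as \<inter> set acc = {}, rev as @ acc)" for as c and acc :: "'b list"
    by (induction as arbitrary: c acc) auto
  have "fp (\<lambda>x. fold ?f (l x) (True, []))"
  proof (rule fp_fold[where b = "\<lambda>n. 4 + (n + 2) ^ k"])
    show "sz (enc (fold ?f (take j (l x)) (True, []))) \<le> 4 + (sz (enc x) + 2) ^ k" for x j
      unfolding e using k[of x] sz_take[of j "l x"] by (simp add: enc_bool_def sz_rev)
  qed (intro fp_intros pb_intros assms)+
  from fp_fst[OF this] show ?thesis by (simp add: e)
qed

subsection \<open>Unary numbers\<close>

lemma fp_length [fp_intros]: "fp l \<Longrightarrow> fp (\<lambda>x. length (l x))"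
proof -
  assume l: "fp l"
  have "fp (\<lambda>x. map (\<lambda>_. ()) (l x))" by (intro fp_intros l)
  then show ?thesis by (rule fp_retype) (simp add: enc_nat_def map_replicate_const)
qed

lemma fp_units: "fp n \<Longrightarrow> fp (\<lambda>x. replicate (n x) ())"
  by (erule fp_retype) (simp add: enc_nat_def)

lemma fp_replicate [fp_intros]:
  assumes "fp n" "fp c" shows "fp (\<lambda>x. replicate (n x) (c x))"
proof -
  have "fp (\<lambda>x. map (\<lambda>_. c x) (replicate (n x) ()))"
    by (intro fp_intros fp_units assms fp_comp[OF assms(2)])
  then show ?thesis by simp
qed

lemma fp_plus [fp_intros]: "fp m \<Longrightarrow> fp n \<Longrightarrow> fp (\<lambda>x. m x + n x :: nat)"
  using fp_length[OF fp_append[OF fp_units fp_units], of m n] by simp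

lemma fp_Suc [fp_intros]: "fp n \<Longrightarrow> fp (\<lambda>x. Suc (n x))"
  using fp_plus[OF _ fp_const[of 1], of n] by simp

lemma fp_times [fp_intros]:
  assumes "fp m" "fp n" shows "fp (\<lambda>x. m x * n x :: nat)"
proof -
  have "fp (\<lambda>x. length (concat (map (\<lambda>_. replicate (n x) ()) (replicate (m x) ()))))"
    by (intro fp_intros fp_units assms fp_comp[OF assms(2)])
  then show ?thesis by (simp add: length_concat sum_list_replicate)
qed

lemma fp_poly [fp_intros]: "fp n \<Longrightarrow> fp (\<lambda>x. poly p (n x) :: nat)"
proof (induction p)
  case 0
  then show ?case by (simp add: fp_const)
next
  case (pCons a p)
  then show ?case by (simp, intro fp_intros)
qed

lemma fp_enumerate [fp_intros]:
  assumes "fp l" shows "fp (\<lambda>x. List.enumerate 0 (l x))"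
proof -
  obtain k where k: "\<And>x. sz (enc (l x)) \<le> (sz (enc x) + 2) ^ k" using assms by (rule fp_size) blast
  let ?f = "\<lambda>a acc. (length acc, a) # acc"
  have e: "fold ?f as acc = rev (List.enumerate (length acc) as) @ acc" for as and acc :: "(nat \<times> 'b) list"
    by (induction as arbitrary: acc) auto
  have n: "sz (enc n) = Suc (2 * n)" for n :: nat
    by (simp add: enc_nat_def sz_list sum_list_replicate)
  have "fp (\<lambda>x. fold ?f (l x) [])"
  proof (rule fp_fold[where b = "\<lambda>n. Suc ((n + 2) ^ k * Suc (3 * (n + 2) ^ k + 2))"])
    show "sz (enc (fold ?f (take j (l x)) [])) \<le> Suc ((sz (enc x) + 2) ^ k * Suc (3 * (sz (enc x) + 2) ^ k + 2))" for x j
    proof -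
      let ?K = "(sz (enc x) + 2) ^ k"
      have len: "length (l x) \<le> ?K" using length_le_sz[of "l x"] k[of x] by simp
      have "sz (enc (rev (List.enumerate 0 (take j (l x))))) \<le> Suc (length (rev (List.enumerate 0 (take j (l x)))) * Suc (3 * ?K + 2))"
      proof (rule sz_list_le)
        fix p assume "p \<in> set (rev (List.enumerate 0 (take j (l x))))"
        then have p: "fst p < length (l x)" "snd p \<in> set (l x)"
          by (auto simp: in_set_enumerate_eq) (metis nth_mem)
        show "sz (enc p) \<le> 3 * ?K + 2"
          using sz_mem[OF p(2)] k[of x] p(1) len by (simp add: enc_prod_def n)
      qed
      also have "\<dots> \<le> Suc (?K * Suc (3 * ?K + 2))" using len by (simp only: Suc_le_mono mult_le_mono1 length_rev length_enumerate length_take min.coboundedI1)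
      finally show ?thesis by (simp add: e)
    qed
  qed (intro fp_intros pb_intros assms)+
  from fp_rev[OF this] show ?thesis by (simp add: e)
qed

lemma fp_upt [fp_intros]: assumes "fp n" shows "fp (\<lambda>x. [0..<n x])"
proof -
  have "fp (\<lambda>x. map fst (List.enumerate 0 (replicate (n x) ())))" by (intro fp_intros fp_units assms)
  then show ?thesis by simp
qed

lemma fp_less [fp_intros]: "fp m \<Longrightarrow> fp n \<Longrightarrow> fp (\<lambda>x. m x < (n x :: nat))"
  using fp_mem[OF _ fp_upt, of m n] by simp

text \<open>The list \<open>as\<close> belongs to the program and not to the input, so every element
  may have a program of its own. The reduction uses this with the tape index, on which its tables
  depend in no uniform way.\<close>

lemma fp_concat_const:
  assumes "\<And>a. a \<in> set as \<Longrightarrow> fp (\<lambda>x. g x a)"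
  shows "fp (\<lambda>x. concat (map (g x) as))"
  using assms by (induction as) (auto intro!: fp_intros)

text \<open>An arbitrary function on finitely many arguments becomes a chain of comparisons with
  constants. In this way tile colors, guessed blocks and lists of cell values enter a
  program.\<close>

lemma fp_finite_table:
  fixes h :: "nat \<Rightarrow> 'b::enc"
  assumes "fp n" shows "fp (\<lambda>x. if n x < B then h (n x) else d)"
proof (induction B)
  case 0
  show ?case by (simp add: fp_const)
next
  case (Suc B)
  have "fp (\<lambda>x. if n x = B then h B else if n x < B then h (n x) else d)"
    by (intro fp_intros assms Suc)
  then show ?case by (rule fp_retype) (auto simp: less_Suc_eq)
qed

subsection \<open>Binary integers\<close>

primrec inc :: "bool list \<Rightarrow> bool list" where
  "inc [] = [True]"
| "inc (b # bs) = (if b then False # inc bs else True # bs)"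

primrec decr :: "bool list \<Rightarrow> bool list" where
  "decr [] = []"
| "decr (b # bs) = (if b then False # bs else True # decr bs)"

text \<open>Codes of integers have to be canonical, so zeros beyond the leading digit must
  go.\<close>

primrec strip :: "bool list \<Rightarrow> bool list" where
  "strip [] = []"
| "strip (b # bs) = (if strip bs = [] \<and> \<not> b then [] else b # strip bs)"

primrec val :: "bool list \<Rightarrow> nat" where
  "val [] = 0"
| "val (b # bs) = of_bool b + 2 * val bs"

lemma binary_digits_Cons: "binary_digits (of_bool b + 2 * n) = (if n = 0 \<and> \<not> b then [] else b # binary_digits n)"
  by (subst binary_digits.simps) auto

lemma binary_digits_0 [simp]: "binary_digits 0 = []"
  by (subst binary_digits.simps) simp

lemma binary_digits_eq_Nil [simp]: "binary_digits n = [] \<longleftrightarrow> n = 0"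
  by (subst binary_digits.simps) simp

lemma strip_eq: "strip bs = binary_digits (val bs)"
  by (induction bs) (auto simp: binary_digits_Cons simp del: of_bool_eq)

lemma val_inc: "val (inc bs) = Suc (val bs)"
  by (induction bs) auto

lemma val_decr: "val bs > 0 \<Longrightarrow> val (decr bs) = val bs - 1"
  by (induction bs) auto

lemma val_binary_digits [simp]: "val (binary_digits n) = n"
proof (induction n rule: less_induct)
  case (less n)
  then show ?case by (subst binary_digits.simps) auto
qed

lemma fp_inc [fp_intros]:
  assumes "fp l" shows "fp (\<lambda>x. inc (l x))"
proof -
  obtain k where k: "\<And>x. sz (enc (l x)) \<le> (sz (enc x) + 2) ^ k" using assms by (rule fp_size) blast
  \<comment> \<open>The first component is the carry, the second the output so far in reverse; the
    output digit is the exclusive or of digit and carry.\<close>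
  let ?f = "\<lambda>b s. (b \<and> fst s, (b \<noteq> fst s) # snd s)"
  have e: "rev (snd (fold ?f bs (c, acc))) @ (if fst (fold ?f bs (c, acc)) then [True] else []) =
      rev acc @ (if c then inc bs else bs)" for bs c acc
    by (induction bs arbitrary: c acc) auto
  have s: "sz (enc (fold ?f bs (c, acc))) \<le> 4 * length bs + sz (enc acc) + 4" for bs c acc
  proof (induction bs arbitrary: c acc)
    case (Cons a bs)
    show ?case using Cons.IH[of "a \<and> c" "(a \<noteq> c) # acc"] by (auto simp: enc_bool_def split: if_splits)
  qed (simp add: enc_bool_def)
  have "fp (\<lambda>x. fold ?f (l x) (True, []))"
  proof (rule fp_fold[where b = "\<lambda>n. 4 * (n + 2) ^ k + 5"])
    show "sz (enc (fold ?f (take j (l x)) (True, []))) \<le> 4 * (sz (enc x) + 2) ^ k + 5" for x j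
      using s[of "take j (l x)" True "[]"] k[of x] length_le_sz[of "l x"] by simp
  qed (intro fp_intros pb_intros assms)+
  then have "fp (\<lambda>x. rev (snd (fold ?f (l x) (True, []))) @ (if fst (fold ?f (l x) (True, [])) then [True] else []))"
    by (intro fp_intros)
  then show ?thesis by (simp only: e) simp
qed

lemma fp_decr [fp_intros]:
  assumes "fp l" shows "fp (\<lambda>x. decr (l x))"
proof -
  obtain k where k: "\<And>x. sz (enc (l x)) \<le> (sz (enc x) + 2) ^ k" using assms by (rule fp_size) blast
  \<comment> \<open>The same scan with a borrow, which only a digit 0 passes on.\<close>
  let ?f = "\<lambda>b s. (\<not> b \<and> fst s, (b \<noteq> fst s) # snd s)"
  have e: "rev (snd (fold ?f bs (c, acc))) = rev acc @ (if c then decr bs else bs)" for bs c acc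
    by (induction bs arbitrary: c acc) auto
  have s: "sz (enc (fold ?f bs (c, acc))) \<le> 4 * length bs + sz (enc acc) + 4" for bs c acc
  proof (induction bs arbitrary: c acc)
    case (Cons a bs)
    show ?case using Cons.IH[of "\<not> a \<and> c" "(a \<noteq> c) # acc"] by (auto simp: enc_bool_def split: if_splits)
  qed (simp add: enc_bool_def)
  have "fp (\<lambda>x. fold ?f (l x) (True, []))"
  proof (rule fp_fold[where b = "\<lambda>n. 4 * (n + 2) ^ k + 5"])
    show "sz (enc (fold ?f (take j (l x)) (True, []))) \<le> 4 * (sz (enc x) + 2) ^ k + 5" for x j
      using s[of "take j (l x)" True "[]"] k[of x] length_le_sz[of "l x"] by simp
  qed (intro fp_intros pb_intros assms)+
  then have "fp (\<lambda>x. rev (snd (fold ?f (l x) (True, []))))" by (intro fp_intros)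
  then show ?thesis by (simp only: e) simp
qed

lemma fp_strip [fp_intros]:
  assumes "fp l" shows "fp (\<lambda>x. strip (l x))"
proof -
  obtain k where k: "\<And>x. sz (enc (l x)) \<le> (sz (enc x) + 2) ^ k" using assms by (rule fp_size) blast
  let ?f = "\<lambda>b acc. if acc = [] \<and> \<not> b then [] else b # acc"
  have e: "fold ?f (rev bs) [] = strip bs" for bs
    by (induction bs) auto
  have s: "sz (enc (fold ?f bs acc)) \<le> 4 * length bs + sz (enc acc)" for bs acc
  proof (induction bs arbitrary: acc)
    case (Cons a bs)
    show ?case using Cons.IH[of "[]"] Cons.IH[of "a # acc"] by (auto simp: enc_bool_def split: if_splits)
  qed simp
  have "fp (\<lambda>x. fold ?f (rev (l x)) [])"
  proof (rule fp_fold[where b = "\<lambda>n. 4 * (n + 2) ^ k + 1"])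
    show "sz (enc (fold ?f (take j (rev (l x))) [])) \<le> 4 * (sz (enc x) + 2) ^ k + 1" for x j
      using s[of "take j (rev (l x))" "[]"] k[of x] length_le_sz[of "l x"] by simp
  qed (intro fp_intros pb_intros assms)+
  then show ?thesis by (simp only: e)
qed

lemma length_binary_digits: "length (binary_digits n) \<le> n"
proof (induction n rule: less_induct)
  case (less n)
  show ?case
  proof (cases "n = 0")
    case False
    then have "length (binary_digits (n div 2)) \<le> n div 2" using less by simp
    then show ?thesis using False by (subst binary_digits.simps) auto
  qed simp
qed

text \<open>From unary to binary by counting up from zero: there are as many rounds as the number
  says, and the intermediate numbers never exceed it.\<close>

lemma fp_binary_digits [fp_intros]:
  assumes "fp n" shows "fp (\<lambda>x. binary_digits (n x))"
proof -
  obtain k where k: "\<And>x. sz (enc (replicate (n x) ())) \<le> (sz (enc x) + 2) ^ k"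
    using fp_units[OF assms] by (rule fp_size) blast
  have e: "((\<lambda>bs. strip (inc bs)) ^^ j) [] = binary_digits j" for j
    by (induction j) (auto simp: strip_eq val_inc)
  have "fp (\<lambda>x. ((\<lambda>bs. strip (inc bs)) ^^ length (replicate (n x) ())) [])"
  proof (rule fp_funpow[where b = "\<lambda>n. Suc ((n + 2) ^ k * Suc 3)"])
    show "sz (enc (((\<lambda>bs. strip (inc bs)) ^^ j) [])) \<le> Suc ((sz (enc x) + 2) ^ k * Suc 3)"
      if "j \<le> length (replicate (n x) ())" for j x
    proof -
      have "sz (enc (binary_digits j)) \<le> Suc (length (binary_digits j) * Suc 3)"
        by (rule sz_list_le) (simp add: enc_bool_def)
      also have "\<dots> \<le> Suc ((sz (enc x) + 2) ^ k * Suc 3)"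
      proof -
        have "length (binary_digits j) \<le> (sz (enc x) + 2) ^ k"
          using length_binary_digits[of j] that length_le_sz[of "replicate (n x) ()"] k[of x] by simp
        then show ?thesis by (simp only: Suc_le_mono mult_le_mono1)
      qed
      finally show ?thesis unfolding e by simp
    qed
  qed (intro fp_intros pb_intros fp_units assms)+
  then show ?thesis by (simp add: e)
qed

text \<open>Binary, unlike \<open>nat\<close>: the words contain coordinates in binary, so unary
  codes could make a certificate exponentially longer than its word.\<close>

instantiation int :: enc begin
definition "enc (i :: int) = enc (i < 0, binary_digits (nat \<bar>i\<bar>))"
instance
proof
  fix i j :: int
  show "enc i = enc j \<longleftrightarrow> i = j"
    using binary_digits_inject[of "nat \<bar>i\<bar>" "nat \<bar>j\<bar>"] by (auto simp: enc_int_def)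
qed
end

definition make_int :: "bool \<times> bool list \<Rightarrow> int" where
  "make_int p = (if fst p then - int (val (snd p)) else int (val (snd p)))"

lemma fp_make_int [fp_intros]: "fp p \<Longrightarrow> fp (\<lambda>x. make_int (p x))"
proof -
  assume p: "fp p"
  \<comment> \<open>A negative zero would give the number 0 a second code, so the sign is dropped
    when no digit remains.\<close>
  have "fp (\<lambda>x. (fst (p x) \<and> strip (snd (p x)) \<noteq> [], strip (snd (p x))))" by (intro fp_intros p)
  then show ?thesis by (rule fp_retype) (auto simp: enc_int_def make_int_def strip_eq)
qed

lemma fp_int_parts: "fp i \<Longrightarrow> fp (\<lambda>x. (i x < (0 :: int), binary_digits (nat \<bar>i x\<bar>)))"
  by (erule fp_retype) (simp add: enc_int_def)

lemma fp_neg [fp_intros]: "fp i \<Longrightarrow> fp (\<lambda>x. i x < (0 :: int))"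
  using fp_fst[OF fp_int_parts] by fastforce

lemma fp_digits [fp_intros]: "fp i \<Longrightarrow> fp (\<lambda>x. binary_digits (nat \<bar>i x :: int\<bar>))"
  using fp_snd[OF fp_int_parts] by fastforce

lemma fp_int_succ [fp_intros]: "fp i \<Longrightarrow> fp (\<lambda>x. i x + 1 :: int)"
proof -
  assume i: "fp i"
  have "j + 1 = make_int (j < 0, if j < 0 then decr (binary_digits (nat \<bar>j\<bar>)) else inc (binary_digits (nat \<bar>j\<bar>)))" for j :: int
    by (auto simp: make_int_def val_inc val_decr)
  then show ?thesis by (simp, intro fp_intros i)
qed

lemma fp_int_minus [fp_intros]: "fp i \<Longrightarrow> fp (\<lambda>x. - i x :: int)"
proof -
  assume i: "fp i"
  have "- j = make_int (\<not> j < 0, binary_digits (nat \<bar>j\<bar>))" for j :: int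
    by (auto simp: make_int_def)
  then show ?thesis by (simp only:) (intro fp_intros i)
qed

lemma fp_int_pred [fp_intros]: "fp i \<Longrightarrow> fp (\<lambda>x. i x - 1 :: int)"
  using fp_int_minus[OF fp_int_succ[OF fp_int_minus]] by fastforce

lemma fp_int [fp_intros]: "fp n \<Longrightarrow> fp (\<lambda>x. int (n x))"
proof -
  assume n: "fp n"
  have "int m = make_int (False, binary_digits m)" for m by (simp add: make_int_def)
  then show ?thesis by (simp, intro fp_intros n)
qed

subsection \<open>The encoding of instances\<close>

instantiation segment :: enc begin
fun enc_segment where
  "enc_segment (Horizontal x y) = enc (False, (x, y))"
| "enc_segment (Vertical x y) = enc (True, (x, y))"
instance
proof
  fix e f :: segment
  show "enc e = enc f \<longleftrightarrow> e = f" by (cases e; cases f) auto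
qed
end

lemma fp_Horizontal [fp_intros]: "fp f \<Longrightarrow> fp g \<Longrightarrow> fp (\<lambda>x. Horizontal (f x) (g x))"
  by (rule fp_retype[OF fp_Pair[OF fp_const[of False] fp_Pair]]) auto

lemma fp_Vertical [fp_intros]: "fp f \<Longrightarrow> fp g \<Longrightarrow> fp (\<lambda>x. Vertical (f x) (g x))"
  by (rule fp_retype[OF fp_Pair[OF fp_const[of True] fp_Pair]]) auto

fun segment_parts :: "segment \<Rightarrow> bool \<times> int \<times> int" where
  "segment_parts (Horizontal x y) = (False, (x, y))"
| "segment_parts (Vertical x y) = (True, (x, y))"

lemma fp_segment_parts [fp_intros]: "fp e \<Longrightarrow> fp (\<lambda>x. segment_parts (e x))"
proof (erule fp_retype)
  fix x show "enc (segment_parts (e x)) = enc (e x)" by (cases "e x") auto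
qed

lemma fp_encode_list [fp_intros]:
  "fp (\<lambda>z. e (fst z) (snd z)) \<Longrightarrow> fp l \<Longrightarrow> fp (\<lambda>x. encode_list (e x) (l x))"
  unfolding encode_list_def by (intro fp_intros)

lemma fp_encode_nat [fp_intros]: "fp n \<Longrightarrow> fp (\<lambda>x. encode_nat (n x))"
  unfolding encode_nat_def by (intro fp_intros)

lemma fp_encode_int [fp_intros]: "fp i \<Longrightarrow> fp (\<lambda>x. encode_int (i x))"
  unfolding encode_int_def encode_nat_def by (intro fp_intros)

lemma fp_encode_instance [fp_intros]: "fp f \<Longrightarrow> fp (\<lambda>x. encode_instance (f x))"
proof -
  assume f: "fp f"
  have cell: "encode_cell = (\<lambda>p. encode_int (fst p) @ encode_int (snd p))"
    by (auto simp: fun_eq_iff)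
  have "encode_segment e = (fst (segment_parts e) # encode_int (fst (snd (segment_parts e))) @
      encode_int (snd (snd (segment_parts e))))" for e
    by (cases e) auto
  then have seg: "encode_colored_segment = (\<lambda>p. (fst (segment_parts (fst p)) #
      encode_int (fst (snd (segment_parts (fst p)))) @ encode_int (snd (snd (segment_parts (fst p))))) @
      encode_nat (snd p))"
    by (auto simp: fun_eq_iff)
  have inst: "encode_instance = (\<lambda>I. encode_list encode_cell (fst I) @ encode_list encode_colored_segment (snd I))"
    by (auto simp: fun_eq_iff)
  show ?thesis unfolding inst cell seg by (intro fp_intros f)
qed

section \<open>From stack programs to the machine model\<close>

text \<open>In state 0 the machine walks over the input and guesses a symbol of \<open>{1..B}\<close> on tape \<open>RG\<close>
  for every input symbol. For \<open>B = 1\<close> this is deterministic.\<close>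

definition guess_trans :: "nat \<Rightarrow> transition set" where
  "guess_trans B = {(0, map \<rho> regs, 0, map (\<lambda>r. if r = RI then (\<rho> RI, Right_Move)
       else if r = RG then (Suc c, Right_Move) else (\<rho> r, No_Move)) regs) |
     \<rho> c. c < B \<and> \<rho> RI \<in> {1, 2} \<and> (\<forall>r. r \<noteq> RI \<longrightarrow> \<rho> r = 0)} \<union>
   {(0, map (\<lambda>_. 0) regs, 1, map (\<lambda>_. (0, Left_Move)) regs)}"

definition guess_conf :: "bool list \<Rightarrow> nat list \<Rightarrow> tape list" where
  "guess_conf w cs = map (\<lambda>r. if r = RI then (int (length cs), word_contents w)
     else if r = RG then (int (length cs), \<lambda>i. if 0 \<le> i \<and> i < int (length cs) then Suc (cs ! nat i) else 0)
     else (0, \<lambda>_. 0)) regs"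

definition loaded :: "bool list \<Rightarrow> nat list \<Rightarrow> store" where
  "loaded w cs r = (if r = RI then rev (map bit_symbol w) else if r = RG then rev (map Suc cs) else [])"

definition machine :: "nat \<Rightarrow> transition set \<Rightarrow> nat \<Rightarrow> tm" where
  "machine B D acc = \<lparr>tapes = length regs, delta = guess_trans B \<union> D, start = 0, accept = acc\<rparr>"

lemma map_regs_eq: "map f regs = map g regs \<longleftrightarrow> f = g"
  by (auto simp: set_regs fun_eq_iff)

lemma finite_guess_trans: "finite (guess_trans B)"
proof -
  let ?R = "{\<rho> :: reg \<Rightarrow> nat. \<forall>r. \<rho> r \<le> 2}"
  have "guess_trans B \<subseteq> (\<lambda>(\<rho>, c). (0, map \<rho> regs, 0, map (\<lambda>r. if r = RI then (\<rho> RI, Right_Move)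
       else if r = RG then (Suc c, Right_Move) else (\<rho> r, No_Move)) regs)) ` (?R \<times> {..<B}) \<union>
     {(0, map (\<lambda>_. 0) regs, 1, map (\<lambda>_. (0, Left_Move)) regs)}"
  proof
    fix \<tau> assume "\<tau> \<in> guess_trans B"
    then consider \<rho> c where "c < B" "\<rho> RI \<in> {1, 2}" "\<forall>r. r \<noteq> RI \<longrightarrow> \<rho> r = 0"
        "\<tau> = (0, map \<rho> regs, 0, map (\<lambda>r. if r = RI then (\<rho> RI, Right_Move)
          else if r = RG then (Suc c, Right_Move) else (\<rho> r, No_Move)) regs)"
      | "\<tau> = (0, map (\<lambda>_. 0) regs, 1, map (\<lambda>_. (0, Left_Move)) regs)"
      unfolding guess_trans_def by blast
    then show "\<tau> \<in> (\<lambda>(\<rho>, c). (0, map \<rho> regs, 0, map (\<lambda>r. if r = RI then (\<rho> RI, Right_Move)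
       else if r = RG then (Suc c, Right_Move) else (\<rho> r, No_Move)) regs)) ` (?R \<times> {..<B}) \<union>
     {(0, map (\<lambda>_. 0) regs, 1, map (\<lambda>_. (0, Left_Move)) regs)}"
    proof cases
      case 1
      have "\<rho> r \<le> 2" for r using 1 by (cases "r = RI") auto
      then show ?thesis using 1 by (intro UnI1 image_eqI[where x = "(\<rho>, c)"]) auto
    qed simp
  qed
  then show ?thesis by (rule finite_subset) (use finite_bounded_readings[of 2] in auto)
qed

lemma wf_machine:
  assumes "finite D" "\<And>\<tau>. \<tau> \<in> D \<Longrightarrow> wf_trans \<tau>"
  shows "wf_tm (machine B D acc)"
proof -
  have "wf_trans \<tau>" if "\<tau> \<in> guess_trans B" for \<tau>
    using that by (auto simp: guess_trans_def wf_trans_def)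
  then show ?thesis
    using assms finite_guess_trans[of B]
    by (fastforce simp: wf_tm_def machine_def wf_trans_def regs_nonempty Suc_le_eq)
qed

lemma guess_source: "(q, rs, q', as) \<in> guess_trans B \<Longrightarrow> q = 0"
  by (auto simp: guess_trans_def)

lemma step_iff: "step M (q, ts) c \<longleftrightarrow> (\<exists>q' as. (q, map read_tape ts, q', as) \<in> delta M \<and> c = (q', map2 act as ts))"
  by (subst step.simps) auto

lemma initial_machine: "initial (machine B D acc) w = (0, guess_conf w [])"
  by (simp add: initial_def machine_def guess_conf_def regs_def numeral_eq_Suc) (auto simp: fun_eq_iff)

lemma guess_reading:
  assumes "length cs \<le> length w"
  shows "map read_tape (guess_conf w cs) =
    map (\<lambda>r. if r = RI \<and> length cs < length w then bit_symbol (w ! length cs) else 0) regs"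
  using assms by (auto simp: guess_conf_def word_contents_def)

lemma guess_act:
  assumes "length cs < length w"
  shows "map2 act (map (\<lambda>r. if r = RI then (bit_symbol (w ! length cs), Right_Move)
       else if r = RG then (Suc c, Right_Move) else (0, No_Move)) regs) (guess_conf w cs)
     = guess_conf w (cs @ [c])"
  using assms unfolding guess_conf_def map2_map_same
  by (auto simp: word_contents_def fun_eq_iff nth_append)

text \<open>The common move to the left puts every head where \<open>stk\<close> expects it: on the
  last symbol of the input and guess tapes, and at -1 on the five empty tapes.\<close>

lemma guess_end:
  assumes "length cs = length w"
  shows "map2 act (map (\<lambda>_. (0, Left_Move)) regs) (guess_conf w cs) = conf (loaded w cs)"
  using assms unfolding guess_conf_def map2_map_same conf_def
  by (auto simp: word_contents_def fun_eq_iff loaded_def stk_def)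

lemma step_guess:
  assumes "length cs < length w" "\<And>q rs q' as. (q, rs, q', as) \<in> D \<Longrightarrow> q \<noteq> 0"
  shows "step (machine B D acc) (0, guess_conf w cs) c \<longleftrightarrow> (\<exists>g<B. c = (0, guess_conf w (cs @ [g])))"
proof
  assume "step (machine B D acc) (0, guess_conf w cs) c"
  then obtain q' as where "(0, map read_tape (guess_conf w cs), q', as) \<in> guess_trans B \<union> D"
    and c: "c = (q', map2 act as (guess_conf w cs))"
    unfolding step_iff by (auto simp: machine_def)
  then have t: "(0, map read_tape (guess_conf w cs), q', as) \<in> guess_trans B"
    using assms(2) by blast
  have r: "map read_tape (guess_conf w cs) = map (\<lambda>r. if r = RI then bit_symbol (w ! length cs) else 0) regs"
    using guess_reading[of cs w] assms(1) by simp
  have "bit_symbol (w ! length cs) \<noteq> 0" by (simp add: bit_symbol_def)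
  then have "\<exists>g<B. q' = 0 \<and> as = map (\<lambda>r. if r = RI then (bit_symbol (w ! length cs), Right_Move)
       else if r = RG then (Suc g, Right_Move) else (0, No_Move)) regs"
  proof -
    let ?\<rho> = "\<lambda>r. if r = RI then bit_symbol (w ! length cs) else 0"
    from t consider \<rho> g where "g < B" "map ?\<rho> regs = map \<rho> regs" "q' = 0" "as = map (\<lambda>r. if r = RI then (\<rho> RI, Right_Move)
       else if r = RG then (Suc g, Right_Move) else (\<rho> r, No_Move)) regs"
      | "map ?\<rho> regs = map (\<lambda>_. 0) regs"
      unfolding r guess_trans_def by blast
    then show ?thesis
    proof cases
      case 1
      then have "\<rho> = ?\<rho>" by (simp only: map_regs_eq)
      then show ?thesis using 1 by (intro exI[of _ g]) auto
    next
      case 2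
      then have "?\<rho> RI = 0" unfolding map_regs_eq by (rule fun_cong)
      then show ?thesis by (simp add: bit_symbol_def split: if_splits)
    qed
  qed
  then show "\<exists>g<B. c = (0, guess_conf w (cs @ [g]))"
    using c guess_act[OF assms(1)] by auto
next
  assume "\<exists>g<B. c = (0, guess_conf w (cs @ [g]))"
  then obtain g where g: "g < B" "c = (0, guess_conf w (cs @ [g]))" by blast
  let ?\<rho> = "\<lambda>r. if r = RI then bit_symbol (w ! length cs) else 0"
  have r: "map read_tape (guess_conf w cs) = map ?\<rho> regs"
    using guess_reading[of cs w] assms(1) by simp
  have "(0, map ?\<rho> regs, 0, map (\<lambda>r. if r = RI then (?\<rho> RI, Right_Move)
       else if r = RG then (Suc g, Right_Move) else (?\<rho> r, No_Move)) regs) \<in> guess_trans B"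
    unfolding guess_trans_def using g(1)
    by (intro UnI1 CollectI exI[of _ ?\<rho>] exI[of _ g]) (auto simp: bit_symbol_def)
  moreover have "map (\<lambda>r. if r = RI then (?\<rho> RI, Right_Move)
       else if r = RG then (Suc g, Right_Move) else (?\<rho> r, No_Move)) regs =
     map (\<lambda>r. if r = RI then (bit_symbol (w ! length cs), Right_Move)
       else if r = RG then (Suc g, Right_Move) else (0, No_Move)) regs"
    by auto
  ultimately show "step (machine B D acc) (0, guess_conf w cs) c"
    unfolding step_iff r g(2) guess_act[OF assms(1), of g, symmetric] by (auto simp: machine_def)
qed

lemma step_guess_end:
  assumes "length cs = length w" "\<And>q rs q' as. (q, rs, q', as) \<in> D \<Longrightarrow> q \<noteq> 0"
  shows "step (machine B D acc) (0, guess_conf w cs) c \<longleftrightarrow> c = (1, conf (loaded w cs))"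
proof -
  have r: "map read_tape (guess_conf w cs) = map (\<lambda>_. 0) regs"
    using guess_reading[of cs w] assms(1) by simp
  have "(0, map (\<lambda>_. 0) regs, q', as) \<in> guess_trans B \<union> D \<longleftrightarrow>
      q' = 1 \<and> as = map (\<lambda>_. (0, Left_Move)) regs" for q' as
    using assms(2) unfolding guess_trans_def by (auto simp: map_regs_eq fun_eq_iff set_regs regs_nonempty)
  then show ?thesis unfolding step_iff r by (auto simp: machine_def guess_end[OF assms(1)])
qed

lemma functional_guess: "functional (guess_trans 1)"
proof -
  have *: "q' = (if rs = map (\<lambda>_. 0) regs then 1 else 0) \<and>
     as = (if rs = map (\<lambda>_. 0) regs then map (\<lambda>_. (0, Left_Move)) regs
       else map2 (\<lambda>r s. if r = RI then (s, Right_Move) else if r = RG then (1, Right_Move) else (s, No_Move)) regs rs)"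
    if "(q, rs, q', as) \<in> guess_trans 1" for q rs q' as
    using that unfolding guess_trans_def by (elim UnE CollectE exE conjE) (auto simp: regs_def)
  show ?thesis unfolding functional_def
  proof (intro allI impI)
    fix q rs q1 as1 q2 as2
    assume "(q, rs, q1, as1) \<in> guess_trans 1" "(q, rs, q2, as2) \<in> guess_trans 1"
    from *[OF this(1)] *[OF this(2)] show "q1 = q2 \<and> as1 = as2" by simp
  qed
qed

section \<open>Loading the input and emitting the output\<close>

primrec cascade :: "nat \<Rightarrow> cmd" where
  "cascade 0 = const_cmd Leaf"
| "cascade (Suc j) = If RG (\<lambda>s. s = Suc j) (const_cmd (enc j)) (cascade j)"

lemma sz_nat [simp]: "sz (enc (n :: nat)) = Suc (2 * n)"
  by (simp add: enc_nat_def sz_list sum_list_replicate)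

text \<open>A tape symbol can only be tested, so a guessed symbol is turned into the tree of a
  number by trying all \<open>B\<close> candidates.\<close>

lemma ex_cascade:
  assumes "c < j" "peek (S RG) = Suc c"
  shows "ex (cascade j) S (S(RM := ser (enc c) @ S RM)) (2 * sz (enc c) + j)"
  using assms
proof (induction j)
  case (Suc j)
  show ?case
  proof (cases "c = j")
    case True
    show ?thesis unfolding cascade.simps True
      by (rule ex_If_True[OF _ ex_const[OF refl order_refl]]) (use Suc True in auto)
  next
    case False
    then have "ex (cascade j) S (S(RM := ser (enc c) @ S RM)) (2 * sz (enc c) + j)"
      by (intro Suc.IH) (use Suc.prems in auto)
    then show ?thesis unfolding cascade.simps
      by (rule ex_If_False[rotated]) (use False Suc.prems in auto)
  qed
qed simp

text \<open>Both stacks deliver their last symbol first, so consing yields the list in the original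
  order. The first of the two final pushes forms the pair, the second conses it to the list.\<close>

definition load_body :: "nat \<Rightarrow> cmd" where
  "load_body B = Seq (cascade B) (Seq (Pop RG) (Seq (If RI (\<lambda>s. s = 1) (const_cmd (enc False)) (const_cmd (enc True)))
     (Seq (Pop RI) (Seq (Push RM True) (Push RM True)))))"

definition load :: "nat \<Rightarrow> cmd" where
  "load B = Seq (Push RM False) (While RI (\<lambda>s. s \<noteq> 0) (load_body B))"

definition load_store :: "nat list \<Rightarrow> nat list \<Rightarrow> nat list \<Rightarrow> store" where
  "load_store i g m r = (if r = RI then i else if r = RG then g else if r = RM then m else [])"

lemma load_store_simps [simp]:
  "load_store i g m RI = i" "load_store i g m RG = g" "load_store i g m RM = m"
  "(load_store i g m)(RI := x) = load_store x g m"
  "(load_store i g m)(RG := x) = load_store i x m"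
  "(load_store i g m)(RM := x) = load_store i g x"
  by (auto simp: load_store_def fun_eq_iff)

lemma ex_load_loop:
  assumes "length ws = length cs" "\<forall>c\<in>set cs. c < B"
  shows "ex (While RI (\<lambda>s. s \<noteq> 0) (load_body B))
    (load_store (map bit_symbol ws) (map Suc cs) (ser (enc acc)))
    (load_store [] [] (ser (enc (rev (zip ws cs) @ acc)))) (length ws * (5 * B + 30) + 1)"
  using assms
proof (induction ws cs arbitrary: acc rule: list_induct2)
  case Nil
  show ?case by (auto intro!: ex_While_False)
next
  case (Cons b ws c cs)
  let ?m = "ser (enc acc)" and ?i = "map bit_symbol ws" and ?g = "map Suc cs"
  have 1: "ex (cascade B) (load_store (bit_symbol b # ?i) (Suc c # ?g) ?m)
      (load_store (bit_symbol b # ?i) (Suc c # ?g) (ser (enc c) @ ?m)) (2 * sz (enc c) + B)"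
    using ex_cascade[of c B "load_store (bit_symbol b # ?i) (Suc c # ?g) ?m"] Cons.prems by simp
  have 2: "ex (Pop RG) (load_store (bit_symbol b # ?i) (Suc c # ?g) (ser (enc c) @ ?m))
      (load_store (bit_symbol b # ?i) ?g (ser (enc c) @ ?m)) 1"
    by (rule ex_Pop[where x = "Suc c"]) auto
  have 3: "ex (If RI (\<lambda>s. s = 1) (const_cmd (enc False)) (const_cmd (enc True)))
      (load_store (bit_symbol b # ?i) ?g (ser (enc c) @ ?m))
      (load_store (bit_symbol b # ?i) ?g (ser (enc b) @ ser (enc c) @ ?m)) 7"
  proof (cases b)
    case True
    show ?thesis by (rule ex_If_False[where U = 6], simp add: True, rule ex_const) (auto simp: True)
  next
    case False
    show ?thesis by (rule ex_If_True[where U = 6], simp add: False, rule ex_const) (auto simp: False)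
  qed
  have 4: "ex (Pop RI) (load_store (bit_symbol b # ?i) ?g (ser (enc b) @ ser (enc c) @ ?m))
      (load_store ?i ?g (ser (enc b) @ ser (enc c) @ ?m)) 1"
    by (rule ex_Pop[where x = "bit_symbol b"]) auto
  have 5: "ex (Seq (Push RM True) (Push RM True)) (load_store ?i ?g (ser (enc b) @ ser (enc c) @ ?m))
      (load_store ?i ?g (ser (enc ((b, c) # acc)))) 4"
    by (rule ex_Seq[OF ex_Push[OF refl order_refl] ex_Push[OF _ order_refl]]) auto
  have body: "ex (load_body B) (load_store (map bit_symbol (b # ws)) (map Suc (c # cs)) ?m)
     (load_store ?i ?g (ser (enc ((b, c) # acc)))) (5 * B + 29)"
    unfolding load_body_def list.map
    by (rule ex_Seq[OF 1 ex_Seq[OF 2 ex_Seq[OF 3 ex_Seq[OF 4 5 order_refl] order_refl] order_refl]])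
       (use Cons.prems in auto)
  have IH: "ex (While RI (\<lambda>s. s \<noteq> 0) (load_body B)) (load_store ?i ?g (ser (enc ((b, c) # acc))))
    (load_store [] [] (ser (enc (rev (zip (b # ws) (c # cs)) @ acc)))) (length ws * (5 * B + 30) + 1)"
    using Cons.IH[of "(b, c) # acc"] Cons.prems by simp
  show ?case by (rule ex_While_True[OF _ body IH]) (auto simp: bit_symbol_def)
qed

lemma ex_load:
  assumes "length w = length cs" "\<forall>c\<in>set cs. c < B"
  shows "ex (load B) (loaded w cs) (st (ser (enc (zip w cs))) [] [] []) (length w * (5 * B + 30) + 3)"
proof -
  have s: "loaded w cs = load_store (rev (map bit_symbol w)) (rev (map Suc cs)) []"
    by (auto simp: loaded_def load_store_def)
  have e: "load_store [] [] m = st m [] [] []" for m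
  proof
    fix r show "load_store [] [] m r = st m [] [] [] r" by (cases r) (auto simp: load_store_def)
  qed
  have 1: "ex (Push RM False) (loaded w cs)
      (load_store (map bit_symbol (rev w)) (map Suc (rev cs)) (ser (enc ([] :: (bool \<times> nat) list)))) 2"
    unfolding s by (rule ex_Push) (auto simp: rev_map)
  have "rev (zip (rev w) (rev cs)) @ [] = zip w cs"
    using assms by (simp add: zip_rev)
  then have 2: "ex (While RI (\<lambda>s. s \<noteq> 0) (load_body B))
     (load_store (map bit_symbol (rev w)) (map Suc (rev cs)) (ser (enc ([] :: (bool \<times> nat) list))))
     (st (ser (enc (zip w cs))) [] [] []) (length w * (5 * B + 30) + 1)"
    using ex_load_loop[of "rev w" "rev cs" B "[]"] assms by (simp add: e)
  show ?thesis unfolding load_def by (rule ex_Seq[OF 1 2]) simp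
qed

text \<open>The first bit is pushed first and thus lands in cell 0, so the tape of \<open>RO\<close>
  holds the word itself. \<open>RO\<close> comes last in \<open>regs\<close> because the output is
  read from the last tape.\<close>

definition emit :: cmd where
  "emit = While RM (\<lambda>s. s = 2) (Seq (Pop RM) (If RM (\<lambda>s. s = 1) (Seq (Pop RM) (Push RO False))
     (Seq (Pop RM) (Seq (Pop RM) (Seq (Pop RM) (Push RO True))))))"

lemma ex_emit:
  "S RM = ser (enc (bs :: bool list)) \<Longrightarrow>
   ex emit S (S(RM := [1], RO := rev (map bit_symbol bs) @ S RO)) (length bs * 10 + 1)"
proof (induction bs arbitrary: S)
  case Nil
  then have e: "S(RM := [1], RO := rev (map bit_symbol []) @ S RO) = S" by (auto simp: fun_eq_iff)
  show ?case unfolding emit_def e by (rule ex_While_False) (use Nil in auto)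
next
  case (Cons b bs)
  let ?m = "ser (enc bs)"
  let ?S = "S(RM := ?m, RO := bit_symbol b # S RO)"
  have 1: "ex (Pop RM) S (S(RM := ser (enc b) @ ?m)) 1"
    by (rule ex_Pop[where x = 2]) (use Cons.prems in auto)
  have 2: "ex (If RM (\<lambda>s. s = 1) (Seq (Pop RM) (Push RO False))
     (Seq (Pop RM) (Seq (Pop RM) (Seq (Pop RM) (Push RO True))))) (S(RM := ser (enc b) @ ?m)) ?S 7"
  proof (cases b)
    case True
    have p1: "ex (Pop RM) (S(RM := 2 # 1 # 1 # ?m)) (S(RM := 1 # 1 # ?m)) 1" by (rule ex_Pop) auto
    have p2: "ex (Pop RM) (S(RM := 1 # 1 # ?m)) (S(RM := 1 # ?m)) 1" by (rule ex_Pop) auto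
    have p3: "ex (Pop RM) (S(RM := 1 # ?m)) (S(RM := ?m)) 1" by (rule ex_Pop) auto
    have p4: "ex (Push RO True) (S(RM := ?m)) ?S 2" by (rule ex_Push) (auto simp: True)
    show ?thesis
      by (rule ex_If_False[OF _ ex_Seq[OF _ ex_Seq[OF p2 ex_Seq[OF p3 p4 order_refl] order_refl]], where U = 5])
         (use p1 True in auto)
  next
    case False
    have p1: "ex (Pop RM) (S(RM := 1 # ?m)) (S(RM := ?m)) 1" by (rule ex_Pop) auto
    have p2: "ex (Push RO False) (S(RM := ?m)) ?S 2" by (rule ex_Push) (auto simp: False)
    show ?thesis
      by (rule ex_If_True[OF _ ex_Seq[OF _ p2], where U = 3]) (use p1 False in auto)
  qed
  have 3: "ex emit ?S (?S(RM := [1], RO := rev (map bit_symbol bs) @ ?S RO)) (length bs * 10 + 1)"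
    by (rule Cons.IH) simp
  have 4: "?S(RM := [1], RO := rev (map bit_symbol bs) @ ?S RO) =
      S(RM := [1], RO := rev (map bit_symbol (b # bs)) @ S RO)"
    by (auto simp: fun_eq_iff)
  show ?case unfolding emit_def
    by (rule ex_While_True[OF _ ex_Seq[OF 1 2 order_refl] 3[unfolded emit_def 4]]) (use Cons.prems in auto)
qed

lemma conf_output: "snd (last (conf S)) = snd (stk (S RO))"
  by (simp add: conf_def regs_def)

lemma pb_poly: assumes "pb T" obtains p :: "nat poly" where "\<And>n. T n \<le> poly p n"
proof -
  from assms obtain k where "\<And>n. T n \<le> (n + 2) ^ k" unfolding pb_def by blast
  moreover have "poly ([:2, 1:] ^ k) n = (n + 2) ^ k" for n :: nat
    by (simp add: poly_power add.commute)
  ultimately show ?thesis using that by metis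
qed

lemma sz_zip:
  assumes "\<forall>c\<in>set cs. c < B"
  shows "sz (enc (zip w cs :: (bool \<times> nat) list)) \<le> Suc (length w * (2 * B + 6))"
proof -
  have "sz (enc (zip w cs)) \<le> Suc (length (zip w cs) * Suc (2 * B + 5))"
  proof (rule sz_list_le)
    fix p assume "p \<in> set (zip w cs)"
    then have "snd p < B" using assms by (metis in_set_zipE prod.collapse)
    then show "sz (enc p) \<le> 2 * B + 5" by (simp add: enc_prod_def enc_bool_def)
  qed
  also have "\<dots> \<le> Suc (length w * Suc (2 * B + 5))"
    by (simp only: Suc_le_mono mult_le_mono1 length_zip min.cobounded1)
  finally show ?thesis by (simp add: algebra_simps)
qed

text \<open>Common to both kinds of machine. For \<open>B = 1\<close> every guessed symbol is 0, the
  machine is deterministic, and the guesses are projected away.\<close>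

lemma loaded_run:
  assumes "fp (f :: (bool \<times> nat) list \<Rightarrow> 'a::enc)"
  obtains c T where "pb T" and
    "\<And>w cs. length w = length cs \<Longrightarrow> \<forall>c\<in>set cs. c < B \<Longrightarrow>
       ex (Seq (load B) c) (loaded w cs) (st (ser (enc (f (zip w cs)))) [] [] []) (T (length w))"
proof -
  obtain c k where c: "\<And>x. run c [enc x] [enc (f x)] ((sz (enc x) + 2) ^ k)"
    using assms by (rule fpE) blast
  let ?T = "\<lambda>n. (n * (5 * B + 30) + 3) + (Suc (n * (2 * B + 6)) + 2) ^ k"
  have "ex (Seq (load B) c) (loaded w cs) (st (ser (enc (f (zip w cs)))) [] [] []) (?T (length w))"
    if "length w = length cs" "\<forall>c\<in>set cs. c < B" for w cs
  proof -
    have "run c [enc (zip w cs)] [enc (f (zip w cs))] ((Suc (length w * (2 * B + 6)) + 2) ^ k)"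
      by (rule run_mono[OF c power_mono]) (use sz_zip[OF that(2)] in auto)
    then have "ex c (st (ser (enc (zip w cs)) @ []) [] [] []) (st (ser (enc (f (zip w cs))) @ []) [] [] [])
        ((Suc (length w * (2 * B + 6)) + 2) ^ k)"
      unfolding run_def by (auto dest: spec[of _ "[]"])
    then show ?thesis using ex_Seq[OF ex_load[OF that] _ order_refl] by simp
  qed
  moreover have "pb ?T" by (intro pb_intros)
  ultimately show ?thesis using that by blast
qed

lemma bounded_loaded:
  assumes "\<forall>c\<in>set cs. c < B" shows "bounded_store (B + 2) (loaded w cs)"
  using assms by (auto simp: bounded_store_def loaded_def bit_symbol_def)

theorem fp_poly_time_computable:
  assumes "fp f" shows "poly_time_computable f"
proof -
  have "fp (\<lambda>z :: (bool \<times> nat) list. f (map fst z))"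
    by (intro fp_comp[OF assms] fp_intros)
  then obtain c T where T: "pb T" and c: "\<And>w cs. length w = length cs \<Longrightarrow> \<forall>c\<in>set cs. c < 1 \<Longrightarrow>
       ex (Seq (load 1) c) (loaded w cs) (st (ser (enc (f (map fst (zip w cs))))) [] [] []) (T (length w))"
    by (rule loaded_run[where B = 1]) blast
  obtain k where k: "\<And>w. sz (enc (f w)) \<le> (sz (enc w) + 2) ^ k"
    using assms by (rule fp_size) blast
  define prog where "prog = Seq (Seq (load 1) c) emit"
  \<comment> \<open>Symbols up to \<open>B + 2 = 3\<close> occur. The exit state
    \<open>1 + csize prog\<close> is the source of no transition, so the machine halts
    there.\<close>
  define D where "D = compile 3 prog 1 (1 + csize prog)"
  let ?M = "machine 1 D 0"
  let ?T = "\<lambda>n. (n + 1) + (T n + ((4 * n + 3) ^ k * 10 + 1))"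
  have src: "(q, rs, q', as) \<in> D \<Longrightarrow> 1 \<le> q \<and> q < 1 + csize prog" for q rs q' as
    using compile_source unfolding D_def by blast
  have "functional (guess_trans 1 \<union> D)"
    by (rule functional_Un[OF functional_guess]) (use src guess_source functional_compile in \<open>fastforce simp: D_def\<close>)+
  then have det: "deterministic ?M"
    unfolding deterministic_def functional_def machine_def by simp
  have "computes_in_time ?M f ?T"
    unfolding computes_in_time_def
  proof
    fix w :: "bool list"
    let ?cs = "replicate (length w) (0 :: nat)"
    have guess: "(step ?M ^^ j) (0, guess_conf w []) (0, guess_conf w (replicate j 0))" if "j \<le> length w" for j
      using that
    proof (induction j)
      case (Suc j)
      then have "step ?M (0, guess_conf w (replicate j 0)) (0, guess_conf w (replicate j 0 @ [0]))"
        by (subst step_guess) (auto dest: src)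
      with Suc show ?case by (auto simp: replicate_append_same)
    qed simp
    have "step ?M (0, guess_conf w ?cs) (1, conf (loaded w ?cs))"
      by (subst step_guess_end) (auto dest: src)
    with guess[of "length w"] have 1: "(step ?M ^^ Suc (length w)) (initial ?M w) (1, conf (loaded w ?cs))"
      unfolding initial_machine by auto
    have m: "map fst (zip w ?cs) = w" by (simp add: map_fst_zip)
    have len: "length (f w) \<le> (4 * length w + 3) ^ k"
    proof -
      have "sz (enc w) \<le> Suc (length w * Suc 3)" by (rule sz_list_le) (simp add: enc_bool_def)
      then have "(sz (enc w) + 2) ^ k \<le> (4 * length w + 3) ^ k" by (intro power_mono) auto
      then show ?thesis using length_le_sz[of "f w"] k[of w] by linarith
    qed
    let ?S = "st (ser (enc (f w))) [] [] []"
    let ?S' = "?S(RM := [1], RO := rev (map bit_symbol (f w)) @ ?S RO)"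
    have "ex emit ?S ?S' ((4 * length w + 3) ^ k * 10 + 1)"
      by (rule ex_mono[OF ex_emit]) (use len in auto)
    then have "ex prog (loaded w ?cs) ?S' (T (length w) + ((4 * length w + 3) ^ k * 10 + 1))"
    proof -
      assume e: "ex emit ?S ?S' ((4 * length w + 3) ^ k * 10 + 1)"
      have "ex (Seq (load 1) c) (loaded w ?cs) ?S (T (length w))"
        using c[of w ?cs] unfolding m by simp
      then show ?thesis unfolding prog_def by (rule ex_Seq[OF _ e order_refl])
    qed
    then obtain t where t: "t \<le> T (length w) + ((4 * length w + 3) ^ k * 10 + 1)"
        "exec prog (loaded w ?cs) ?S' t"
      unfolding ex_def by blast
    have 2: "(step ?M ^^ t) (1, conf (loaded w ?cs)) (1 + csize prog, conf ?S')"
    proof -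
      have "bounded_store 3 (loaded w ?cs)" using bounded_loaded[of ?cs 1 w] by (simp add: numeral_3_eq_3)
      then show ?thesis
        using exec_compile[OF t(2), of 3 1 "1 + csize prog" ?M] by (auto simp: machine_def D_def)
    qed
    have "halted ?M (1 + csize prog, conf ?S')"
      unfolding halted_def step_iff using src guess_source by (fastforce simp: machine_def)
    moreover have "snd (last (conf ?S')) = word_contents (f w)"
      by (auto simp: conf_output stk_def word_contents_def fun_eq_iff simp flip: map_append)
    moreover have "(step ?M ^^ (Suc (length w) + t)) (initial ?M w) (1 + csize prog, conf ?S')"
      using 1 2 unfolding relpowp_add by blast
    moreover have "Suc (length w) + t \<le> ?T (length w)" using t(1) by simp
    ultimately show "\<exists>n\<le>?T (length w). \<exists>c. (step ?M ^^ n) (initial ?M w) c \<and> halted ?M c \<and>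
        snd (last (snd c)) = word_contents (f w)"
      by (metis snd_conv)
  qed
  moreover have "pb ?T" by (intro pb_intros T)
  then obtain p where p: "\<And>n. ?T n \<le> poly p n" using pb_poly by blast
  ultimately have "computes_in_time ?M f (poly p)"
    unfolding computes_in_time_def by (meson le_trans)
  moreover have "wf_tm ?M" unfolding D_def by (rule wf_machine[OF finite_compile wf_compile])
  ultimately show ?thesis using det unfolding poly_time_computable_def by blast
qed

text \<open>Deciding a language is a statement about all paths. The machine below is deterministic
  only after its guessing phase, so determinism is required only on an invariant set
  \<open>P\<close> of configurations; there one halting run determines all others.\<close>

lemma det_run:
  assumes "(step M ^^ n) c d" "halted M d"
    and inv: "P c" "\<And>c d. P c \<Longrightarrow> step M c d \<Longrightarrow> P d"
    and unique: "\<And>c d e. P c \<Longrightarrow> step M c d \<Longrightarrow> step M c e \<Longrightarrow> d = e"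
  shows "((step M ^^ m) c e \<longrightarrow> m \<le> n) \<and> ((step M)\<^sup>*\<^sup>* c e \<longrightarrow> halted M e \<longrightarrow> e = d)"
  using assms(1) inv(1)
proof (induction n arbitrary: c m)
  case 0
  then have "c = d" by simp
  then have no: "\<not> step M c x" for x using assms(2) unfolding halted_def by blast
  then have "(step M ^^ m) c e \<Longrightarrow> m = 0" by (cases m) (auto simp del: relpowp.simps dest: relpowp_Suc_D2)
  then show ?case using no \<open>c = d\<close> by (auto elim: converse_rtranclpE)
next
  case (Suc n)
  then obtain c1 where c1: "step M c c1" "(step M ^^ n) c1 d" by (blast dest: relpowp_Suc_D2)
  have P1: "P c1" using inv(2) Suc.prems(2) c1(1) .
  have u: "x = c1" if "step M c x" for x using unique[OF Suc.prems(2) that c1(1)] .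
  have "m \<le> Suc n" if m: "(step M ^^ m) c e"
  proof (cases m)
    case (Suc m')
    then obtain x where "step M c x" "(step M ^^ m') x e" using m by (blast dest: relpowp_Suc_D2)
    then show ?thesis using u Suc.IH[OF c1(2) P1, of m'] Suc by auto
  qed simp
  moreover have "e = d" if "(step M)\<^sup>*\<^sup>* c e" "halted M e"
    using that(1)
  proof (cases rule: converse_rtranclpE)
    case base
    then show ?thesis using that(2) c1(1) unfolding halted_def by blast
  next
    case (step y)
    then show ?thesis using u Suc.IH[OF c1(2) P1] that(2) by auto
  qed
  ultimately show ?case by blast
qed

theorem NP_I:
  assumes V: "fp (V :: (bool \<times> nat) list \<Rightarrow> bool)" and B: "B > 0"
    and L: "\<And>w. w \<in> L \<longleftrightarrow> (\<exists>cs. length cs = length w \<and> (\<forall>c\<in>set cs. c < B) \<and> V (zip w cs))"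
  shows "L \<in> NP"
proof -
  obtain c T where T: "pb T" and c: "\<And>w cs. length w = length cs \<Longrightarrow> \<forall>c\<in>set cs. c < B \<Longrightarrow>
       ex (Seq (load B) c) (loaded w cs) (st (ser (enc (V (zip w cs)))) [] [] []) (T (length w))"
    using V by (rule loaded_run[where B = B]) blast
  let ?A = "B + 2"
  define prog where "prog = Seq (load B) c"
  define z where "z = 1 + csize prog"
  have zpos: "1 \<le> z" by (simp add: z_def)
  \<comment> \<open>The code of \<open>True\<close> starts with 2, that of \<open>False\<close> with
    1. So only the answer \<open>True\<close> leads from \<open>z\<close> to the accepting state;
    otherwise the machine halts in \<open>z\<close>.\<close>
  define E where "E = {(z, map \<rho> regs, Suc z, map (\<lambda>r. (\<rho> r, No_Move)) regs) |\<rho>. (\<forall>r. \<rho> r \<le> ?A) \<and> \<rho> RM = 2}"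
  define D where "D = compile ?A prog 1 z \<union> E"
  let ?M = "machine B D (Suc z)"
  have Esub: "E \<subseteq> trans_of ?A z (\<lambda>_. Suc z) (\<lambda>_ s. (s, No_Move))"
    by (auto simp: trans_of_def E_def)
  have src: "(q, rs, q', as) \<in> D \<Longrightarrow> 1 \<le> q \<and> q \<le> z" for q rs q' as
    using compile_source[of q rs q' as ?A prog 1 z] by (auto simp: D_def E_def z_def)
  have tgt: "(q, rs, q', as) \<in> D \<Longrightarrow> 1 \<le> q'" for q rs q' as
    using compile_target[of q rs q' as ?A prog 1 z] by (auto simp: D_def E_def z_def)
  have "functional E"
    using functional_trans_of[of ?A z "\<lambda>_. Suc z" "\<lambda>_ s. (s, No_Move)"] Esub
    unfolding functional_def by blast
  then have fD: "functional D"
    unfolding D_def by (intro functional_Un[OF functional_compile]) (auto dest!: compile_source simp: E_def z_def)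
  have wf: "wf_tm ?M"
  proof (rule wf_machine)
    show "finite D" unfolding D_def using finite_compile finite_subset[OF Esub finite_trans_of] by blast
    show "wf_trans \<tau>" if "\<tau> \<in> D" for \<tau>
      using that wf_compile wf_trans_of Esub unfolding D_def by blast
  qed
  have stepD: "step ?M (q, ts) d \<longleftrightarrow> (\<exists>q' as. (q, map read_tape ts, q', as) \<in> D \<and> d = (q', map2 act as ts))"
    if "1 \<le> q" for q ts d
    using that unfolding step_iff by (auto simp: machine_def dest: guess_source)
  let ?P = "\<lambda>c :: config. 1 \<le> fst c"
  have invP: "?P d" if "?P c" "step ?M c d" for c d
    using that tgt by (cases c) (auto simp: stepD)
  have uniq: "d = e" if P: "?P c" and s: "step ?M c d" "step ?M c e" for c d e
  proof -
    obtain q ts where c: "c = (q, ts)" by force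
    have q: "1 \<le> q" using P c by simp
    obtain q1 a1 where d: "(q, map read_tape ts, q1, a1) \<in> D" "d = (q1, map2 act a1 ts)"
      using s(1) unfolding c stepD[OF q] by blast
    obtain q2 a2 where e: "(q, map read_tape ts, q2, a2) \<in> D" "e = (q2, map2 act a2 ts)"
      using s(2) unfolding c stepD[OF q] by blast
    show ?thesis using functionalD[OF fD d(1) e(1)] d(2) e(2) by simp
  qed
  have run: "\<exists>t d. t \<le> T (length w) + 1 \<and> (step ?M ^^ t) (1, conf (loaded w cs)) d \<and> halted ?M d \<and>
      (fst d = Suc z \<longleftrightarrow> V (zip w cs))"
    if cs: "length w = length cs" "\<forall>c\<in>set cs. c < B" for w cs
  proof -
    let ?S = "st (ser (enc (V (zip w cs)))) [] [] []"
    obtain t where t: "t \<le> T (length w)" "exec prog (loaded w cs) ?S t"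
      using c[OF cs] unfolding ex_def prog_def by blast
    have 2: "(step ?M ^^ t) (1, conf (loaded w cs)) (z, conf ?S) \<and> bounded_store ?A ?S"
      by (rule exec_compile[OF t(2) bounded_loaded[OF cs(2)]]) (auto simp: machine_def D_def)
    have readS: "map read_tape (conf ?S) = map (\<lambda>r. peek (?S r)) regs"
      by (simp add: conf_def)
    have zD: "(z, rs, q', as) \<in> D \<longleftrightarrow> (z, rs, q', as) \<in> E" for rs q' as
      using compile_source[of z rs q' as ?A prog 1 z] by (auto simp: D_def E_def z_def)
    show ?thesis
    proof (cases "V (zip w cs)")
      case True
      have "(z, map (\<lambda>r. peek (?S r)) regs, Suc z, map (\<lambda>r. (peek (?S r), No_Move)) regs) \<in> E"
        using 2 True unfolding E_def by (intro CollectI exI[of _ "\<lambda>r. peek (?S r)"]) (auto simp: bounded_store_peek simp del: st.simps, simp)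
      then have "step ?M (z, conf ?S) (Suc z, map2 act (map (\<lambda>r. (peek (?S r), No_Move)) regs) (conf ?S))"
        unfolding stepD[OF zpos] readS by (auto simp: D_def)
      then have "(step ?M ^^ Suc t) (1, conf (loaded w cs))
          (Suc z, map2 act (map (\<lambda>r. (peek (?S r), No_Move)) regs) (conf ?S))"
        using 2 by auto
      moreover have "\<not> step ?M (Suc z, ts) x" for ts x
        by (subst stepD) (auto dest: src)
      then have "halted ?M (Suc z, ts)" for ts
        unfolding halted_def by blast
      ultimately show ?thesis using True t(1)
        by (intro exI[of _ "Suc t"] exI[of _ "(Suc z, map2 act (map (\<lambda>r. (peek (?S r), No_Move)) regs) (conf ?S))"])
           auto
    next
      case False
      have "halted ?M (z, conf ?S)"
        unfolding halted_def
      proof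
        assume "\<exists>c'. step ?M (z, conf ?S) c'"
        then obtain q' as where "(z, map (\<lambda>r. peek (?S r)) regs, q', as) \<in> E"
          using zD zpos by (auto simp: stepD readS)
        then obtain \<rho> where "map (\<lambda>r. peek (?S r)) regs = map \<rho> regs" "\<rho> RM = 2" unfolding E_def by blast
        then have "peek (?S RM) = 2" by (metis map_regs_eq)
        then show False using False by simp
      qed
      then show ?thesis using False 2 t(1) by (intro exI[of _ t] exI[of _ "(z, conf ?S)"]) auto
    qed
  qed
  have D0: "\<And>q rs q' as. (q, rs, q', as) \<in> D \<Longrightarrow> q \<noteq> 0" using src by force
  \<comment> \<open>Induction on the number of positions without a guess. The time bound adds up the
    outstanding guesses, the step that ends the guessing phase, the program, and a possible step
    into the accepting state.\<close>
  have main: "((step ?M ^^ m) (0, guess_conf w cs) e \<longrightarrow> m \<le> (length w - length cs) + 1 + (T (length w) + 1)) \<and>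
     ((\<exists>e. (step ?M)\<^sup>*\<^sup>* (0, guess_conf w cs) e \<and> halted ?M e \<and> fst e = Suc z) \<longleftrightarrow>
      (\<exists>cs'. length (cs @ cs') = length w \<and> (\<forall>c\<in>set cs'. c < B) \<and> V (zip w (cs @ cs'))))"
    if "length cs \<le> length w" "\<forall>c\<in>set cs. c < B" for w cs m e
    using that
  proof (induction "length w - length cs" arbitrary: cs m e)
    case 0
    then have len: "length cs = length w" by simp
    obtain t d where d: "t \<le> T (length w) + 1" "(step ?M ^^ t) (1, conf (loaded w cs)) d" "halted ?M d"
        "fst d = Suc z \<longleftrightarrow> V (zip w cs)"
      using run[of w cs] len 0 by metis
    have dr: "((step ?M ^^ i) (1, conf (loaded w cs)) x \<longrightarrow> i \<le> t) \<and>
        ((step ?M)\<^sup>*\<^sup>* (1, conf (loaded w cs)) x \<longrightarrow> halted ?M x \<longrightarrow> x = d)" for i x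
    proof (rule det_run[OF d(2,3), where P = ?P])
      show "?P (1, conf (loaded w cs))" by simp
      show "?P y" if "?P x" "step ?M x y" for x y by (rule invP[OF that])
      show "y = y'" if "?P x" "step ?M x y" "step ?M x y'" for x y y' by (rule uniq[OF that])
    qed
    have st: "step ?M (0, guess_conf w cs) x \<longleftrightarrow> x = (1, conf (loaded w cs))" for x
      by (rule step_guess_end[OF len D0])
    have "m \<le> (length w - length cs) + 1 + (T (length w) + 1)" if m: "(step ?M ^^ m) (0, guess_conf w cs) e"
    proof (cases m)
      case (Suc m')
      then obtain x where "step ?M (0, guess_conf w cs) x" "(step ?M ^^ m') x e"
        using m by (blast dest: relpowp_Suc_D2)
      then have "(step ?M ^^ m') (1, conf (loaded w cs)) e" using st by auto
      then have "m' \<le> t" using dr by blast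
      then show ?thesis using d(1) Suc by simp
    qed simp
    moreover have "(\<exists>e. (step ?M)\<^sup>*\<^sup>* (0, guess_conf w cs) e \<and> halted ?M e \<and> fst e = Suc z) \<longleftrightarrow> V (zip w cs)"
    proof
      assume "\<exists>e. (step ?M)\<^sup>*\<^sup>* (0, guess_conf w cs) e \<and> halted ?M e \<and> fst e = Suc z"
      then obtain e where e: "(step ?M)\<^sup>*\<^sup>* (0, guess_conf w cs) e" "halted ?M e" "fst e = Suc z" by blast
      from e(1) have "(step ?M)\<^sup>*\<^sup>* (1, conf (loaded w cs)) e"
        by (cases rule: converse_rtranclpE) (use e st in auto)
      then have "e = d" using dr e(2) by blast
      then show "V (zip w cs)" using e(3) d(4) by simp
    next
      assume "V (zip w cs)"
      moreover have "(step ?M)\<^sup>*\<^sup>* (0, guess_conf w cs) d"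
        by (rule converse_rtranclp_into_rtranclp[OF _ relpowp_imp_rtranclp[OF d(2)]]) (simp add: st)
      ultimately show "\<exists>e. (step ?M)\<^sup>*\<^sup>* (0, guess_conf w cs) e \<and> halted ?M e \<and> fst e = Suc z"
        using d(3,4) by blast
    qed
    ultimately show ?case using len by simp
  next
    case (Suc n)
    then have len: "length cs < length w" by simp
    have st: "step ?M (0, guess_conf w cs) x \<longleftrightarrow> (\<exists>g<B. x = (0, guess_conf w (cs @ [g])))" for x
      by (rule step_guess[OF len D0])
    have IH: "((step ?M ^^ m) (0, guess_conf w (cs @ [g])) e \<longrightarrow> m \<le> (length w - length (cs @ [g])) + 1 + (T (length w) + 1)) \<and>
       ((\<exists>e. (step ?M)\<^sup>*\<^sup>* (0, guess_conf w (cs @ [g])) e \<and> halted ?M e \<and> fst e = Suc z) \<longleftrightarrow>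
        (\<exists>cs'. length ((cs @ [g]) @ cs') = length w \<and> (\<forall>c\<in>set cs'. c < B) \<and> V (zip w ((cs @ [g]) @ cs'))))"
      if "g < B" for g m e
      by (rule Suc.hyps) (use Suc that len in auto)
    have "m \<le> (length w - length cs) + 1 + (T (length w) + 1)" if m: "(step ?M ^^ m) (0, guess_conf w cs) e"
    proof (cases m)
      case (Suc m')
      then obtain x where "step ?M (0, guess_conf w cs) x" "(step ?M ^^ m') x e"
        using m by (blast dest: relpowp_Suc_D2)
      then obtain g where g: "g < B" "(step ?M ^^ m') (0, guess_conf w (cs @ [g])) e" using st by auto
      then show ?thesis using IH[OF g(1), of m' e] Suc len by auto
    qed simp
    moreover have "(\<exists>e. (step ?M)\<^sup>*\<^sup>* (0, guess_conf w cs) e \<and> halted ?M e \<and> fst e = Suc z) \<longleftrightarrow>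
      (\<exists>g<B. \<exists>e. (step ?M)\<^sup>*\<^sup>* (0, guess_conf w (cs @ [g])) e \<and> halted ?M e \<and> fst e = Suc z)" (is "?l \<longleftrightarrow> ?r")
    proof
      assume ?l
      then obtain e where e: "(step ?M)\<^sup>*\<^sup>* (0, guess_conf w cs) e" "halted ?M e" "fst e = Suc z" by blast
      from e(1) show ?r
      proof (cases rule: converse_rtranclpE)
        case base
        then show ?thesis using e(3) by auto
      next
        case (step y)
        then obtain g where "g < B" "y = (0, guess_conf w (cs @ [g]))" using st by blast
        then show ?thesis using step(2) e(2,3) by blast
      qed
    next
      assume ?r
      then obtain g e where g: "g < B" and e: "(step ?M)\<^sup>*\<^sup>* (0, guess_conf w (cs @ [g])) e" "halted ?M e" "fst e = Suc z"
        by blast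
      have "step ?M (0, guess_conf w cs) (0, guess_conf w (cs @ [g]))" using st g by blast
      from converse_rtranclp_into_rtranclp[OF this e(1)] e(2,3) show ?l by blast
    qed
    moreover have "\<dots> \<longleftrightarrow> (\<exists>g<B. \<exists>cs'. length ((cs @ [g]) @ cs') = length w \<and> (\<forall>c\<in>set cs'. c < B) \<and> V (zip w ((cs @ [g]) @ cs')))"
      using IH by blast
    moreover have "\<dots> \<longleftrightarrow> (\<exists>cs'. length (cs @ cs') = length w \<and> (\<forall>c\<in>set cs'. c < B) \<and> V (zip w (cs @ cs')))" (is "?l \<longleftrightarrow> ?r")
    proof
      assume ?l
      then obtain g cs' where "g < B" "length ((cs @ [g]) @ cs') = length w" "\<forall>c\<in>set cs'. c < B" "V (zip w ((cs @ [g]) @ cs'))"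
        by blast
      then show ?r by (intro exI[of _ "g # cs'"]) auto
    next
      assume ?r
      then obtain cs' where cs': "length (cs @ cs') = length w" "\<forall>c\<in>set cs'. c < B" "V (zip w (cs @ cs'))" by blast
      then obtain g cs'' where "cs' = g # cs''" using len by (cases cs') auto
      then show ?l using cs' by (intro exI[of _ g] conjI exI[of _ cs'']) auto
    qed
    ultimately show ?case by blast
  qed
  have "pb (\<lambda>n. n + 1 + (T n + 1))" by (intro pb_intros T)
  then obtain p where p: "\<And>n. n + 1 + (T n + 1) \<le> poly p n" using pb_poly by blast
  have "decides_in_time ?M L (poly p)"
    unfolding decides_in_time_def
  proof (intro allI conjI impI)
    fix w n e assume "(step ?M ^^ n) (initial ?M w) e"
    then have "n \<le> length w + 1 + (T (length w) + 1)"
      using main[of "[]" w n e] unfolding initial_machine by simp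
    then show "n \<le> poly p (length w)" using p le_trans by blast
  next
    fix w
    have "accept ?M = Suc z" by (simp add: machine_def)
    then show "(w \<in> L) = (\<exists>c. (step ?M)\<^sup>*\<^sup>* (initial ?M w) c \<and> halted ?M c \<and> fst c = accept ?M)"
      using main[of "[]" w] unfolding initial_machine L by simp
  qed
  with wf show ?thesis unfolding NP_def by blast
qed

section \<open>A combinatorial description of polyominoes\<close>

text \<open>A finite edge-connected set of cells is a polyomino iff its complement is edge-connected.
  One direction is the Borsuk separation theorem, applied to the union of the squares in the
  complex plane. For the other, the union is a retract of an open neighbourhood, hence of
  the union of slightly enlarged open squares, and that is simply connected because its
  complement is connected.\<close>

lemma share_edge_iff:
  "share_edge (x, y) (x', y') \<longleftrightarrow> \<bar>x - x'\<bar> + \<bar>y - y'\<bar> = 1"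
proof
  assume "share_edge (x, y) (x', y')"
  then obtain s t where *: "(x, y) \<noteq> (x', y')" "segment_of (x, y) s = segment_of (x', y') t"
    unfolding share_edge_def by blast
  then show "\<bar>x - x'\<bar> + \<bar>y - y'\<bar> = 1" by (cases s; cases t) auto
next
  assume *: "\<bar>x - x'\<bar> + \<bar>y - y'\<bar> = 1"
  then consider "x' = x" "y' = y + 1" | "x' = x" "y' = y - 1" | "y' = y" "x' = x + 1" | "y' = y" "x' = x - 1"
    by linarith
  then show "share_edge (x, y) (x', y')"
  proof cases
    case 1
    then have "segment_of (x, y) North = segment_of (x', y') South" by simp
    with 1 show ?thesis unfolding share_edge_def by (metis add_cancel_right_right prod.inject zero_neq_one)
  next
    case 2
    then have "segment_of (x, y) South = segment_of (x', y') North" by simp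
    moreover have "(x, y) \<noteq> (x', y')" using 2 by simp
    ultimately show ?thesis unfolding share_edge_def by blast
  next
    case 3
    then have "segment_of (x, y) East = segment_of (x', y') West" by simp
    moreover have "(x, y) \<noteq> (x', y')" using 3 by simp
    ultimately show ?thesis unfolding share_edge_def by blast
  next
    case 4
    then have "segment_of (x, y) West = segment_of (x', y') East" by simp
    moreover have "(x, y) \<noteq> (x', y')" using 4 by simp
    ultimately show ?thesis unfolding share_edge_def by blast
  qed
qed

lemma share_edge_sym: "share_edge p q \<Longrightarrow> share_edge q p"
  unfolding share_edge_def by metis

definition linked :: "cell set \<Rightarrow> cell \<Rightarrow> cell \<Rightarrow> bool" where
  "linked D = (\<lambda>a b. a \<in> D \<and> b \<in> D \<and> share_edge a b)\<^sup>*\<^sup>*"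

lemma edge_connected_linked: "edge_connected D \<longleftrightarrow> (\<forall>p\<in>D. \<forall>q\<in>D. linked D p q)"
  by (simp add: edge_connected_def linked_def)

lemma linked_refl: "linked D p p"
  by (simp add: linked_def)

lemma linked_trans: "linked D p q \<Longrightarrow> linked D q r \<Longrightarrow> linked D p r"
  unfolding linked_def by (rule rtranclp_trans)

lemma linked_sym: "linked D p q \<Longrightarrow> linked D q p"
  unfolding linked_def
proof (induction rule: rtranclp_induct)
  case (step y z)
  then show ?case by (metis (no_types, lifting) converse_rtranclp_into_rtranclp share_edge_sym)
qed simp

lemma linked_step: "p \<in> D \<Longrightarrow> q \<in> D \<Longrightarrow> share_edge p q \<Longrightarrow> linked D p q"
  unfolding linked_def by blast

section \<open>Squares in the complex plane\<close>

definition csquare :: "cell \<Rightarrow> complex set" where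
  "csquare p = {z. of_int (fst p) \<le> Re z \<and> Re z \<le> of_int (fst p) + 1 \<and>
                   of_int (snd p) \<le> Im z \<and> Im z \<le> of_int (snd p) + 1}"

definition cunion :: "cell set \<Rightarrow> complex set" where
  "cunion D = (\<Union>p\<in>D. csquare p)"

definition osquare :: "real \<Rightarrow> cell \<Rightarrow> complex set" where
  "osquare \<epsilon> p = {z. of_int (fst p) - \<epsilon> < Re z \<and> Re z < of_int (fst p) + 1 + \<epsilon> \<and>
                   of_int (snd p) - \<epsilon> < Im z \<and> Im z < of_int (snd p) + 1 + \<epsilon>}"

definition ounion :: "real \<Rightarrow> cell set \<Rightarrow> complex set" where
  "ounion \<epsilon> D = (\<Union>p\<in>D. osquare \<epsilon> p)"

lemma csquare_cbox: "csquare (x, y) = cbox (Complex x y) (Complex (x + 1) (y + 1))"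
  by (auto simp: csquare_def in_cbox_complex_iff)

lemma osquare_box: "osquare \<epsilon> (x, y) = box (Complex (x - \<epsilon>) (y - \<epsilon>)) (Complex (x + 1 + \<epsilon>) (y + 1 + \<epsilon>))"
  by (auto simp: osquare_def in_box_complex_iff)

lemma compact_cunion: "finite D \<Longrightarrow> compact (cunion D)"
proof -
  assume D: "finite D"
  have "compact (csquare p)" for p by (cases p) (simp add: csquare_cbox)
  then show ?thesis unfolding cunion_def using D by blast
qed

text \<open>Passing to the complex numbers makes two results about planar sets applicable: Borsuk's
  separation theorem, and the description of bounded simply connected open sets by connected
  complements.\<close>

lemma simply_connected_cunion:
  "simply_connected (\<Union>p\<in>D. unit_square p) \<longleftrightarrow> simply_connected (cunion D)"
proof (rule homeomorphic_simply_connected_eq)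
  let ?S = "\<Union>p\<in>D. unit_square p"
  let ?f = "\<lambda>z :: real \<times> real. Complex (fst z) (snd z)"
  let ?g = "\<lambda>z. (Re z, Im z)"
  have us: "unit_square p = {z. of_int (fst p) \<le> fst z \<and> fst z \<le> of_int (fst p) + 1 \<and>
                   of_int (snd p) \<le> snd z \<and> snd z \<le> of_int (snd p) + 1}" for p
    by (cases p) (auto simp: cbox_Pair_eq)
  have "homeomorphism ?S (cunion D) ?f ?g"
  proof (rule homeomorphismI)
    show "continuous_on ?S ?f" unfolding Complex_eq by (intro continuous_intros)
    show "continuous_on (cunion D) ?g" by (intro continuous_intros)
    show "?f ` ?S \<subseteq> cunion D" by (auto simp: us cunion_def csquare_def)
    show "?g ` cunion D \<subseteq> ?S" by (auto simp: us cunion_def csquare_def)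
  qed auto
  then show "?S homeomorphic cunion D" unfolding homeomorphic_def by blast
qed

definition cell_of :: "complex \<Rightarrow> cell" where
  "cell_of z = (\<lfloor>Re z\<rfloor>, \<lfloor>Im z\<rfloor>)"

definition center :: "cell \<Rightarrow> complex" where
  "center p = Complex (of_int (fst p) + 1/2) (of_int (snd p) + 1/2)"

lemma cell_of_center [simp]: "cell_of (center p) = p"
proof -
  have "\<lfloor>of_int i + 1/2 :: real\<rfloor> = i" for i by linarith
  then show ?thesis by (simp add: cell_of_def center_def)
qed

lemma in_csquare_cell_of: "z \<in> csquare (cell_of z)"
  by (auto simp: csquare_def cell_of_def)

lemma center_in_csquare: "center p \<in> csquare q \<Longrightarrow> p = q"
proof -
  assume "center p \<in> csquare q"
  then have "fst p = fst q" "snd p = snd q" unfolding center_def csquare_def by auto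
  then show ?thesis by (simp add: prod_eq_iff)
qed

lemma floor_close: "\<bar>a - b\<bar> < 1 \<Longrightarrow> \<bar>\<lfloor>a\<rfloor> - \<lfloor>b\<rfloor>\<bar> \<le> (1 :: int)" for a b :: real
  by linarith

text \<open>A finite union of closed convex sets is an ENR, hence locally path connected, and
  together with simple connectedness this makes the union Borsukian. The connectedness of its
  complement is carried over to cells by rounding coordinates down: nearby points lie in linked
  cells.\<close>

lemma simply_connected_imp_complement:
  assumes D: "finite D" and sc: "simply_connected (cunion D)"
  shows "edge_connected (- D)"
proof -
  have "ENR (\<Union> (csquare ` D))"
  proof (rule ENR_finite_Union_convex_closed)
    show "closed C" "convex C" if "C \<in> csquare ` D" for C
      using that by (auto simp: csquare_cbox)
  qed (use D in simp)
  then have "locally path_connected (cunion D)"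
    unfolding cunion_def by (rule ENR_imp_locally_path_connected)
  with sc have "Borsukian (cunion D)" by (rule simply_connected_imp_Borsukian)
  then have con: "connected (- cunion D)"
    using Borsukian_separation_compact compact_cunion[OF D] by blast
  have out: "cell_of z \<in> - D" if "z \<in> - cunion D" for z
    using that in_csquare_cell_of unfolding cunion_def by auto
  have opn: "open (- cunion D)" using compact_cunion[OF D] by (simp add: compact_imp_closed open_Compl)
  let ?R = "\<lambda>z w. linked (- D) (cell_of z) (cell_of w)"
  have R: "?R a b" if "a \<in> - cunion D" "b \<in> - cunion D" for a b
  proof (rule connected_equivalence_relation[OF con that])
    fix a assume a: "a \<in> - cunion D"
    then obtain e where e: "e > 0" "ball a e \<subseteq> - cunion D" using opn open_contains_ball by blast
    let ?T = "ball a (min e 1)"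
    have "?R a x" if x: "x \<in> ?T" for x
    proof -
      \<comment> \<open>The cells of \<open>a\<close> and \<open>x\<close> may be diagonal
        neighbours. The detour through \<open>?m\<close> changes one coordinate at a time, and
        \<open>?m\<close> is no farther from \<open>a\<close> than \<open>x\<close> is, so it also
        avoids the union.\<close>
      let ?m = "Complex (Re a) (Im x)"
      have d: "dist a x < min e 1" using x by simp
      have "dist a ?m \<le> dist a x"
        using abs_Im_le_cmod[of "a - x"] by (simp add: dist_norm cmod_def)
      then have m: "?m \<in> - cunion D" using e d by (simp add: subset_iff)
      have x': "x \<in> - cunion D" using e d by (simp add: subset_iff)
      have ab: "\<bar>Re a - Re x\<bar> < 1" "\<bar>Im a - Im x\<bar> < 1"
        using abs_Im_le_cmod[of "a - x"] abs_Re_le_cmod[of "a - x"] d by (auto simp: dist_norm)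
      have l1: "linked (- D) (cell_of a) (cell_of ?m)"
      proof (cases "cell_of a = cell_of ?m")
        case False
        have "share_edge (cell_of a) (cell_of ?m)"
          using False floor_close[OF ab(2)] unfolding cell_of_def share_edge_iff by auto
        then show ?thesis using out[OF a] out[OF m] by (rule linked_step[rotated 2])
      qed (simp add: linked_refl)
      have l2: "linked (- D) (cell_of ?m) (cell_of x)"
      proof (cases "cell_of ?m = cell_of x")
        case False
        have "share_edge (cell_of ?m) (cell_of x)"
          using False floor_close[OF ab(1)] unfolding cell_of_def share_edge_iff by auto
        then show ?thesis using out[OF m] out[OF x'] by (rule linked_step[rotated 2])
      qed (simp add: linked_refl)
      show ?thesis using linked_trans[OF l1 l2] .
    qed
    moreover have "?T \<subseteq> - cunion D" using e by auto
    then have "openin (top_of_set (- cunion D)) ?T" by (simp add: openin_open_eq opn)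
    moreover have "a \<in> ?T" using e by simp
    ultimately show "\<exists>T. openin (top_of_set (- cunion D)) T \<and> a \<in> T \<and> (\<forall>x\<in>T. ?R a x)" by blast
  qed (blast intro: linked_sym linked_trans)+
  show ?thesis unfolding edge_connected_linked
  proof (intro ballI)
    fix p q assume pq: "p \<in> - D" "q \<in> - D"
    have "center p \<in> - cunion D" "center q \<in> - cunion D"
      using pq center_in_csquare[of p] center_in_csquare[of q] unfolding cunion_def by blast+
    from R[OF this] show "linked (- D) p q" by simp
  qed
qed

text \<open>Used for the enlarged union and for its complement: both are connected along centers of
  linked cells, once each of their points sees the center of some cell.\<close>

lemma connected_by_links:
  assumes "edge_connected C"
    and sub: "\<And>p. p \<in> C \<Longrightarrow> center p \<in> S"
    and seg: "\<And>p q. p \<in> C \<Longrightarrow> q \<in> C \<Longrightarrow> share_edge p q \<Longrightarrow> closed_segment (center p) (center q) \<subseteq> S"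
    and cov: "\<And>z. z \<in> S \<Longrightarrow> \<exists>p\<in>C. closed_segment z (center p) \<subseteq> S"
  shows "connected S"
proof -
  have pc: "path_component S (center p) (center q)" if "linked C p q" "p \<in> C" for p q
    using that unfolding linked_def
  proof (induction rule: rtranclp_induct)
    case base
    then show ?case using sub by (simp add: path_component_refl)
  next
    case (step q r)
    have "path_component S (center q) (center r)"
      using seg[of q r] step.hyps(2)
      by (meson path_component_of_subset convex_closed_segment convex_imp_path_connected ends_in_segment path_connected_component)
    then show ?case using step path_component_trans by blast
  qed
  have "path_component S z w" if zw: "z \<in> S" "w \<in> S" for z w
  proof -
    obtain p q where p: "p \<in> C" "closed_segment z (center p) \<subseteq> S" and q: "q \<in> C" "closed_segment w (center q) \<subseteq> S"
      using cov[OF zw(1)] cov[OF zw(2)] by blast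
    have "path_component S z (center p)" "path_component S w (center q)"
      using p q by (meson path_component_of_subset convex_closed_segment convex_imp_path_connected ends_in_segment path_connected_component)+
    moreover have "path_component S (center p) (center q)"
      using pc p q assms(1) unfolding edge_connected_linked by blast
    ultimately show ?thesis using path_component_trans path_component_sym by blast
  qed
  then show ?thesis using path_connected_component path_connected_imp_connected by blast
qed

lemma convex_combination_bounds:
  assumes "z \<in> closed_segment a b"
  shows "min (Re a) (Re b) \<le> Re z" "Re z \<le> max (Re a) (Re b)"
    "min (Im a) (Im b) \<le> Im z" "Im z \<le> max (Im a) (Im b)"
proof -
  from assms obtain u where "z = (1 - u) *\<^sub>R a + u *\<^sub>R b" "0 \<le> u" "u \<le> 1"
    unfolding closed_segment_def by blast
  then have "Re z \<in> closed_segment (Re a) (Re b)" "Im z \<in> closed_segment (Im a) (Im b)"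
    unfolding closed_segment_def by auto
  then show "min (Re a) (Re b) \<le> Re z" "Re z \<le> max (Re a) (Re b)"
    "min (Im a) (Im b) \<le> Im z" "Im z \<le> max (Im a) (Im b)"
    by (auto simp: closed_segment_eq_real_ivl split: if_splits)
qed

lemma connected_ounion:
  assumes "edge_connected D" "0 < \<epsilon>"
  shows "connected (ounion \<epsilon> D)"
proof (rule connected_by_links[OF assms(1)])
  have conv: "convex (osquare \<epsilon> p)" for p by (cases p) (simp add: osquare_box)
  have c: "center p \<in> osquare \<epsilon> p" for p using assms(2) by (auto simp: center_def osquare_def)
  show "center p \<in> ounion \<epsilon> D" if "p \<in> D" for p using c that unfolding ounion_def by blast
  show "\<exists>p\<in>D. closed_segment z (center p) \<subseteq> ounion \<epsilon> D" if "z \<in> ounion \<epsilon> D" for z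
  proof -
    obtain p where p: "p \<in> D" "z \<in> osquare \<epsilon> p" using \<open>z \<in> ounion \<epsilon> D\<close> unfolding ounion_def by blast
    have "closed_segment z (center p) \<subseteq> osquare \<epsilon> p" using closed_segment_subset[OF p(2) c conv] .
    then show ?thesis using p(1) unfolding ounion_def by blast
  qed
  show "closed_segment (center p) (center q) \<subseteq> ounion \<epsilon> D"
    if pq: "p \<in> D" "q \<in> D" "share_edge p q" for p q
  proof -
    obtain x y x' y' where e: "p = (x, y)" "q = (x', y')" by force
    \<comment> \<open>The midpoint lies on the common edge, hence in both convex squares; the
      segment is cut there.\<close>
    let ?m = "midpoint (center p) (center q)"
    have "\<bar>x - x'\<bar> + \<bar>y - y'\<bar> = 1" using pq(3) e share_edge_iff by simp
    then have "x \<le> x' + 1" "x' \<le> x + 1" "y \<le> y' + 1" "y' \<le> y + 1" by linarith+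
    then have d: "real_of_int x \<le> x' + 1" "real_of_int x' \<le> x + 1" "real_of_int y \<le> y' + 1" "real_of_int y' \<le> y + 1"
      by linarith+
    have m: "Re ?m = (x + x' + 1) / 2" "Im ?m = (y + y' + 1) / 2"
      by (simp_all add: midpoint_def e center_def field_simps)
    have "?m \<in> osquare \<epsilon> p" "?m \<in> osquare \<epsilon> q"
      using d assms(2) unfolding osquare_def mem_Collect_eq m unfolding e by (auto simp: field_simps)
    then have "closed_segment (center p) ?m \<subseteq> osquare \<epsilon> p" "closed_segment ?m (center q) \<subseteq> osquare \<epsilon> q"
      using c conv by (meson closed_segment_subset)+
    moreover have "closed_segment (center p) ?m \<union> closed_segment ?m (center q) = closed_segment (center p) (center q)"
      by (rule Un_closed_segment) simp
    ultimately show ?thesis using pq unfolding ounion_def by blast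
  qed
qed

lemma connected_complement_ounion:
  assumes "edge_connected (- D)" "0 < \<epsilon>" "\<epsilon> \<le> 1/2"
  shows "connected (- ounion \<epsilon> D)"
proof (rule connected_by_links[OF assms(1)])
  \<comment> \<open>If \<open>z\<close> lies beyond one side of the enlarged square of
    \<open>q\<close>, then by integrality the whole cell \<open>c\<close> lies on that side of
    \<open>q\<close>. Its center keeps a distance of at least 1/2 from the line through that side of
    \<open>q\<close>, so for \<epsilon> \<le> 1/2 the way to the center stays outside.\<close>
  have sep: "w \<notin> osquare \<epsilon> q"
    if z: "z \<in> csquare c" "z \<notin> osquare \<epsilon> q" and w: "w \<in> closed_segment z (center c)" for z w c q
  proof -
    obtain cx cy qx qy where e: "c = (cx, cy)" "q = (qx, qy)" by force
    note b = convex_combination_bounds[OF w]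
    have zc: "cx \<le> Re z" "Re z \<le> cx + 1" "cy \<le> Im z" "Im z \<le> cy + 1"
      using z(1) by (auto simp: csquare_def e)
    consider "Re z \<le> qx - \<epsilon>" | "qx + 1 + \<epsilon> \<le> Re z" | "Im z \<le> qy - \<epsilon>" | "qy + 1 + \<epsilon> \<le> Im z"
      using z(2) by (auto simp: osquare_def e not_less)
    then show ?thesis
    proof cases
      case 1
      then have "real_of_int cx < qx" using zc assms by linarith
      then have "cx + 1 \<le> qx" by linarith
      then have "real_of_int cx + 1 \<le> qx" by linarith
      then have "Re w \<le> qx - \<epsilon>" using b(2) 1 assms(3) by (auto simp: center_def e)
      then show ?thesis by (auto simp: osquare_def e)
    next
      case 2
      then have "real_of_int qx < cx" using zc assms by linarith
      then have "qx + 1 \<le> cx" by linarith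
      then have "real_of_int qx + 1 \<le> cx" by linarith
      then have "qx + 1 + \<epsilon> \<le> Re w" using b(1) 2 assms(3) by (auto simp: center_def e)
      then show ?thesis by (auto simp: osquare_def e)
    next
      case 3
      then have "real_of_int cy < qy" using zc assms by linarith
      then have "cy + 1 \<le> qy" by linarith
      then have "real_of_int cy + 1 \<le> qy" by linarith
      then have "Im w \<le> qy - \<epsilon>" using b(4) 3 assms(3) by (auto simp: center_def e)
      then show ?thesis by (auto simp: osquare_def e)
    next
      case 4
      then have "real_of_int qy < cy" using zc assms by linarith
      then have "qy + 1 \<le> cy" by linarith
      then have "real_of_int qy + 1 \<le> cy" by linarith
      then have "qy + 1 + \<epsilon> \<le> Im w" using b(3) 4 assms(3) by (auto simp: center_def e)
      then show ?thesis by (auto simp: osquare_def e)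
    qed
  qed
  show seg: "closed_segment (center p) (center q) \<subseteq> - ounion \<epsilon> D"
    if pq: "p \<in> - D" "q \<in> - D" "share_edge p q" for p q
  proof
    fix z assume z: "z \<in> closed_segment (center p) (center q)"
    note b = convex_combination_bounds[OF z]
    obtain x y x' y' where e: "p = (x, y)" "q = (x', y')" by force
    have dist: "\<bar>x - x'\<bar> + \<bar>y - y'\<bar> = 1" using pq(3) e share_edge_iff by simp
    have "z \<notin> osquare \<epsilon> d" if "d \<in> D" for d
    proof -
      obtain a c where d: "d = (a, c)" by force
      have ne: "a \<noteq> x \<or> c \<noteq> y" "a \<noteq> x' \<or> c \<noteq> y'" using that pq e d by auto
      \<comment> \<open>Adjacent cells share a row or a column, so any third cell is separated from
        both in one and the same direction.\<close>
      have "(a + 1 \<le> x \<and> a + 1 \<le> x') \<or> (x + 1 \<le> a \<and> x' + 1 \<le> a) \<or>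
          (c + 1 \<le> y \<and> c + 1 \<le> y') \<or> (y + 1 \<le> c \<and> y' + 1 \<le> c)"
        using dist ne by presburger
      then consider "real_of_int a + 1 \<le> x" "real_of_int a + 1 \<le> x'" | "real_of_int x + 1 \<le> a" "real_of_int x' + 1 \<le> a"
        | "real_of_int c + 1 \<le> y" "real_of_int c + 1 \<le> y'" | "real_of_int y + 1 \<le> c" "real_of_int y' + 1 \<le> c"
        by linarith
      then show ?thesis
      proof cases
        case 1
        then have "a + 1 + \<epsilon> \<le> Re z" using b(1) assms(3) by (auto simp: center_def e)
        then show ?thesis by (auto simp: osquare_def d)
      next
        case 2
        then have "Re z \<le> a - \<epsilon>" using b(2) assms(3) by (auto simp: center_def e)
        then show ?thesis by (auto simp: osquare_def d)
      next
        case 3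
        then have "c + 1 + \<epsilon> \<le> Im z" using b(3) assms(3) by (auto simp: center_def e)
        then show ?thesis by (auto simp: osquare_def d)
      next
        case 4
        then have "Im z \<le> c - \<epsilon>" using b(4) assms(3) by (auto simp: center_def e)
        then show ?thesis by (auto simp: osquare_def d)
      qed
    qed
    then show "z \<in> - ounion \<epsilon> D" unfolding ounion_def by blast
  qed
  have cin: "center p \<notin> osquare \<epsilon> d" if "d \<noteq> p" for p d
  proof -
    obtain x y a c where e: "p = (x, y)" "d = (a, c)" by force
    have "a + 1 \<le> x \<or> x + 1 \<le> a \<or> c + 1 \<le> y \<or> y + 1 \<le> c" using that e by auto
    then have "real_of_int a + 1 \<le> x \<or> real_of_int x + 1 \<le> a \<or> real_of_int c + 1 \<le> y \<or> real_of_int y + 1 \<le> c"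
      by linarith
    then show ?thesis using assms(3) by (auto simp: e center_def osquare_def)
  qed
  show "center p \<in> - ounion \<epsilon> D" if "p \<in> - D" for p
  proof -
    have "center p \<notin> osquare \<epsilon> d" if "d \<in> D" for d
      by (rule cin) (use that \<open>p \<in> - D\<close> in auto)
    then show ?thesis unfolding ounion_def by blast
  qed
  show "\<exists>p\<in>- D. closed_segment z (center p) \<subseteq> - ounion \<epsilon> D" if z: "z \<in> - ounion \<epsilon> D" for z
  proof
    have "csquare d \<subseteq> osquare \<epsilon> d" for d using assms(2) by (auto simp: csquare_def osquare_def)
    then show "cell_of z \<in> - D" using z in_csquare_cell_of[of z] unfolding ounion_def by blast
    show "closed_segment z (center (cell_of z)) \<subseteq> - ounion \<epsilon> D"
      using sep[OF in_csquare_cell_of] z unfolding ounion_def by blast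
  qed
qed

lemma complement_imp_simply_connected:
  assumes D: "finite D" and con: "edge_connected D" "edge_connected (- D)"
  shows "simply_connected (cunion D)"
proof -
  have "ENR (\<Union> (csquare ` D))"
  proof (rule ENR_finite_Union_convex_closed)
    show "closed C" "convex C" if "C \<in> csquare ` D" for C
      using that by (auto simp: csquare_cbox)
  qed (use D in simp)
  then have "ENR (cunion D)" unfolding cunion_def .
  then obtain V where V: "open V" "cunion D retract_of V" unfolding ENR_def by blast
  then have sub: "cunion D \<subseteq> V" using retract_of_imp_subset by blast
  obtain e where e: "e > 0" "\<And>z. z \<in> cunion D \<Longrightarrow> ball z e \<subseteq> V"
  proof -
    obtain e where "e > 0" "(\<Union>z\<in>cunion D. ball z e) \<subseteq> V"
      by (rule compact_subset_open_imp_ball_epsilon_subset[OF compact_cunion[OF D] V(1) sub])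
    then show ?thesis by (intro that[of e]) (simp, meson UN_subset_iff)
  qed
  \<comment> \<open>At most 1/2 for the connectedness of the complement. At most e / 4 because a
    point of an enlarged square is off the square by at most \<epsilon> in each coordinate, hence
    closer than e to it.\<close>
  define \<epsilon> where "\<epsilon> = min (1/2) (e / 4)"
  have eps: "0 < \<epsilon>" "\<epsilon> \<le> 1/2" "\<epsilon> \<le> e / 4" using e by (auto simp: \<epsilon>_def)
  have oV: "ounion \<epsilon> D \<subseteq> V"
  proof
    fix z assume "z \<in> ounion \<epsilon> D"
    then obtain p where p: "p \<in> D" "z \<in> osquare \<epsilon> p" unfolding ounion_def by blast
    define c where "c = Complex (max (fst p) (min (Re z) (fst p + 1))) (max (snd p) (min (Im z) (snd p + 1)))"
    have "c \<in> csquare p" by (auto simp: c_def csquare_def)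
    then have c: "c \<in> cunion D" using p(1) unfolding cunion_def by blast
    have "cmod (c - z) \<le> \<bar>Re (c - z)\<bar> + \<bar>Im (c - z)\<bar>" by (rule cmod_le)
    moreover have "\<bar>Re (c - z)\<bar> \<le> \<epsilon>" "\<bar>Im (c - z)\<bar> \<le> \<epsilon>"
      using p(2) eps by (auto simp: c_def osquare_def max_def min_def)
    ultimately have "dist c z < e" using eps e(1) by (simp add: dist_norm)
    then show "z \<in> V" using e(2)[OF c] by auto
  qed
  have "csquare d \<subseteq> osquare \<epsilon> d" for d using eps by (auto simp: csquare_def osquare_def)
  then have co: "cunion D \<subseteq> ounion \<epsilon> D" unfolding cunion_def ounion_def by blast
  have op: "open (osquare \<epsilon> p) \<and> bounded (osquare \<epsilon> p)" for p
  proof (cases p)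
    case (Pair x y)
    show ?thesis unfolding Pair osquare_box using open_box bounded_box by blast
  qed
  have "open (ounion \<epsilon> D)" unfolding ounion_def using op by (intro open_UN) blast
  moreover have "bounded (ounion \<epsilon> D)" unfolding ounion_def using op D by (intro bounded_UN) auto
  ultimately have "open (ounion \<epsilon> D)" "bounded (ounion \<epsilon> D)" .
  from simply_connected_iff_simple[OF this] have "simply_connected (ounion \<epsilon> D)"
    using connected_ounion[OF con(1) eps(1)] connected_complement_ounion[OF con(2) eps(1,2)] by simp
  moreover have "cunion D retract_of ounion \<epsilon> D"
    by (rule retract_of_subset[OF V(2) co oV])
  ultimately show ?thesis by (rule retract_of_simply_connected)
qed

theorem polyomino_iff:
  "polyomino D \<longleftrightarrow> finite D \<and> D \<noteq> {} \<and> edge_connected D \<and> edge_connected (- D)"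
  unfolding polyomino_def simply_connected_cunion
  using simply_connected_imp_complement complement_imp_simply_connected by blast

section \<open>Tilings of rectangles, row by row\<close>

lemma segment_of_eq_Horizontal:
  "segment_of p s = Horizontal x y \<longleftrightarrow> (p = (x, y) \<and> s = South) \<or> (p = (x, y - 1) \<and> s = North)"
  by (cases p; cases s) auto

lemma segment_of_eq_Vertical:
  "segment_of p s = Vertical x y \<longleftrightarrow> (p = (x, y) \<and> s = West) \<or> (p = (x - 1, y) \<and> s = East)"
  by (cases p; cases s) auto

lemma Horizontal_in_boundary: "Horizontal x y \<in> boundary D \<longleftrightarrow> ((x, y) \<in> D) \<noteq> ((x, y - 1) \<in> D)"
proof -
  have "(\<exists>s. Horizontal x y = segment_of p s) \<longleftrightarrow> p = (x, y) \<or> p = (x, y - 1)" for p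
    using segment_of_eq_Horizontal[of p _ x y] by metis
  then have "Horizontal x y \<in> boundary D \<longleftrightarrow> (\<exists>!p. p \<in> D \<and> (p = (x, y) \<or> p = (x, y - 1)))"
    by (simp add: boundary_def)
  moreover have "(x, y) \<noteq> (x, y - 1)" by simp
  ultimately show ?thesis by blast
qed

lemma Vertical_in_boundary: "Vertical x y \<in> boundary D \<longleftrightarrow> ((x, y) \<in> D) \<noteq> ((x - 1, y) \<in> D)"
proof -
  have "(\<exists>s. Vertical x y = segment_of p s) \<longleftrightarrow> p = (x, y) \<or> p = (x - 1, y)" for p
    using segment_of_eq_Vertical[of p _ x y] by metis
  then have "Vertical x y \<in> boundary D \<longleftrightarrow> (\<exists>!p. p \<in> D \<and> (p = (x, y) \<or> p = (x - 1, y)))"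
    by (simp add: boundary_def)
  moreover have "(x, y) \<noteq> (x - 1, y)" by simp
  ultimately show ?thesis by blast
qed

definition adjacent_match :: "cell set \<Rightarrow> (cell \<Rightarrow> wang_tile) \<Rightarrow> bool" where
  "adjacent_match D f \<longleftrightarrow>
     (\<forall>x y. (x, y) \<in> D \<longrightarrow> (x, y + 1) \<in> D \<longrightarrow> north (f (x, y)) = south (f (x, y + 1))) \<and>
     (\<forall>x y. (x, y) \<in> D \<longrightarrow> (x + 1, y) \<in> D \<longrightarrow> east (f (x, y)) = west (f (x + 1, y)))"

text \<open>A segment lies on at most two cells, so equal segments come either from one side of one
  cell or from a vertical or horizontal pair of neighbours.\<close>

lemma adjacent_match_iff:
  "(\<forall>p\<in>D. \<forall>q\<in>D. \<forall>s t. segment_of p s = segment_of q t \<longrightarrow> side_color (f p) s = side_color (f q) t)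
   \<longleftrightarrow> adjacent_match D f" (is "?l \<longleftrightarrow> _")
proof
  assume l: ?l
  show "adjacent_match D f" unfolding adjacent_match_def
  proof (intro conjI allI impI)
    fix x y assume "(x, y) \<in> D" "(x, y + 1) \<in> D"
    with l show "north (f (x, y)) = south (f (x, y + 1))"
      by (metis segment_of.simps(1,2) side_color.simps(1,2))
  next
    fix x y assume "(x, y) \<in> D" "(x + 1, y) \<in> D"
    with l show "east (f (x, y)) = west (f (x + 1, y))"
      by (metis segment_of.simps(3,4) side_color.simps(3,4))
  qed
next
  assume m: "adjacent_match D f"
  show ?l
  proof (intro ballI allI impI)
    fix p q s t assume pq: "p \<in> D" "q \<in> D" "segment_of p s = segment_of q t"
    obtain x y where p: "p = (x, y)" by force
    obtain x' y' where q: "q = (x', y')" by force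
    note N = m[unfolded adjacent_match_def, THEN conjunct1, rule_format]
    note E = m[unfolded adjacent_match_def, THEN conjunct2, rule_format]
    show "side_color (f p) s = side_color (f q) t"
      using pq N[of x y] N[of x' y'] E[of x y] E[of x' y'] unfolding p q
      by (cases s; cases t) (auto simp: eq_diff_eq)
  qed
qed

text \<open>The transfer relation of a row: its arguments after \<open>W\<close> are the west color,
  the south colors, the north colors and the east color.\<close>

fun row :: "wang_tile set \<Rightarrow> nat \<Rightarrow> nat list \<Rightarrow> nat list \<Rightarrow> nat \<Rightarrow> bool" where
  "row W w [] [] e \<longleftrightarrow> w = e"
| "row W w (a # u) (b # v) e \<longleftrightarrow> (\<exists>c. Wang_Tile b a w c \<in> W \<and> row W c u v e)"
| "row W w _ _ e \<longleftrightarrow> False"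

lemma row_iff:
  "row W w u v e \<longleftrightarrow> length v = length u \<and> (\<exists>h. h 0 = w \<and> h (length u) = e \<and>
     (\<forall>i<length u. Wang_Tile (v ! i) (u ! i) (h i) (h (Suc i)) \<in> W))"
proof (induction W w u v e rule: row.induct)
  case (1 W w e)
  show ?case by auto
next
  case (2 W w a u b v e)
  show ?case (is "?l \<longleftrightarrow> ?r")
  proof
    assume ?l
    then obtain c h where "Wang_Tile b a w c \<in> W" "length v = length u" "h 0 = c" "h (length u) = e"
        "\<forall>i<length u. Wang_Tile (v ! i) (u ! i) (h i) (h (Suc i)) \<in> W"
      using 2 by auto
    then show ?r
      by (intro conjI exI[of _ "case_nat w h"]) (auto simp: nth_Cons split: nat.splits)
  next
    assume ?r
    then obtain h where h: "length v = length u" "h 0 = w" "h (Suc (length u)) = e"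
        "\<forall>i<Suc (length u). Wang_Tile ((b # v) ! i) ((a # u) ! i) (h i) (h (Suc i)) \<in> W"
      by auto
    have "Wang_Tile b a w (h 1) \<in> W" using h(2) h(4)[rule_format, of 0] by simp
    moreover have "row W (h 1) u v e" unfolding 2
      using h(1,3) h(4)[rule_format, of "Suc _"] by (intro conjI exI[of _ "\<lambda>i. h (Suc i)"]) auto
    ultimately show ?l by auto
  qed
qed auto

fun rows :: "wang_tile set \<Rightarrow> (nat \<times> nat) list \<Rightarrow> nat list \<Rightarrow> nat list \<Rightarrow> bool" where
  "rows W [] u v \<longleftrightarrow> u = v"
| "rows W (r # R) u v \<longleftrightarrow> (\<exists>u'. row W (fst r) u u' (snd r) \<and> rows W R u' v)"

lemma rows_append: "rows W (R @ R') u v \<longleftrightarrow> (\<exists>u'. rows W R u u' \<and> rows W R' u' v)"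
  by (induction R arbitrary: u) auto

lemma rows_iff:
  "rows W R u v \<longleftrightarrow> (\<exists>V. V 0 = u \<and> V (length R) = v \<and>
     (\<forall>j<length R. row W (fst (R ! j)) (V j) (V (Suc j)) (snd (R ! j))))"
proof (induction R arbitrary: u)
  case Nil
  show ?case by auto
next
  case (Cons r R)
  show ?case (is "?l \<longleftrightarrow> ?r")
  proof
    assume ?l
    then obtain V where "row W (fst r) u (V 0) (snd r)" "V (length R) = v"
        "\<forall>j<length R. row W (fst (R ! j)) (V j) (V (Suc j)) (snd (R ! j))"
      using Cons by auto
    then show ?r by (intro exI[of _ "case_nat u V"]) (auto simp: nth_Cons split: nat.splits)
  next
    assume ?r
    then obtain V where V: "V 0 = u" "V (Suc (length R)) = v"
        "\<forall>j<Suc (length R). row W (fst ((r # R) ! j)) (V j) (V (Suc j)) (snd ((r # R) ! j))"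
      by auto
    have "row W (fst r) u (V 1) (snd r)" using V(1) V(3)[rule_format, of 0] by simp
    moreover have "rows W R (V 1) v" unfolding Cons
      using V(2) V(3)[rule_format, of "Suc _"] by (intro exI[of _ "\<lambda>j. V (Suc j)"]) auto
    ultimately show ?l by auto
  qed
qed

definition rect :: "nat \<Rightarrow> nat \<Rightarrow> cell set" where
  "rect N H = {0..<int N} \<times> {0..<int H}"

lemma in_rect [simp]: "(x, y) \<in> rect N H \<longleftrightarrow> 0 \<le> x \<and> x < int N \<and> 0 \<le> y \<and> y < int H"
  by (auto simp: rect_def)

lemma rectE:
  assumes "p \<in> rect N H"
  obtains x y where "p = (int x, int y)" "x < N" "y < H"
proof (rule that[of "nat (fst p)" "nat (snd p)"])
  show "p = (int (nat (fst p)), int (nat (snd p)))" "nat (fst p) < N" "nat (snd p) < H"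
    using assms by (auto simp: rect_def)
qed

lemma boundary_rect:
  assumes "0 < N" "0 < H"
  shows "boundary (rect N H) = (\<lambda>x. Horizontal x 0) ` {0..<int N} \<union> (\<lambda>x. Horizontal x (int H)) ` {0..<int N}
     \<union> (\<lambda>y. Vertical 0 y) ` {0..<int H} \<union> (\<lambda>y. Vertical (int N) y) ` {0..<int H}"
proof (rule set_eqI)
  fix e show "e \<in> boundary (rect N H) \<longleftrightarrow> e \<in> (\<lambda>x. Horizontal x 0) ` {0..<int N} \<union> (\<lambda>x. Horizontal x (int H)) ` {0..<int N}
     \<union> (\<lambda>y. Vertical 0 y) ` {0..<int H} \<union> (\<lambda>y. Vertical (int N) y) ` {0..<int H}"
  proof (cases e)
    case (Horizontal x y)
    show ?thesis unfolding Horizontal Horizontal_in_boundary using assms by auto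
  next
    case (Vertical x y)
    show ?thesis unfolding Vertical Vertical_in_boundary using assms by auto
  qed
qed

lemma tiles_rect_iff:
  assumes pos: "0 < N" "R \<noteq> []"
    and hor: "\<And>x. x < N \<Longrightarrow> \<kappa> (Horizontal (int x) 0) = z" "\<And>x. x < N \<Longrightarrow> \<kappa> (Horizontal (int x) (int (length R))) = z"
    and vert: "\<And>y. y < length R \<Longrightarrow> \<kappa> (Vertical 0 (int y)) = fst (R ! y)"
      "\<And>y. y < length R \<Longrightarrow> \<kappa> (Vertical (int N) (int y)) = snd (R ! y)"
  shows "tiles_region W (rect N (length R)) \<kappa> \<longleftrightarrow> rows W R (replicate N z) (replicate N z)"
proof
  let ?H = "length R"
  let ?D = "rect N ?H"
  have bd: "boundary ?D = (\<lambda>x. Horizontal x 0) ` {0..<int N} \<union> (\<lambda>x. Horizontal x (int ?H)) ` {0..<int N}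
     \<union> (\<lambda>y. Vertical 0 y) ` {0..<int ?H} \<union> (\<lambda>y. Vertical (int N) y) ` {0..<int ?H}"
    using boundary_rect pos by simp
  assume "tiles_region W ?D \<kappa>"
  then obtain f where W: "\<And>p. p \<in> ?D \<Longrightarrow> f p \<in> W" and m: "adjacent_match ?D f"
    and b: "\<And>p s. p \<in> ?D \<Longrightarrow> segment_of p s \<in> boundary ?D \<Longrightarrow> side_color (f p) s = \<kappa> (segment_of p s)"
    unfolding tiles_region_def adjacent_match_iff by blast
  \<comment> \<open>\<open>vs j\<close> collects the colors on the horizontal grid line at height
    \<open>j\<close>, and \<open>hs y\<close> those on the vertical lines along row
    \<open>y\<close>. Only the first line has to be read from the south or west side of a
    tile.\<close>
  define vs where "vs j x = (if j = 0 then south (f (int x, 0)) else north (f (int x, int (j - 1))))" for j x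
  define hs where "hs y i = (if i = 0 then west (f (0, int y)) else east (f (int (i - 1), int y)))" for y i
  have tile: "Wang_Tile (vs (Suc y) x) (vs y x) (hs y x) (hs y (Suc x)) \<in> W" if xy: "x < N" "y < ?H" for x y
  proof -
    have "vs y x = south (f (int x, int y))"
    proof (cases y)
      case (Suc y')
      have "north (f (int x, int y')) = south (f (int x, int y' + 1))"
        using m xy Suc unfolding adjacent_match_def by auto
      then show ?thesis using Suc by (simp add: vs_def add.commute)
    qed (simp add: vs_def)
    moreover have "hs y x = west (f (int x, int y))"
    proof (cases x)
      case (Suc x')
      have "east (f (int x', int y)) = west (f (int x' + 1, int y))"
        using m xy Suc unfolding adjacent_match_def by auto
      then show ?thesis using Suc by (simp add: hs_def add.commute)
    qed (simp add: hs_def)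
    moreover have "vs (Suc y) x = north (f (int x, int y))" "hs y (Suc x) = east (f (int x, int y))"
      by (simp_all add: vs_def hs_def)
    moreover have "f (int x, int y) \<in> W" using W xy by simp
    ultimately show ?thesis by simp
  qed
  have bottom: "vs 0 x = z" if "x < N" for x
    using b[of "(int x, 0)" South] that hor(1) pos by (simp add: vs_def bd)
  have top: "vs ?H x = z" if "x < N" for x
    using b[of "(int x, int (?H - 1))" North] that hor(2) pos by (simp add: vs_def bd of_nat_diff Suc_le_eq)
  have left: "hs y 0 = fst (R ! y)" if "y < ?H" for y
    using b[of "(0, int y)" West] that vert(1) pos by (simp add: hs_def bd)
  have right: "hs y N = snd (R ! y)" if "y < ?H" for y
    using b[of "(int (N - 1), int y)" East] that vert(2) pos by (simp add: hs_def bd of_nat_diff Suc_le_eq)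
  show "rows W R (replicate N z) (replicate N z)"
    unfolding rows_iff
  proof (intro exI[of _ "\<lambda>j. map (vs j) [0..<N]"] conjI allI impI)
    show "map (vs 0) [0..<N] = replicate N z" using bottom by (intro nth_equalityI) auto
    show "map (vs ?H) [0..<N] = replicate N z" using top by (intro nth_equalityI) auto
    show "row W (fst (R ! j)) (map (vs j) [0..<N]) (map (vs (Suc j)) [0..<N]) (snd (R ! j))" if "j < ?H" for j
      unfolding row_iff
      by (intro conjI exI[of _ "hs j"]) (use that tile left right in auto)
  qed
next
  let ?H = "length R"
  let ?D = "rect N ?H"
  have bd: "boundary ?D = (\<lambda>x. Horizontal x 0) ` {0..<int N} \<union> (\<lambda>x. Horizontal x (int ?H)) ` {0..<int N}
     \<union> (\<lambda>y. Vertical 0 y) ` {0..<int ?H} \<union> (\<lambda>y. Vertical (int N) y) ` {0..<int ?H}"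
    using boundary_rect pos by simp
  assume "rows W R (replicate N z) (replicate N z)"
  then obtain V where V: "V 0 = replicate N z" "V ?H = replicate N z"
      "\<And>j. j < ?H \<Longrightarrow> row W (fst (R ! j)) (V j) (V (Suc j)) (snd (R ! j))"
    unfolding rows_iff by blast
  have len: "length (V j) = N" if "j \<le> ?H" for j
    using that
  proof (induction j)
    case (Suc j)
    then show ?case using V(3)[of j] by (simp add: row_iff)
  qed (simp add: V)
  have "\<forall>j. \<exists>h. j < ?H \<longrightarrow> h 0 = fst (R ! j) \<and> h N = snd (R ! j) \<and>
      (\<forall>i<N. Wang_Tile (V (Suc j) ! i) (V j ! i) (h i) (h (Suc i)) \<in> W)"
  proof
    fix j show "\<exists>h. j < ?H \<longrightarrow> h 0 = fst (R ! j) \<and> h N = snd (R ! j) \<and>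
      (\<forall>i<N. Wang_Tile (V (Suc j) ! i) (V j ! i) (h i) (h (Suc i)) \<in> W)"
      using V(3)[of j] len[of j] unfolding row_iff by fastforce
  qed
  then obtain h where h: "\<And>j. j < ?H \<Longrightarrow> h j 0 = fst (R ! j) \<and> h j N = snd (R ! j) \<and>
      (\<forall>i<N. Wang_Tile (V (Suc j) ! i) (V j ! i) (h j i) (h j (Suc i)) \<in> W)"
    by metis
  define f where "f p = Wang_Tile (V (Suc (nat (snd p))) ! nat (fst p)) (V (nat (snd p)) ! nat (fst p))
     (h (nat (snd p)) (nat (fst p))) (h (nat (snd p)) (Suc (nat (fst p))))" for p :: cell
  show "tiles_region W ?D \<kappa>"
    unfolding tiles_region_def adjacent_match_iff
  proof (intro exI[of _ f] conjI ballI allI impI)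
    fix p assume "p \<in> ?D"
    then obtain x y where p: "p = (int x, int y)" "x < N" "y < ?H" by (rule rectE)
    show "f p \<in> W" using h p by (simp add: f_def)
    fix s assume "segment_of p s \<in> boundary ?D"
    then show "side_color (f p) s = \<kappa> (segment_of p s)"
    proof (cases s)
      case North
      then have y: "Suc y = ?H" using \<open>segment_of p s \<in> boundary ?D\<close> p by (auto simp: bd)
      then have "\<kappa> (Horizontal (int x) (int y + 1)) = z" using hor(2)[OF p(2)] by (simp add: add.commute flip: y)
      then show ?thesis using North p V(2) y by (simp add: f_def)
    next
      case South
      then have y: "y = 0" using \<open>segment_of p s \<in> boundary ?D\<close> p by (auto simp: bd)
      then show ?thesis using South p V(1) hor(1)[OF p(2)] by (simp add: f_def)
    next
      case West
      then have x: "x = 0" using \<open>segment_of p s \<in> boundary ?D\<close> p by (auto simp: bd)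
      then show ?thesis using West p vert(1)[OF p(3)] h[OF p(3)] by (simp add: f_def)
    next
      case East
      then have x: "Suc x = N" using \<open>segment_of p s \<in> boundary ?D\<close> p by (auto simp: bd)
      then have "\<kappa> (Vertical (int x + 1) (int y)) = snd (R ! y)" using vert(2)[OF p(3)] by (simp add: add.commute flip: x)
      then show ?thesis using East p h[OF p(3)] x by (simp add: f_def)
    qed
  next
    show "adjacent_match ?D f" unfolding adjacent_match_def
      by (auto simp: f_def nat_add_distrib)
  qed
qed

section \<open>The tile set\<close>

text \<open>A vertical edge signal carries a bit \<open>b\<close> and a mark \<open>m\<close> as the color \<open>2 * b + m\<close>; the signals
  travel northwards. The color on the west end of a row selects what the row does:
  4 and 5 shift the marks by one column to the east, feeding in the mark 0 or 1;
  6 (with 7 on the east end) checks that exactly one column has both bit and mark, and clears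
  the marks; 8 chooses the bits freely, or forgets them. The last five tiles are never used.\<close>

definition tile_list :: "wang_tile list" where
  "tile_list =
    [Wang_Tile 0 0 4 4, Wang_Tile 1 0 5 4, Wang_Tile 0 1 4 5, Wang_Tile 1 1 5 5,
     Wang_Tile 2 2 4 4, Wang_Tile 3 2 5 4, Wang_Tile 2 3 4 5, Wang_Tile 3 3 5 5,
     Wang_Tile 0 0 6 6, Wang_Tile 0 1 6 6, Wang_Tile 2 2 6 6,
     Wang_Tile 0 0 7 7, Wang_Tile 0 1 7 7, Wang_Tile 2 2 7 7, Wang_Tile 2 3 6 7,
     Wang_Tile 0 0 8 8, Wang_Tile 2 0 8 8, Wang_Tile 0 2 8 8,
     Wang_Tile 9 9 9 9, Wang_Tile 10 10 10 10, Wang_Tile 11 11 11 11,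
     Wang_Tile 12 12 12 12, Wang_Tile 13 13 13 13]"

definition tile_set :: "wang_tile set" where
  "tile_set = set tile_list"

lemma card_tile_set: "card tile_set = 23"
proof -
  have "distinct tile_list" by (simp add: tile_list_def)
  then have "card tile_set = length tile_list" unfolding tile_set_def by (rule distinct_card)
  then show ?thesis by (simp add: tile_list_def)
qed

definition col :: "bool \<Rightarrow> bool \<Rightarrow> nat" where
  "col b m = 2 * of_bool b + of_bool m"

text \<open>The mark arriving from the west stays in the column, the old mark of the column moves
  on, and the bit passes unchanged.\<close>

lemma shift_tile:
  "Wang_Tile n (col b m) (4 + of_bool h) e \<in> tile_set \<longleftrightarrow> n = col b h \<and> e = 4 + of_bool m"
  by (cases b; cases m; cases h) (auto simp: tile_set_def tile_list_def col_def)

text \<open>The horizontal color 7 means that one hit has been counted. There is no tile for a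
  second hit, which caps the count at one.\<close>

lemma check_tile_7:
  "Wang_Tile n (col b m) 7 e \<in> tile_set \<longleftrightarrow> \<not> (b \<and> m) \<and> n = col b False \<and> e = 7"
  by (cases b; cases m) (auto simp: tile_set_def tile_list_def col_def)

lemma check_tile_6:
  "Wang_Tile n (col b m) 6 e \<in> tile_set \<longleftrightarrow> n = col b False \<and> e = (if b \<and> m then 7 else 6)"
  by (cases b; cases m) (auto simp: tile_set_def tile_list_def col_def)

lemma free_tile: "Wang_Tile n 0 8 e \<in> tile_set \<longleftrightarrow> (\<exists>b. n = col b False) \<and> e = 8"
  by (auto simp: tile_set_def tile_list_def col_def intro: exI[of _ False] exI[of _ True])

lemma forget_tile: "Wang_Tile 0 (col b False) 8 e \<in> tile_set \<longleftrightarrow> e = 8"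
  by (cases b) (auto simp: tile_set_def tile_list_def col_def)

lemma row_Cons: "row W w (a # u) v e \<longleftrightarrow> (\<exists>c b v'. v = b # v' \<and> Wang_Tile b a w c \<in> W \<and> row W c u v' e)"
  by (cases v) auto

lemma row_Nil: "row W w [] v e \<longleftrightarrow> v = [] \<and> w = e"
  by (cases v) auto

lemma shift_row:
  "length bs = length ms \<Longrightarrow> row tile_set (4 + of_bool h) (map2 col bs ms) v (4 + of_bool k) \<longleftrightarrow>
     v = map2 col bs (butlast (h # ms)) \<and> last (h # ms) = k"
proof (induction bs ms arbitrary: h v rule: list_induct2)
  case Nil
  show ?case by (auto simp: row_Nil)
next
  case (Cons b bs m ms)
  have "row tile_set (4 + of_bool h) (map2 col (b # bs) (m # ms)) v (4 + of_bool k) \<longleftrightarrow>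
      (\<exists>v'. v = col b h # v' \<and> row tile_set (4 + of_bool m) (map2 col bs ms) v' (4 + of_bool k))"
    by (auto simp: row_Cons shift_tile)
  also have "\<dots> \<longleftrightarrow> v = col b h # map2 col bs (butlast (m # ms)) \<and> last (m # ms) = k"
    unfolding Cons.IH by blast
  finally show ?case by simp
qed

text \<open>Generalised to the marks \<open>es'\<close> already fed in. The first mark fed travels
  farthest east, hence the reversal. The east color 4 demands that a 0 falls out at the end, and
  indeed only the initial zeros get there.\<close>

lemma shift_rows:
  "length bs = length es' + length es \<Longrightarrow>
   rows tile_set (map (\<lambda>h. (4 + of_bool h, 4)) es) (map2 col bs (rev es' @ replicate (length es) False)) v \<longleftrightarrow>
   v = map2 col bs (rev (es' @ es))"
proof (induction es arbitrary: es')
  case Nil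
  show ?case by auto
next
  case (Cons h es)
  have b: "butlast (h # rev es' @ replicate (length (h # es)) False) = rev (es' @ [h]) @ replicate (length es) False"
    by (simp add: butlast_append replicate_append_same[symmetric] del: replicate_append_same)
  have "last (h # rev es' @ replicate (length (h # es)) False) = False" by simp
  with shift_row[of bs "rev es' @ replicate (length (h # es)) False" h _ False] Cons.prems
  have "row tile_set (4 + of_bool h) (map2 col bs (rev es' @ replicate (length (h # es)) False)) u 4 \<longleftrightarrow>
      u = map2 col bs (rev (es' @ [h]) @ replicate (length es) False)" for u
    unfolding b by simp
  moreover have "rows tile_set (map (\<lambda>h. (4 + of_bool h, 4)) es)
      (map2 col bs (rev (es' @ [h]) @ replicate (length es) False)) v \<longleftrightarrow> v = map2 col bs (rev ((es' @ [h]) @ es))"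
    by (rule Cons.IH) (use Cons.prems in simp)
  ultimately show ?case by simp
qed

definition hits :: "bool list \<Rightarrow> bool list \<Rightarrow> nat" where
  "hits bs ms = length (filter id (map2 (\<and>) bs ms))"

lemma hits_simps [simp]: "hits [] ms = 0"
  "hits (b # bs) (m # ms) = (if b \<and> m then Suc (hits bs ms) else hits bs ms)"
  by (simp_all add: hits_def)

lemma check_row_7:
  "length bs = length ms \<Longrightarrow> row tile_set 7 (map2 col bs ms) v 7 \<longleftrightarrow>
     v = map2 col bs (replicate (length bs) False) \<and> hits bs ms = 0"
proof (induction bs ms arbitrary: v rule: list_induct2)
  case Nil
  show ?case by (auto simp: row_Nil)
next
  case (Cons b bs m ms)
  then show ?case by (auto simp: row_Cons check_tile_7)
qed

lemma check_row:
  "length bs = length ms \<Longrightarrow> row tile_set 6 (map2 col bs ms) v 7 \<longleftrightarrow>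
     v = map2 col bs (replicate (length bs) False) \<and> hits bs ms = 1"
proof (induction bs ms arbitrary: v rule: list_induct2)
  case Nil
  show ?case by (auto simp: row_Nil)
next
  case (Cons b bs m ms)
  then show ?case
    using check_row_7[of bs ms] by (cases "b \<and> m") (auto simp: row_Cons check_tile_6)
qed

lemma free_row:
  "row tile_set 8 (replicate N 0) v 8 \<longleftrightarrow> (\<exists>bs. length bs = N \<and> v = map2 col bs (replicate N False))"
proof (induction N arbitrary: v)
  case 0
  show ?case by (auto simp: row_Nil)
next
  case (Suc N)
  have "row tile_set 8 (replicate (Suc N) 0) v 8 \<longleftrightarrow>
      (\<exists>b v'. v = col b False # v' \<and> row tile_set 8 (replicate N 0) v' 8)"
    by (auto simp: row_Cons free_tile)
  also have "\<dots> \<longleftrightarrow> (\<exists>b bs. length bs = N \<and> v = map2 col (b # bs) (replicate (Suc N) False))"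
    unfolding Suc by auto
  also have "\<dots> \<longleftrightarrow> (\<exists>bs. length bs = Suc N \<and> v = map2 col bs (replicate (Suc N) False))"
    by (metis length_Suc_conv)
  finally show ?case .
qed

lemma forget_row:
  "row tile_set 8 (map2 col bs (replicate (length bs) False)) (replicate (length bs) 0) 8"
  by (induction bs) (auto simp: forget_tile)

text \<open>The first row chooses the bits and the last row forgets them, so that the south and
  north sides of the rectangle can both carry the constant color 0.\<close>

definition program :: "bool list list \<Rightarrow> (nat \<times> nat) list" where
  "program ps = [(8, 8)] @ concat (map (\<lambda>p. map (\<lambda>h. (4 + of_bool h, 4)) p @ [(6, 7)]) ps) @ [(8, 8)]"

text \<open>A check row clears all marks and keeps the bits, so each pattern starts from the same
  colors and the requirements add up to a conjunction.\<close>

lemma rows_patterns: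
  assumes "\<forall>p\<in>set ps. length p = length bs"
  shows "rows tile_set (concat (map (\<lambda>p. map (\<lambda>h. (4 + of_bool h, 4)) p @ [(6, 7)]) ps))
     (map2 col bs (replicate (length bs) False)) v \<longleftrightarrow>
     v = map2 col bs (replicate (length bs) False) \<and> (\<forall>p\<in>set ps. hits bs (rev p) = 1)"
  using assms
proof (induction ps)
  case Nil
  show ?case by auto
next
  case (Cons p ps)
  let ?u = "map2 col bs (replicate (length bs) False)"
  have "rows tile_set (map (\<lambda>h. (4 + of_bool h, 4)) p @ [(6, 7)]) ?u u \<longleftrightarrow> u = ?u \<and> hits bs (rev p) = 1" for u
    using shift_rows[of bs "[]" p] check_row[of bs "rev p"] Cons.prems by (simp add: rows_append)
  moreover have "concat (map f (p # ps)) = f p @ concat (map f ps)" for f :: "bool list \<Rightarrow> (nat \<times> nat) list"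
    by simp
  ultimately show ?case using Cons by (simp only: rows_append) auto
qed

lemma rows_program:
  assumes "\<forall>p\<in>set ps. length p = N"
  shows "rows tile_set (program ps) (replicate N 0) (replicate N 0) \<longleftrightarrow>
     (\<exists>bs. length bs = N \<and> (\<forall>p\<in>set ps. hits bs (rev p) = 1))"
proof -
  have "rows tile_set (program ps) (replicate N 0) (replicate N 0) \<longleftrightarrow>
     (\<exists>v u. row tile_set 8 (replicate N 0) v 8 \<and> rows tile_set (concat (map (\<lambda>p. map (\<lambda>h. (4 + of_bool h, 4)) p @ [(6, 7)]) ps))
        v u \<and> row tile_set 8 u (replicate N 0) 8)"
    by (auto simp: program_def rows_append)
  also have "\<dots> \<longleftrightarrow>
     (\<exists>bs u. length bs = N \<and> rows tile_set (concat (map (\<lambda>p. map (\<lambda>h. (4 + of_bool h, 4)) p @ [(6, 7)]) ps))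
        (map2 col bs (replicate N False)) u \<and> row tile_set 8 u (replicate N 0) 8)"
    unfolding free_row by blast
  also have "\<dots> \<longleftrightarrow> (\<exists>bs. length bs = N \<and> (\<forall>p\<in>set ps. hits bs (rev p) = 1))"
    using rows_patterns[of ps] forget_row assms by metis
  finally show ?thesis .
qed

section \<open>Instances from patterns\<close>

definition rect_instance :: "nat \<Rightarrow> (nat \<times> nat) list \<Rightarrow> instance_data" where
  "rect_instance N R =
    (concat (map (\<lambda>y. map (\<lambda>x. (int x, int y)) [0..<N]) [0..<length R]),
     concat (map (\<lambda>x. [(Horizontal (int x) 0, 0), (Horizontal (int x) (int (length R)), 0)]) [0..<N]) @
     concat (map (\<lambda>p. [(Vertical 0 (int (fst p)), fst (snd p)), (Vertical (int N) (int (fst p)), snd (snd p))])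
       (List.enumerate 0 R)))"

lemma distinct_concat_map:
  assumes "distinct xs" "\<And>x. x \<in> set xs \<Longrightarrow> distinct (f x)"
    and "\<And>x y. x \<in> set xs \<Longrightarrow> y \<in> set xs \<Longrightarrow> x \<noteq> y \<Longrightarrow> set (f x) \<inter> set (f y) = {}"
  shows "distinct (concat (map f xs))"
  using assms
proof (induction xs)
  case (Cons x xs)
  then have "set (f x) \<inter> set (concat (map f xs)) = {}" by fastforce
  with Cons show ?case by simp
qed simp

text \<open>The squares fill a box, so simple connectedness follows from convexity.\<close>

lemma polyomino_rect:
  assumes "0 < N" "0 < H" shows "polyomino (rect N H)"
proof -
  have "(\<Union>p\<in>rect N H. unit_square p) = cbox (0, 0) (real N, real H)"
  proof (rule set_eqI)
    fix z :: "real \<times> real"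
    obtain a b where z: "z = (a, b)" by force
    show "z \<in> (\<Union>p\<in>rect N H. unit_square p) \<longleftrightarrow> z \<in> cbox (0, 0) (real N, real H)"
    proof
      assume "z \<in> (\<Union>p\<in>rect N H. unit_square p)"
      then obtain x y where "(x, y) \<in> rect N H" "z \<in> unit_square (x, y)" by auto
      then have "0 \<le> x" "x + 1 \<le> int N" "0 \<le> y" "y + 1 \<le> int H" "x \<le> a" "a \<le> x + 1" "y \<le> b" "b \<le> y + 1"
        by (auto simp: z cbox_Pair_eq)
      then have "0 \<le> a" "a \<le> N" "0 \<le> b" "b \<le> H" by linarith+
      then show "z \<in> cbox (0, 0) (real N, real H)" by (simp add: z cbox_Pair_eq)
    next
      assume "z \<in> cbox (0, 0) (real N, real H)"
      then have ab: "0 \<le> a" "a \<le> N" "0 \<le> b" "b \<le> H" by (auto simp: z cbox_Pair_eq)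
      define x where "x = min \<lfloor>a\<rfloor> (int N - 1)"
      define y where "y = min \<lfloor>b\<rfloor> (int H - 1)"
      have "0 \<le> x" "x < int N" "x \<le> a" "a \<le> x + 1" "0 \<le> y" "y < int H" "y \<le> b" "b \<le> y + 1"
        using ab assms unfolding x_def y_def by linarith+
      then have "(x, y) \<in> rect N H" "z \<in> unit_square (x, y)" by (auto simp: z cbox_Pair_eq)
      then show "z \<in> (\<Union>p\<in>rect N H. unit_square p)" by blast
    qed
  qed
  then have "simply_connected (\<Union>p\<in>rect N H. unit_square p)"
    by (simp add: convex_imp_simply_connected)
  moreover have "finite (rect N H)" "rect N H \<noteq> {}" using assms by (auto simp: rect_def)
  moreover have "edge_connected (rect N H)"
  proof -
    have h: "linked (rect N H) (0, int y) (int x, int y)" if "x < N" "y < H" for x y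
      using that
    proof (induction x)
      case (Suc x)
      have "linked (rect N H) (int x, int y) (int (Suc x), int y)"
        by (rule linked_step) (use Suc.prems in \<open>auto simp: share_edge_iff\<close>)
      then show ?case using Suc linked_trans by auto
    qed (simp add: linked_refl)
    have v: "linked (rect N H) (0, 0) (0, int y)" if "y < H" for y
      using that
    proof (induction y)
      case (Suc y)
      have "linked (rect N H) (0, int y) (0, int (Suc y))"
        by (rule linked_step) (use Suc.prems assms in \<open>auto simp: share_edge_iff\<close>)
      then show ?case using Suc linked_trans by auto
    qed (simp add: linked_refl)
    have o: "linked (rect N H) (0, 0) p" if "p \<in> rect N H" for p
    proof -
      from \<open>p \<in> rect N H\<close> obtain x y where "p = (int x, int y)" "x < N" "y < H" by (rule rectE)
      then show ?thesis using h[of x y] v[of y] linked_trans by blast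
    qed
    show ?thesis unfolding edge_connected_linked using o linked_sym linked_trans by blast
  qed
  ultimately show ?thesis unfolding polyomino_def by blast
qed

lemma encode_instance_in_tiling_problem:
  "encode_instance I \<in> tiling_problem W \<longleftrightarrow> valid_instance I \<and> tileable W I"
  unfolding tiling_problem_def using inj_encode_instance by (blast dest: injD)

lemma rect_instance_correct:
  assumes "0 < N" "R \<noteq> []"
  shows "encode_instance (rect_instance N R) \<in> tiling_problem W \<longleftrightarrow> rows W R (replicate N 0) (replicate N 0)"
proof -
  let ?cs = "fst (rect_instance N R)" and ?bs = "snd (rect_instance N R)" and ?H = "length R"
  have im: "{0..<int n} = int ` {0..<n}" for n by (simp add: image_int_atLeastLessThan)
  have cs: "set ?cs = rect N ?H"
    by (auto simp: rect_instance_def rect_def im)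
  have dcs: "distinct ?cs"
    unfolding rect_instance_def fst_conv
    by (intro distinct_concat_map) (auto simp: distinct_map inj_on_def)
  have keys: "map fst ?bs = concat (map (\<lambda>x. [Horizontal (int x) 0, Horizontal (int x) (int ?H)]) [0..<N]) @
     concat (map (\<lambda>y. [Vertical 0 (int y), Vertical (int N) (int y)]) [0..<?H])"
  proof -
    have "map (\<lambda>p. [Vertical 0 (int (fst p)), Vertical (int N) (int (fst p))]) (List.enumerate 0 R)
      = map (\<lambda>y. [Vertical 0 (int y), Vertical (int N) (int y)]) (map fst (List.enumerate 0 R))"
      by (simp del: map_fst_enumerate)
    then show ?thesis by (simp add: rect_instance_def map_concat comp_def)
  qed
  have dbs: "distinct (map fst ?bs)"
    unfolding keys distinct_append
    by (intro conjI distinct_concat_map) (use assms in auto)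
  have bd: "fst ` set ?bs = boundary (rect N ?H)"
  proof -
    have "fst ` set ?bs = set (map fst ?bs)" by simp
    also have "\<dots> = boundary (rect N ?H)" unfolding keys
      using assms by (subst boundary_rect) (auto simp: im)
    finally show ?thesis .
  qed
  have valid: "valid_instance (rect_instance N R)"
    using dcs dbs cs bd polyomino_rect[of N ?H] assms by (cases "rect_instance N R") auto
  have mo: "the (map_of ?bs e) = k" if "(e, k) \<in> set ?bs" for e k
    using dbs that by simp
  have "tileable W (rect_instance N R) \<longleftrightarrow> tiles_region W (rect N ?H) (\<lambda>e. the (map_of ?bs e))"
    using cs by (cases "rect_instance N R") auto
  also have "\<dots> \<longleftrightarrow> rows W R (replicate N 0) (replicate N 0)"
  proof (rule tiles_rect_iff[OF assms])
    show "the (map_of ?bs (Horizontal (int x) 0)) = 0" "the (map_of ?bs (Horizontal (int x) (int ?H))) = 0"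
      if "x < N" for x
      by (rule mo; use that in \<open>auto simp: rect_instance_def\<close>)+
    have en: "(y, R ! y) \<in> set (List.enumerate 0 R)" if "y < ?H" for y
      using that by (auto simp: in_set_enumerate_eq)
    show "the (map_of ?bs (Vertical 0 (int y))) = fst (R ! y)" "the (map_of ?bs (Vertical (int N) (int y))) = snd (R ! y)"
      if "y < ?H" for y
      by (rule mo; use en[OF that] in \<open>force simp: rect_instance_def\<close>)+
  qed
  finally show ?thesis
    using valid by (simp add: encode_instance_in_tiling_problem)
qed

section \<open>Tree certificates\<close>

text \<open>Preorder notation read from right to left needs only a stack: a leaf is pushed, and a
  node joins the two topmost trees. Where the stack is too short it is left alone, so every bit
  string can be parsed.\<close>

definition shift_reduce :: "bool \<Rightarrow> data list \<Rightarrow> data list" where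
  "shift_reduce b stack = (if b then (case stack of [] \<Rightarrow> stack | x # r \<Rightarrow>
     (case r of [] \<Rightarrow> stack | y # r' \<Rightarrow> Node x y # r')) else Leaf # stack)"

definition parse :: "bool list \<Rightarrow> data" where
  "parse bs = (case foldr shift_reduce bs [] of [] \<Rightarrow> Leaf | d # _ \<Rightarrow> d)"

definition tokens :: "data \<Rightarrow> bool list" where
  "tokens d = map (\<lambda>s. s = 2) (ser d)"

lemma tokens_simps [simp]: "tokens Leaf = [False]" "tokens (Node a b) = True # tokens a @ tokens b"
  by (simp_all add: tokens_def)

lemma foldr_shift_reduce: "foldr shift_reduce (tokens d) stack = d # stack"
  by (induction d arbitrary: stack) (auto simp: shift_reduce_def)

text \<open>Whatever follows the tree is read earlier and ends up below it on the stack.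
  Certificates may therefore be padded to a fixed length.\<close>

lemma parse_tokens: "parse (tokens d @ bs) = d"
  by (simp add: parse_def foldr_shift_reduce)

lemma fp_Node [fp_intros]: "fp f \<Longrightarrow> fp g \<Longrightarrow> fp (\<lambda>x. Node (f x) (g x))"
  by (rule fp_retype[OF fp_Pair[of f g]]) auto

lemma fp_parse [fp_intros]:
  assumes "fp l" shows "fp (\<lambda>x. parse (l x))"
proof -
  obtain k where k: "\<And>x. sz (enc (l x)) \<le> (sz (enc x) + 2) ^ k" using assms by (rule fp_size) blast
  have s: "sz (enc (fold shift_reduce bs stack)) \<le> 2 * length bs + sz (enc stack)" for bs stack
  proof (induction bs arbitrary: stack)
    case (Cons b bs)
    have "sz (enc (shift_reduce b stack)) \<le> 2 + sz (enc stack)"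
      by (auto simp: shift_reduce_def split: list.splits)
    then show ?case using Cons[of "shift_reduce b stack"] by simp
  qed simp
  have "fp (\<lambda>x. fold (\<lambda>b stack. shift_reduce b stack) (rev (l x)) [])"
  proof (rule fp_fold[where b = "\<lambda>n. 2 * (n + 2) ^ k + 1"])
    show "fp (\<lambda>z :: 'a \<times> bool \<times> data list. shift_reduce (fst (snd z)) (snd (snd z)))"
      unfolding shift_reduce_def by (intro fp_intros)
    show "sz (enc (fold (\<lambda>b stack. shift_reduce b stack) (take j (rev (l x))) [])) \<le> 2 * (sz (enc x) + 2) ^ k + 1" for x j
      using s[of "take j (rev (l x))" "[]"] k[of x] length_le_sz[of "l x"] by simp
  qed (intro fp_intros pb_intros assms)+
  then have "fp (\<lambda>x. case fold shift_reduce (rev (l x)) [] of [] \<Rightarrow> Leaf | d # r \<Rightarrow> d)"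
    by (intro fp_intros)
  then show ?thesis by (simp add: parse_def foldr_conv_fold)
qed

text \<open>A guessed symbol serves as an index into the list of all blocks of \<open>K\<close>
  bits, so one symbol per input position carries \<open>K\<close> certificate bits.\<close>

lemma blocks_exist:
  assumes "length bs = K * n"
  shows "\<exists>cs. length cs = n \<and> (\<forall>c\<in>set cs. c < length (List.n_lists K [False, True])) \<and>
    concat (map (\<lambda>c. List.n_lists K [False, True] ! c) cs) = bs"
  using assms
proof (induction n arbitrary: bs)
  case 0
  then show ?case by auto
next
  case (Suc n)
  obtain cs where cs: "length cs = n" "\<forall>c\<in>set cs. c < length (List.n_lists K [False, True])"
      "concat (map (\<lambda>c. List.n_lists K [False, True] ! c) cs) = drop K bs"
    using Suc.IH[of "drop K bs"] Suc.prems by auto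
  have "take K bs \<in> set (List.n_lists K [False, True])"
    using Suc.prems by (auto simp: set_n_lists)
  then obtain c where "c < length (List.n_lists K [False, True])" "List.n_lists K [False, True] ! c = take K bs"
    by (metis in_set_conv_nth)
  then show ?case using cs by (intro exI[of _ "c # cs"]) auto
qed

text \<open>The bound on the certificate is linear because the number of guesses is the length of
  the word and the guessing alphabet is fixed. Bits beyond the code of the certificate are
  padding.\<close>

theorem NP_certificate:
  assumes V: "fp (V :: bool list \<times> data \<Rightarrow> bool)"
    and sound: "\<And>w d. V (w, d) \<Longrightarrow> w \<in> L"
    and complete: "\<And>w. w \<in> L \<Longrightarrow> \<exists>d. sz d \<le> K * length w \<and> V (w, d)"
  shows "L \<in> NP"
proof (rule NP_I)
  let ?ls = "List.n_lists K [False, True]"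
  let ?U = "\<lambda>z :: (bool \<times> nat) list. V (map fst z,
     parse (concat (map (\<lambda>p. if snd p < length ?ls then ?ls ! snd p else []) z)))"
  show "fp ?U"
    by (intro fp_comp[OF V] fp_intros fp_finite_table)
  show "0 < length ?ls" by (simp add: length_n_lists)
  fix w
  show "w \<in> L \<longleftrightarrow> (\<exists>cs. length cs = length w \<and> (\<forall>c\<in>set cs. c < length ?ls) \<and> ?U (zip w cs))"
  proof
    assume "w \<in> L"
    then obtain d where d: "sz d \<le> K * length w" "V (w, d)" using complete by blast
    let ?bs = "tokens d @ replicate (K * length w - sz d) False"
    obtain cs where cs: "length cs = length w" "\<forall>c\<in>set cs. c < length ?ls" "concat (map (\<lambda>c. ?ls ! c) cs) = ?bs"
      using blocks_exist[of ?bs K "length w"] d(1) by (auto simp: tokens_def)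
    have "map (\<lambda>p. if snd p < length ?ls then ?ls ! snd p else []) (zip w cs) =
        map (\<lambda>c. if c < length ?ls then ?ls ! c else []) (map snd (zip w cs))"
      by (simp del: map_snd_zip)
    also have "\<dots> = map (\<lambda>c. ?ls ! c) cs" using cs(1,2) by simp
    finally have "?U (zip w cs)" using cs d(2) by (simp add: parse_tokens)
    then show "\<exists>cs. length cs = length w \<and> (\<forall>c\<in>set cs. c < length ?ls) \<and> ?U (zip w cs)"
      using cs by blast
  next
    assume "\<exists>cs. length cs = length w \<and> (\<forall>c\<in>set cs. c < length ?ls) \<and> ?U (zip w cs)"
    then obtain cs where "length cs = length w" "?U (zip w cs)" by blast
    then show "w \<in> L" using sound by simp
  qed
qed

text \<open>Any tree can be read as a value of these types, so certificates need no syntax check.\<close>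

definition readable :: "(data \<Rightarrow> 'a::enc) \<Rightarrow> bool" where
  "readable dec \<longleftrightarrow> fp dec \<and> (\<forall>x. dec (enc x) = x)"

primrec spine :: "data \<Rightarrow> data list" where
  "spine Leaf = []"
| "spine (Node a b) = a # spine b"

lemma enc_spine [simp]: "enc (spine d) = d"
  by (induction d) auto

lemma spine_enc_list [simp]: "spine (enc xs) = map enc xs"
  by (induction xs) auto

lemma fp_spine [fp_intros]: "fp f \<Longrightarrow> fp (\<lambda>x. spine (f x))"
  by (erule fp_retype) simp

lemma readable_bool: "readable (\<lambda>d. d \<noteq> Leaf)"
  unfolding readable_def by (auto intro!: fp_intros simp: enc_bool_def)

lemma readable_list: "readable dec \<Longrightarrow> readable (\<lambda>d. map dec (spine d))"
  unfolding readable_def by (auto intro!: fp_intros fp_comp[of dec] simp: comp_def)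

lemma readable_nat: "readable (\<lambda>d. length (spine d))"
  unfolding readable_def by (auto intro!: fp_intros simp: enc_nat_def)

text \<open>A pair has the code of a nonempty list, so the head of the spine is its first component
  and the tail, encoded again, its second. \<open>Leaf\<close> is the default where there is no
  pair.\<close>

lemma readable_prod:
  assumes "readable d1" "readable d2"
  shows "readable (\<lambda>d. (d1 (case spine d of [] \<Rightarrow> Leaf | a # b \<Rightarrow> a), d2 (case spine d of [] \<Rightarrow> Leaf | a # b \<Rightarrow> enc b)))"
proof -
  have e: "fp f \<Longrightarrow> fp (\<lambda>x. enc (f x))" for f :: "'x::enc \<Rightarrow> data list" by (erule fp_retype) simp
  have 1: "fp (\<lambda>d. case spine d of [] \<Rightarrow> Leaf | a # b \<Rightarrow> a)" by (intro fp_intros)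
  have 2: "fp (\<lambda>d. case spine d of [] \<Rightarrow> Leaf | a # b \<Rightarrow> enc b)" by (intro fp_intros e)
  have "fp d1" "fp d2" using assms by (auto simp: readable_def)
  note fp_Pair[OF fp_comp[OF this(1) 1] fp_comp[OF this(2) 2]]
  then show ?thesis using assms by (auto simp: readable_def)
qed

lemma readable_int:
  assumes "readable (dec :: data \<Rightarrow> bool \<times> bool list)" shows "readable (\<lambda>d. make_int (dec d))"
proof -
  have "make_int (dec (enc i)) = i" for i
  proof -
    have "dec (enc i) = (i < 0, binary_digits (nat \<bar>i\<bar>))"
      using assms by (simp add: readable_def enc_int_def)
    then show ?thesis by (simp add: make_int_def)
  qed
  then show ?thesis using assms by (auto simp: readable_def intro!: fp_intros)
qed

lemma readable_segment:
  assumes "readable (dec :: data \<Rightarrow> bool \<times> int \<times> int)"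
  shows "readable (\<lambda>d. if fst (dec d) then Vertical (fst (snd (dec d))) (snd (snd (dec d)))
     else Horizontal (fst (snd (dec d))) (snd (snd (dec d))))"
proof -
  have parts: "dec (enc e) = segment_parts e" for e
  proof -
    have "enc e = enc (segment_parts e)" by (cases e) auto
    moreover have "\<forall>x. dec (enc x) = x" using assms unfolding readable_def by blast
    ultimately show ?thesis by metis
  qed
  have "(if fst (dec (enc e)) then Vertical (fst (snd (dec (enc e)))) (snd (snd (dec (enc e))))
     else Horizontal (fst (snd (dec (enc e)))) (snd (snd (dec (enc e))))) = e" for e
    unfolding parts by (cases e) auto
  then show ?thesis using assms by (auto simp: readable_def intro!: fp_intros)
qed

section \<open>Deciding connectivity\<close>

text \<open>Adjacency in terms of successor and equality, for which closure rules on binary integers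
  are at hand.\<close>

definition near :: "cell \<Rightarrow> cell \<Rightarrow> bool" where
  "near p q \<longleftrightarrow> (fst q = fst p + 1 \<and> snd q = snd p) \<or> (fst p = fst q + 1 \<and> snd q = snd p) \<or>
     (fst q = fst p \<and> snd q = snd p + 1) \<or> (fst q = fst p \<and> snd p = snd q + 1)"

lemma near_share_edge: "near p q \<longleftrightarrow> share_edge p q"
proof -
  obtain x y x' y' where e: "p = (x, y)" "q = (x', y')" by force
  show ?thesis unfolding e share_edge_iff near_def by (simp, presburger)
qed

text \<open>One round of breadth-first search. The list of all cells is carried along because
  \<open>fp_funpow\<close> iterates a function of the state alone.\<close>

definition spread :: "cell list \<times> cell list \<Rightarrow> cell list \<times> cell list" where
  "spread s = (fst s, filter (\<lambda>q. \<exists>r\<in>set (snd s). q = r \<or> near r q) (fst s))"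

definition check_connected :: "cell list \<Rightarrow> bool" where
  "check_connected C = (case C of [] \<Rightarrow> True | a # C' \<Rightarrow>
     (\<forall>q\<in>set C. q \<in> set (snd ((spread ^^ length C) (C, [a])))))"

lemma sz_filter: "sz (enc (filter P (xs :: 'a::enc list))) \<le> sz (enc xs)"
  by (induction xs) auto

lemma spread_fst: "fst ((spread ^^ j) (C, R)) = C"
  by (induction j) (auto simp: spread_def)

lemma fp_check_connected [fp_intros]:
  assumes "fp l" shows "fp (\<lambda>x. check_connected (l x))"
proof -
  obtain k where k: "\<And>x. sz (enc (l x)) \<le> (sz (enc x) + 2) ^ k" using assms by (rule fp_size) blast
  have "fp (\<lambda>x. (spread ^^ length (l x)) (l x, case l x of [] \<Rightarrow> [] | a # as \<Rightarrow> [a]))"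
  proof (rule fp_funpow[where b = "\<lambda>n. Suc (2 * (n + 2) ^ k)"])
    show "fp spread" unfolding spread_def near_def by (intro fp_intros)
    show "sz (enc ((spread ^^ j) (l x, case l x of [] \<Rightarrow> [] | a # as \<Rightarrow> [a]))) \<le> Suc (2 * (sz (enc x) + 2) ^ k)" for j x
    proof -
      have "sz (enc (snd ((spread ^^ j) (l x, case l x of [] \<Rightarrow> [] | a # as \<Rightarrow> [a])))) \<le> sz (enc (l x))"
      proof (cases j)
        case 0
        have "0 < sz (enc as)" for as :: "cell list" by (rule sz_pos)
        then show ?thesis by (cases "l x") (auto simp: 0 Suc_le_eq simp del: sz_pos)
      next
        case (Suc i)
        show ?thesis by (simp add: Suc spread_def spread_fst sz_filter)
      qed
      then show ?thesis using k[of x] by (simp add: enc_prod_def spread_fst)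
    qed
  qed (intro fp_intros pb_intros assms)+
  then have "fp (\<lambda>x. \<forall>q\<in>set (l x). q \<in> set (snd ((spread ^^ length (l x)) (l x, case l x of [] \<Rightarrow> [] | a # as \<Rightarrow> [a]))))"
    by (intro fp_intros assms) (rule fp_comp[of _ fst], auto intro: fp_intros)
  moreover have "check_connected C = (\<forall>q\<in>set C. q \<in> set (snd ((spread ^^ length C) (C, case C of [] \<Rightarrow> [] | a # as \<Rightarrow> [a]))))" for C
    by (cases C) (auto simp: check_connected_def)
  ultimately show ?thesis by simp
qed

lemma check_connected_iff: "check_connected C \<longleftrightarrow> edge_connected (set C)"
proof (cases C)
  case Nil
  then show ?thesis by (simp add: check_connected_def edge_connected_def)
next
  case (Cons a C')
  define S where "S j = set (snd ((spread ^^ j) (C, [a])))" for j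
  define F where "F X = {q \<in> set C. \<exists>r\<in>X. q = r \<or> share_edge r q}" for X
  have S0: "S 0 = {a}" by (simp add: S_def)
  have SS: "S (Suc j) = F (S j)" for j
    by (auto simp: S_def F_def spread_def spread_fst near_share_edge)
  have sub: "S j \<subseteq> set C" for j
    by (cases j) (auto simp: S0 SS F_def Cons)
  have inc: "S j \<subseteq> S (Suc j)" for j
    using sub[of j] by (auto simp: SS F_def)
  have link: "q \<in> S j \<Longrightarrow> linked (set C) a q" for q j
  proof (induction j arbitrary: q)
    case 0
    then show ?case by (simp add: S0 linked_refl)
  next
    case (Suc j)
    then obtain r where r: "q \<in> set C" "r \<in> S j" "q = r \<or> share_edge r q" by (auto simp: SS F_def)
    then show ?case using Suc.IH[OF r(2)] sub[of j] linked_step[of r "set C" q] linked_trans by blast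
  qed
  \<comment> \<open>Starting from one element, a chain that grew strictly in each of the
    \<open>length C\<close> rounds would end with more elements than \<open>C\<close> has.\<close>
  have "\<exists>j<length C. S (Suc j) = S j"
  proof (rule ccontr)
    assume no: "\<not> (\<exists>j<length C. S (Suc j) = S j)"
    have "j \<le> length C \<Longrightarrow> j < card (S j)" for j
    proof (induction j)
      case (Suc j)
      then have "S (Suc j) \<noteq> S j" using no by auto
      then have "S j \<subset> S (Suc j)" using inc[of j] by blast
      then have "card (S j) < card (S (Suc j))"
        using sub[of "Suc j"] by (meson List.finite_set finite_subset psubset_card_mono)
      then show ?case using Suc by simp
    qed (simp add: S0)
    then have "length C < card (S (length C))" by simp
    also have "\<dots> \<le> card (set C)" using sub by (simp add: card_mono)
    also have "\<dots> \<le> length C" by (rule card_length)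
    finally show False by simp
  qed
  then obtain j where j: "j < length C" "S (Suc j) = S j" by blast
  have fixp: "S (j + i) = S j" for i
    by (induction i) (use j SS in auto)
  have n: "S (length C) = S j" using fixp[of "length C - j"] j(1) by simp
  have reach: "linked (set C) a q \<Longrightarrow> q \<in> S j" for q
    unfolding linked_def
  proof (induction rule: rtranclp_induct)
    case base
    have "S 0 \<subseteq> S j" by (rule lift_Suc_mono_le[of S 0 j]) (use inc in auto)
    then show ?case by (simp add: S0)
  next
    case (step y z)
    then have "z \<in> F (S j)" unfolding F_def by blast
    then show ?case using j SS by simp
  qed
  have "check_connected C \<longleftrightarrow> (\<forall>q\<in>set C. q \<in> S (length C))"
    by (simp add: check_connected_def S_def Cons)
  also have "\<dots> \<longleftrightarrow> (\<forall>q\<in>set C. linked (set C) a q)"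
    unfolding n using link reach by blast
  also have "\<dots> \<longleftrightarrow> edge_connected (set C)"
    unfolding edge_connected_linked using linked_sym linked_trans Cons by (metis list.set_intros(1))
  finally show ?thesis .
qed

section \<open>Connectivity of the complement inside a box\<close>

text \<open>Coordinates are binary, so listing all integers between two bounds could take
  exponential time. Thickening the projections of the cells gives at most three entries per cell,
  and for a connected region the result is an interval that exceeds the projection by one at each
  end.\<close>

definition thicken :: "int set \<Rightarrow> int set" where
  "thicken X = (\<Union>x\<in>X. {x - 1, x, x + 1})"

lemma linked_mono: "linked D p q \<Longrightarrow> D \<subseteq> E \<Longrightarrow> linked E p q"
  unfolding linked_def by (rule rtranclp_mono[THEN predicate2D]) auto

lemma thicken_interval:
  assumes "finite X" "X \<noteq> {}" and gap: "\<And>l r u. l \<in> X \<Longrightarrow> r \<in> X \<Longrightarrow> l < u \<Longrightarrow> u < r \<Longrightarrow> u \<in> X"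
  shows "thicken X = {Min X - 1..Max X + 1}"
proof (rule set_eqI)
  fix u show "u \<in> thicken X \<longleftrightarrow> u \<in> {Min X - 1..Max X + 1}"
  proof
    assume "u \<in> thicken X"
    then obtain x where "x \<in> X" "u = x - 1 \<or> u = x \<or> u = x + 1" unfolding thicken_def by auto
    moreover from this have "Min X \<le> x" "x \<le> Max X" using assms(1) by simp_all
    ultimately show "u \<in> {Min X - 1..Max X + 1}" by (elim disjE) (simp_all only: atLeastAtMost_iff, linarith+)
  next
    assume u: "u \<in> {Min X - 1..Max X + 1}"
    have mm: "Min X \<in> X" "Max X \<in> X" using assms by auto
    consider "u = Min X - 1" | "u = Max X + 1" | "u = Min X" | "u = Max X" | "Min X < u" "u < Max X"
      using u by fastforce
    then show "u \<in> thicken X"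
      by cases (use mm gap[OF mm, of u] in \<open>auto simp: thicken_def\<close>)
  qed
qed

text \<open>A discrete intermediate value theorem: along a path of cells \<open>g\<close> changes by
  at most one per step, so it cannot jump over \<open>u\<close>.\<close>

lemma connected_gap:
  assumes "edge_connected D" "p \<in> D" "q \<in> D"
    and lip: "\<And>p q. share_edge p q \<Longrightarrow> \<bar>g p - g q\<bar> \<le> (1 :: int)"
    and "g p < u" "u < g q"
  shows "u \<in> g ` D"
proof (rule ccontr)
  assume u: "u \<notin> g ` D"
  have "linked D p q" using assms edge_connected_linked by blast
  then have "g q < u" unfolding linked_def
  proof (induction rule: rtranclp_induct)
    case base
    show ?case by fact
  next
    case (step y z)
    have "g z \<noteq> u" using u step.hyps(2) by blast
    then show ?case using step lip[of y z] by auto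
  qed
  then show False using assms by simp
qed

lemma linked_horizontal:
  assumes "x \<le> x'" "\<And>t. x \<le> t \<Longrightarrow> t \<le> x' \<Longrightarrow> (t, y) \<in> C" shows "linked C (x, y) (x', y)"
  using assms
proof (induction x' rule: int_ge_induct)
  case (step i)
  have "linked C (i, y) (i + 1, y)"
    by (rule linked_step) (use step in \<open>auto simp: share_edge_iff\<close>)
  then show ?case using step linked_trans by fastforce
qed (simp add: linked_refl)

lemma linked_vertical:
  assumes "y \<le> y'" "\<And>t. y \<le> t \<Longrightarrow> t \<le> y' \<Longrightarrow> (x, t) \<in> C" shows "linked C (x, y) (x, y')"
  using assms
proof (induction y' rule: int_ge_induct)
  case (step i)
  have "linked C (x, i) (x, i + 1)"
    by (rule linked_step) (use step in \<open>auto simp: share_edge_iff\<close>)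
  then show ?case using step linked_trans by fastforce
qed (simp add: linked_refl)

lemma clamp_dist: "\<bar>max a (min b x) - max a (min b y)\<bar> \<le> \<bar>x - y :: int\<bar>"
  by (cases "x \<le> y") (auto simp: max_def min_def)

text \<open>Clamping coordinates maps the complement of \<open>D\<close> to its part in the box and preserves links.\<close>

lemma complement_in_box:
  assumes D: "finite D" "D \<noteq> {}" "edge_connected D"
  shows "edge_connected (- D) \<longleftrightarrow> edge_connected (thicken (fst ` D) \<times> thicken (snd ` D) - D)"
proof -
  have l1: "\<bar>fst p - fst q\<bar> \<le> 1" and l2: "\<bar>snd p - snd q\<bar> \<le> 1" if "share_edge p q" for p q
    using that share_edge_iff[of "fst p" "snd p" "fst q" "snd q"] by auto
  define a b c d where "a = Min (fst ` D) - 1" and "b = Max (fst ` D) + 1"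
    and "c = Min (snd ` D) - 1" and "d = Max (snd ` D) + 1"
  have X: "thicken (fst ` D) = {a..b}" unfolding a_def b_def
    by (rule thicken_interval) (use D connected_gap[OF D(3) _ _ l1] in auto)
  have Y: "thicken (snd ` D) = {c..d}" unfolding c_def d_def
    by (rule thicken_interval) (use D connected_gap[OF D(3) _ _ l2] in auto)
  have inner: "a < x \<and> x < b \<and> c < y \<and> y < d" if "(x, y) \<in> D" for x y
  proof -
    have "x \<in> fst ` D" "y \<in> snd ` D" using that by force+
    then have "Min (fst ` D) \<le> x" "x \<le> Max (fst ` D)" "Min (snd ` D) \<le> y" "y \<le> Max (snd ` D)"
      using D by auto
    then show ?thesis unfolding a_def b_def c_def d_def by linarith
  qed
  obtain x0 y0 where "(x0, y0) \<in> D" using D(2) by auto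
  from inner[OF this] have ab: "a \<le> b" "c \<le> d" by linarith+
  let ?B = "{a..b} \<times> {c..d} - D"
  define r where "r p = (max a (min b (fst p)), max c (min d (snd p)))" for p :: cell
  have rB: "r p \<in> ?B" if "p \<notin> D" for p
  proof -
    have "r p \<notin> D"
    proof
      assume "r p \<in> D"
      then have "a < fst (r p) \<and> fst (r p) < b \<and> c < snd (r p) \<and> snd (r p) < d" by (cases "r p") (use inner in auto)
      then have "r p = p" by (cases p) (auto simp: r_def max_def min_def split: if_splits)
      then show False using that \<open>r p \<in> D\<close> by simp
    qed
    then show ?thesis using ab by (auto simp: r_def)
  qed
  have rid: "r p = p" if "p \<in> ?B" for p using that by (cases p) (auto simp: r_def)
  have rlink: "linked ?B (r p) (r q)" if "linked (- D) p q" for p q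
    using that unfolding linked_def[of "- D"]
  proof (induction rule: rtranclp_induct)
    case (step y z)
    have "linked ?B (r y) (r z)"
    proof (cases "r y = r z")
      case False
      have "\<bar>fst y - fst z\<bar> + \<bar>snd y - snd z\<bar> = 1" using step share_edge_iff by (metis prod.collapse)
      moreover have "\<bar>fst (r y) - fst (r z)\<bar> \<le> \<bar>fst y - fst z\<bar>" "\<bar>snd (r y) - snd (r z)\<bar> \<le> \<bar>snd y - snd z\<bar>"
        unfolding r_def fst_conv snd_conv by (rule clamp_dist)+
      moreover have "fst (r y) \<noteq> fst (r z) \<or> snd (r y) \<noteq> snd (r z)" using False by (simp add: prod_eq_iff)
      ultimately have "\<bar>fst (r y) - fst (r z)\<bar> + \<bar>snd (r y) - snd (r z)\<bar> = 1" by linarith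
      then have "share_edge (r y) (r z)" using share_edge_iff by (metis prod.collapse)
      then show ?thesis using step rB by (intro linked_step) auto
    qed (simp add: linked_refl)
    then show ?case using step linked_trans by blast
  qed (simp add: linked_refl)
  have out: "(x, y) \<in> - D" if "x \<le> a \<or> b \<le> x \<or> y \<le> c \<or> d \<le> y" for x y
    using that inner[of x y] by force
  \<comment> \<open>For the converse every outside cell is linked to its clamped image, first
    horizontally, then vertically. The cells added by each leg have a coordinate on or beyond the
    border of the box, where \<open>D\<close> has no cell.\<close>
  have pr: "linked (- D) p (r p)" if p: "p \<notin> D" for p
  proof -
    obtain x y where e: "p = (x, y)" by force
    let ?x = "max a (min b x)" and ?y = "max c (min d y)"
    have 1: "linked (- D) (x, y) (?x, y)"
    proof (cases "x \<le> ?x")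
      case True
      show ?thesis
      proof (rule linked_horizontal[OF True])
        fix t assume "x \<le> t" "t \<le> ?x"
        then have "t = x \<or> t \<le> a" using True by (auto simp: max_def min_def split: if_splits)
        then show "(t, y) \<in> - D" using p e out by blast
      qed
    next
      case False
      then have le: "?x \<le> x" by linarith
      show ?thesis
      proof (rule linked_sym, rule linked_horizontal[OF le])
        fix t assume "?x \<le> t" "t \<le> x"
        then have "t = x \<or> b \<le> t" using False ab by (auto simp: max_def min_def split: if_splits)
        then show "(t, y) \<in> - D" using p e out by blast
      qed
    qed
    have mid: "(?x, y) \<in> - D"
    proof (cases "x = ?x")
      case True
      then show ?thesis using p e by simp
    next
      case False
      then have "?x \<le> a \<or> b \<le> ?x" by (auto simp: max_def min_def split: if_splits)
      then show ?thesis using out by blast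
    qed
    have 2: "linked (- D) (?x, y) (?x, ?y)"
    proof (cases "y \<le> ?y")
      case True
      show ?thesis
      proof (rule linked_vertical[OF True])
        fix t assume t: "y \<le> t" "t \<le> ?y"
        then have "t = y \<or> t \<le> c" using True by (auto simp: max_def min_def split: if_splits)
        then show "(?x, t) \<in> - D" using mid out by blast
      qed
    next
      case False
      then have le: "?y \<le> y" by linarith
      show ?thesis
      proof (rule linked_sym, rule linked_vertical[OF le])
        fix t assume t: "?y \<le> t" "t \<le> y"
        then have "t = y \<or> d \<le> t" using False ab by (auto simp: max_def min_def split: if_splits)
        then show "(?x, t) \<in> - D" using mid out by blast
      qed
    qed
    show ?thesis using linked_trans[OF 1 2] by (simp add: e r_def)
  qed
  show ?thesis unfolding X Y edge_connected_linked
  proof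
    assume all: "\<forall>p\<in>- D. \<forall>q\<in>- D. linked (- D) p q"
    show "\<forall>p\<in>?B. \<forall>q\<in>?B. linked ?B p q"
    proof (intro ballI)
      fix p q assume pq: "p \<in> ?B" "q \<in> ?B"
      then have "linked ?B (r p) (r q)" using all by (intro rlink) auto
      then show "linked ?B p q" using rid pq by simp
    qed
  next
    assume all: "\<forall>p\<in>?B. \<forall>q\<in>?B. linked ?B p q"
    show "\<forall>p\<in>- D. \<forall>q\<in>- D. linked (- D) p q"
    proof (intro ballI)
      fix p q assume pq: "p \<in> - D" "q \<in> - D"
      have "linked ?B (r p) (r q)" using all rB pq by blast
      then have "linked (- D) (r p) (r q)" by (rule linked_mono) auto
      then show "linked (- D) p q" using pr pq linked_trans linked_sym by (metis ComplD)
    qed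
  qed
qed

section \<open>The tiling problem is in NP\<close>

definition box_list :: "cell list \<Rightarrow> cell list" where
  "box_list cs = concat (map (\<lambda>x. map (\<lambda>y. (x, y)) (concat (map (\<lambda>p. [snd p - 1, snd p, snd p + 1]) cs)))
     (concat (map (\<lambda>p. [fst p - 1, fst p, fst p + 1]) cs)))"

lemma set_box_list: "set (box_list cs) = thicken (fst ` set cs) \<times> thicken (snd ` set cs)"
proof -
  have "set (concat (map (\<lambda>p. [g p - 1, g p, g p + 1]) cs)) = thicken (g ` set cs)" for g :: "cell \<Rightarrow> int"
    by (auto simp: thicken_def)
  moreover have "set (concat (map (\<lambda>x. map (\<lambda>y. (x, y)) ys) xs)) = set xs \<times> set ys" for xs ys :: "int list"
    by auto
  ultimately show ?thesis unfolding box_list_def by (simp only:)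
qed

lemma fp_box_list [fp_intros]: "fp f \<Longrightarrow> fp (\<lambda>x. box_list (f x))"
proof -
  assume "fp f"
  moreover have "fp box_list" unfolding box_list_def by (intro fp_intros)
  ultimately show ?thesis by (rule fp_comp[rotated])
qed

definition tile_color :: "wang_tile list \<Rightarrow> side \<Rightarrow> nat \<Rightarrow> nat" where
  "tile_color ts s n = (if n < length ts then side_color (ts ! n) s else 0)"

lemma fp_tile_color [fp_intros]: "fp n \<Longrightarrow> fp (\<lambda>x. tile_color ts s (n x))"
  unfolding tile_color_def by (rule fp_finite_table)

definition edges_of :: "wang_tile list \<Rightarrow> cell \<times> nat \<Rightarrow> (segment \<times> cell \<times> nat) list" where
  "edges_of ts p =
    [(Horizontal (fst (fst p)) (snd (fst p) + 1), (fst p, tile_color ts North (snd p))),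
     (Horizontal (fst (fst p)) (snd (fst p)), (fst p, tile_color ts South (snd p))),
     (Vertical (fst (fst p)) (snd (fst p)), (fst p, tile_color ts West (snd p))),
     (Vertical (fst (fst p) + 1) (snd (fst p)), (fst p, tile_color ts East (snd p)))]"

text \<open>With one entry for every side of every cell, matching of neighbours, boundary membership
  and boundary colors all become comparisons between list entries.\<close>

definition edge_list :: "wang_tile list \<Rightarrow> (cell \<times> nat) list \<Rightarrow> (segment \<times> cell \<times> nat) list" where
  "edge_list ts tc = concat (map (edges_of ts) tc)"

lemma in_edge_list:
  "(e, p, k) \<in> set (edge_list ts tc) \<longleftrightarrow> (\<exists>n s. (p, n) \<in> set tc \<and> e = segment_of p s \<and> k = tile_color ts s n)"
proof -
  have "(e, p, k) \<in> set (edges_of ts (q, n)) \<longleftrightarrow> q = p \<and> (\<exists>s. e = segment_of p s \<and> k = tile_color ts s n)" for q n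
    by (cases q) (auto simp: edges_of_def intro: exI[of _ North] exI[of _ South] exI[of _ West] exI[of _ East],
      metis segment_of.simps side.exhaust side_color.simps, (metis segment_of.simps side.exhaust)+)
  then show ?thesis unfolding edge_list_def by fastforce
qed

lemma fp_edge_list [fp_intros]: "fp f \<Longrightarrow> fp (\<lambda>x. edge_list ts (f x))"
proof -
  assume "fp f"
  moreover have "fp (edge_list ts)" unfolding edge_list_def edges_of_def by (intro fp_intros)
  ultimately show ?thesis by (rule fp_comp[rotated])
qed

definition free_edges :: "(segment \<times> cell \<times> nat) list \<Rightarrow> segment list" where
  "free_edges E = filter (\<lambda>e. \<forall>x\<in>set E. \<forall>y\<in>set E. fst x = e \<longrightarrow> fst y = e \<longrightarrow> fst (snd x) = fst (snd y)) (map fst E)"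

lemma fp_free_edges [fp_intros]: "fp f \<Longrightarrow> fp (\<lambda>x. free_edges (f x))"
proof -
  assume "fp f"
  moreover have "fp free_edges" unfolding free_edges_def by (intro fp_intros)
  ultimately show ?thesis by (rule fp_comp[rotated])
qed

lemma set_free_edges: "set (free_edges (edge_list ts tc)) = boundary (fst ` set tc)"
proof (rule set_eqI)
  fix e
  let ?on = "\<lambda>p. p \<in> fst ` set tc \<and> (\<exists>s. e = segment_of p s)"
  have on: "(\<exists>k. (e, p, k) \<in> set (edge_list ts tc)) \<longleftrightarrow> ?on p" for p
    unfolding in_edge_list by force
  have "e \<in> set (free_edges (edge_list ts tc)) \<longleftrightarrow>
      (\<exists>p k. (e, p, k) \<in> set (edge_list ts tc)) \<and>
      (\<forall>p k q l. (e, p, k) \<in> set (edge_list ts tc) \<longrightarrow> (e, q, l) \<in> set (edge_list ts tc) \<longrightarrow> p = q)"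
    unfolding free_edges_def
    by (simp add: image_iff Ball_def Bex_def split_paired_All split_paired_Ex)
  also have "\<dots> \<longleftrightarrow> (\<exists>p. ?on p) \<and> (\<forall>p q. ?on p \<longrightarrow> ?on q \<longrightarrow> p = q)"
    unfolding on[symmetric] by blast
  also have "\<dots> \<longleftrightarrow> (\<exists>!p. ?on p)" by blast
  finally show "e \<in> set (free_edges (edge_list ts tc)) \<longleftrightarrow> e \<in> boundary (fst ` set tc)"
    by (simp add: boundary_def)
qed

text \<open>The certificate contains the whole instance besides the tile numbers. The verifier
  encodes that instance and compares the result with the word, which spares a polynomial-time
  decoder.\<close>

definition verify :: "wang_tile list \<Rightarrow> bool list \<times> (cell \<times> nat) list \<times> (segment \<times> nat) list \<Rightarrow> bool" where
  "verify ts z \<longleftrightarrow>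
     fst z = encode_instance (map fst (fst (snd z)), snd (snd z)) \<and> fst (snd z) \<noteq> [] \<and>
     distinct (map fst (fst (snd z))) \<and> check_connected (map fst (fst (snd z))) \<and>
     check_connected (filter (\<lambda>q. q \<notin> set (map fst (fst (snd z)))) (box_list (map fst (fst (snd z))))) \<and>
     distinct (map fst (snd (snd z))) \<and>
     (\<forall>p\<in>set (fst (snd z)). snd p < length ts) \<and>
     (\<forall>x\<in>set (edge_list ts (fst (snd z))). \<forall>y\<in>set (edge_list ts (fst (snd z))).
        fst x = fst y \<longrightarrow> snd (snd x) = snd (snd y)) \<and>
     (\<forall>e\<in>set (map fst (snd (snd z))). e \<in> set (free_edges (edge_list ts (fst (snd z))))) \<and>
     (\<forall>e\<in>set (free_edges (edge_list ts (fst (snd z)))). e \<in> set (map fst (snd (snd z)))) \<and>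
     (\<forall>b\<in>set (snd (snd z)). \<forall>x\<in>set (edge_list ts (fst (snd z))). fst b = fst x \<longrightarrow> snd (snd x) = snd b)"

lemma fp_verify: "fp (verify ts)"
  unfolding verify_def by (intro fp_intros)

lemma verify_iff:
  assumes tc: "map fst tc = cs"
  shows "verify ts (w, tc, bs) \<longleftrightarrow> w = encode_instance (cs, bs) \<and> valid_instance (cs, bs) \<and>
     (\<forall>p\<in>set tc. snd p < length ts) \<and>
     (\<forall>e p k q l. (e, p, k) \<in> set (edge_list ts tc) \<longrightarrow> (e, q, l) \<in> set (edge_list ts tc) \<longrightarrow> k = l) \<and>
     (\<forall>e p k l. (e, p, k) \<in> set (edge_list ts tc) \<longrightarrow> (e, l) \<in> set bs \<longrightarrow> k = l)"
proof -
  have D: "fst ` set tc = set cs" using tc by (metis list.set_map)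
  have "set (filter (\<lambda>q. q \<notin> set cs) (box_list cs)) = thicken (fst ` set cs) \<times> thicken (snd ` set cs) - set cs"
    by (auto simp: set_box_list)
  then have h1: "cs \<noteq> [] \<and> check_connected cs \<and> check_connected (filter (\<lambda>q. q \<notin> set cs) (box_list cs)) \<longleftrightarrow>
      polyomino (set cs)"
    unfolding check_connected_iff polyomino_iff using complement_in_box[of "set cs"] by auto
  have h2: "(\<forall>e\<in>set (map fst bs). e \<in> set (free_edges (edge_list ts tc))) \<and>
      (\<forall>e\<in>set (free_edges (edge_list ts tc)). e \<in> set (map fst bs)) \<longleftrightarrow> fst ` set bs = boundary (set cs)"
    unfolding set_free_edges D by auto
  have h3: "tc \<noteq> [] \<longleftrightarrow> cs \<noteq> []" using tc by auto
  have h4: "(\<forall>x\<in>set (edge_list ts tc). \<forall>y\<in>set (edge_list ts tc). fst x = fst y \<longrightarrow> snd (snd x) = snd (snd y)) \<longleftrightarrow>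
     (\<forall>e p k q l. (e, p, k) \<in> set (edge_list ts tc) \<longrightarrow> (e, q, l) \<in> set (edge_list ts tc) \<longrightarrow> k = l)"
    by fastforce
  have h5: "(\<forall>b\<in>set bs. \<forall>x\<in>set (edge_list ts tc). fst b = fst x \<longrightarrow> snd (snd x) = snd b) \<longleftrightarrow>
     (\<forall>e p k l. (e, p, k) \<in> set (edge_list ts tc) \<longrightarrow> (e, l) \<in> set bs \<longrightarrow> k = l)"
    by fastforce
  show ?thesis
    unfolding verify_def fst_conv snd_conv tc valid_instance.simps h3 h4 h5 h1[symmetric] h2[symmetric]
    by (rule iffI; elim conjE; intro conjI; assumption)
qed

lemma verify_sound:
  assumes "verify ts (w, tc, bs)" shows "w \<in> tiling_problem (set ts)"
proof -
  let ?cs = "map fst tc"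
  let ?f = "\<lambda>p. ts ! the (map_of tc p)"
  note v = assms[unfolded verify_iff[OF refl]]
  have dtc: "distinct (map fst tc)" and dbs: "distinct (map fst bs)" and bd: "fst ` set bs = boundary (set ?cs)"
    using v by auto
  have f: "side_color (?f p) s = tile_color ts s n \<and> ?f p \<in> set ts" if "(p, n) \<in> set tc" for p n s
  proof -
    have "map_of tc p = Some n" using dtc that by simp
    moreover have "n < length ts" using v that by force
    ultimately show ?thesis by (simp add: tile_color_def)
  qed
  have "tiles_region (set ts) (set ?cs) (\<lambda>e. the (map_of bs e))"
    unfolding tiles_region_def
  proof (intro exI[of _ ?f] conjI ballI allI impI)
    fix p assume "p \<in> set ?cs"
    then obtain n where n: "(p, n) \<in> set tc" by auto
    show "?f p \<in> set ts" using f[OF n] by blast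
    {
      fix q s t assume "q \<in> set ?cs" "segment_of p s = segment_of q t"
      moreover from this obtain l where l: "(q, l) \<in> set tc" by auto
      ultimately have "(segment_of p s, p, tile_color ts s n) \<in> set (edge_list ts tc)"
        "(segment_of p s, q, tile_color ts t l) \<in> set (edge_list ts tc)"
        using n unfolding in_edge_list by metis+
      then have "tile_color ts s n = tile_color ts t l" using v by blast
      then show "side_color (?f p) s = side_color (?f q) t" using f[OF n, of s] f[OF l, of t] by simp
    }
    fix s assume "segment_of p s \<in> boundary (set ?cs)"
    then obtain k where k: "(segment_of p s, k) \<in> set bs" using bd by force
    have "(segment_of p s, p, tile_color ts s n) \<in> set (edge_list ts tc)"
      using n unfolding in_edge_list by metis
    then have "tile_color ts s n = k" using v k by blast
    then show "side_color (?f p) s = the (map_of bs (segment_of p s))" using f[OF n, of s] k dbs by simp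
  qed
  moreover have "w = encode_instance (?cs, bs)" "valid_instance (?cs, bs)" using v by blast+
  ultimately show ?thesis by (simp only: encode_instance_in_tiling_problem tileable.simps)
qed

section \<open>Certificates of linear size\<close>

lemma sz_encode_list:
  assumes "\<And>x. x \<in> set xs \<Longrightarrow> Suc (sz (enc (g x))) \<le> K * Suc (length (e x))" "1 \<le> K"
  shows "sz (enc (map g xs)) \<le> K * length (encode_list e xs)"
proof -
  have "sz (enc (map g xs)) \<le> Suc (K * (length (encode_list e xs) - 1))"
    using assms(1)
  proof (induction xs)
    case (Cons x xs)
    have "Suc (sz (enc (g x))) \<le> K * Suc (length (e x))" using Cons.prems by simp
    moreover have "sz (enc (map g xs)) \<le> Suc (K * (length (encode_list e xs) - 1))" using Cons by simp
    moreover have "length (encode_list e (x # xs)) - 1 = Suc (length (e x)) + (length (encode_list e xs) - 1)"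
      by (simp add: encode_list_def)
    ultimately show ?case by (simp add: add_mult_distrib2)
  qed (simp add: encode_list_def)
  also have "\<dots> \<le> K * length (encode_list e xs)"
  proof -
    have "0 < length (encode_list e xs)" by (simp add: encode_list_def)
    then obtain m where "length (encode_list e xs) = Suc m" by (cases "length (encode_list e xs)") auto
    then show ?thesis using assms(2) by simp
  qed
  finally show ?thesis .
qed

lemma sz_int: "sz (enc (i :: int)) \<le> 3 * length (encode_int i)"
proof -
  let ?bs = "binary_digits (nat \<bar>i\<bar>)"
  have "length (encode_nat (nat \<bar>i\<bar>)) = Suc (2 * length ?bs)"
    by (simp add: encode_nat_def encode_list_def length_concat comp_def sum_list_triv)
  moreover have "sz (enc ?bs) \<le> Suc (length ?bs * Suc 3)" by (rule sz_list_le) (simp add: enc_bool_def)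
  moreover have "sz (enc (i < 0)) \<le> 3" by (simp add: enc_bool_def)
  ultimately show ?thesis by (simp add: enc_int_def encode_int_def)
qed

lemma sz_cell: "sz (enc (p :: cell)) \<le> Suc (3 * length (encode_cell p))"
proof (cases p)
  case (Pair x y)
  then show ?thesis using sz_int[of x] sz_int[of y] by simp
qed

lemma sz_segment: "sz (enc (e :: segment)) \<le> 5 + 3 * length (encode_segment e)"
proof (cases e)
  case (Horizontal x y)
  then show ?thesis using sz_int[of x] sz_int[of y] by simp
next
  case (Vertical x y)
  then show ?thesis using sz_int[of x] sz_int[of y] by simp
qed

text \<open>Each cell and each boundary segment of the certificate has size at most a constant times
  that of its code in the word: coordinates are binary in both, and tile numbers and colors are
  unary but bounded by the tile set.\<close>

lemma verify_complete:
  assumes w: "w \<in> tiling_problem (set ts)" and B: "\<And>t s. t \<in> set ts \<Longrightarrow> side_color t s \<le> B"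
  shows "\<exists>tc bs. verify ts (w, tc, bs) \<and> sz (enc (tc, bs)) \<le> (2 * length ts + 2 * B + 10) * length w"
proof -
  obtain cs bs where wI: "w = encode_instance (cs, bs)" and valid: "valid_instance (cs, bs)"
    and til: "tileable (set ts) (cs, bs)"
    using w unfolding tiling_problem_def by auto
  have dbs: "distinct (map fst bs)" and bd: "fst ` set bs = boundary (set cs)" using valid by auto
  obtain f where fW: "\<And>p. p \<in> set cs \<Longrightarrow> f p \<in> set ts"
    and fm: "\<And>p q s t. p \<in> set cs \<Longrightarrow> q \<in> set cs \<Longrightarrow> segment_of p s = segment_of q t \<Longrightarrow> side_color (f p) s = side_color (f q) t"
    and fb: "\<And>p s. p \<in> set cs \<Longrightarrow> segment_of p s \<in> boundary (set cs) \<Longrightarrow>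
        side_color (f p) s = the (map_of bs (segment_of p s))"
    using til unfolding tileable.simps tiles_region_def by blast
  have "\<forall>p. \<exists>n. p \<in> set cs \<longrightarrow> n < length ts \<and> ts ! n = f p"
    using fW by (meson in_set_conv_nth)
  then obtain idx where idx: "\<And>p. p \<in> set cs \<Longrightarrow> idx p < length ts \<and> ts ! idx p = f p" by metis
  let ?tc = "map (\<lambda>p. (p, idx p)) cs"
  have edge: "(e, p, k) \<in> set (edge_list ts ?tc) \<longleftrightarrow> p \<in> set cs \<and> (\<exists>s. e = segment_of p s \<and> k = side_color (f p) s)" for e p k
  proof
    assume "(e, p, k) \<in> set (edge_list ts ?tc)"
    then obtain s where "p \<in> set cs" "e = segment_of p s" "k = tile_color ts s (idx p)"
      unfolding in_edge_list by auto
    then show "p \<in> set cs \<and> (\<exists>s. e = segment_of p s \<and> k = side_color (f p) s)"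
      using idx[of p] by (auto simp: tile_color_def)
  next
    assume "p \<in> set cs \<and> (\<exists>s. e = segment_of p s \<and> k = side_color (f p) s)"
    then obtain s where "p \<in> set cs" "e = segment_of p s" "k = side_color (f p) s" by blast
    then have "(p, idx p) \<in> set ?tc" "k = tile_color ts s (idx p)" using idx[of p] by (auto simp: tile_color_def)
    then show "(e, p, k) \<in> set (edge_list ts ?tc)" unfolding in_edge_list using \<open>e = segment_of p s\<close> by blast
  qed
  have fst: "map fst ?tc = cs" by (simp add: comp_def)
  have "verify ts (w, ?tc, bs)"
    unfolding verify_iff[OF fst]
  proof (intro conjI allI impI ballI)
    show "snd p < length ts" if "p \<in> set ?tc" for p using that idx by auto
    show "k = l" if "(e, p, k) \<in> set (edge_list ts ?tc)" "(e, q, l) \<in> set (edge_list ts ?tc)" for e p k q l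
      using that fm unfolding edge by metis
    show "k = l" if kl: "(e, p, k) \<in> set (edge_list ts ?tc)" "(e, l) \<in> set bs" for e p k l
    proof -
      obtain s where s: "p \<in> set cs" "e = segment_of p s" "k = side_color (f p) s" using kl(1) edge by blast
      have "e \<in> boundary (set cs)" using kl(2) bd by force
      then show ?thesis using fb[OF s(1), of s] s kl(2) dbs by simp
    qed
  qed (use wI valid in auto)
  moreover have "sz (enc (?tc, bs)) \<le> (2 * length ts + 2 * B + 10) * length w"
  proof -
    let ?K = "2 * length ts + 2 * B + 9"
    have 1: "sz (enc ?tc) \<le> ?K * length (encode_list encode_cell cs)"
    proof (rule sz_encode_list)
      fix p assume "p \<in> set cs"
      then have "idx p < length ts" using idx by blast
      then have "Suc (sz (enc (p, idx p))) \<le> 2 * length ts + 4 + 3 * length (encode_cell p)"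
        using sz_cell[of p] by (simp add: sz_nat)
      also have "\<dots> \<le> ?K * Suc (length (encode_cell p))" by (simp add: algebra_simps)
      finally show "Suc (sz (enc (p, idx p))) \<le> ?K * Suc (length (encode_cell p))" .
    qed simp
    have 2: "sz (enc (map (\<lambda>b. b) bs)) \<le> ?K * length (encode_list encode_colored_segment bs)"
    proof (rule sz_encode_list)
      fix b assume b: "b \<in> set bs"
      obtain e k where ek: "b = (e, k)" by force
      have "e \<in> boundary (set cs)" using b ek bd by force
      then obtain p s where p: "p \<in> set cs" "e = segment_of p s" unfolding boundary_def by blast
      \<comment> \<open>A boundary color of an untileable instance could be exponentially long in
        unary. In a tiling it is the color of some tile, hence at most \<open>B\<close>.\<close>
      then have "k = side_color (f p) s" using fb[OF p(1), of s] \<open>e \<in> boundary (set cs)\<close> b ek dbs by simp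
      then have "k \<le> B" using B fW[OF p(1)] by simp
      then have "Suc (sz (enc b)) \<le> 2 * B + 8 + 3 * length (encode_segment e)"
        using sz_segment[of e] by (simp add: ek sz_nat)
      also have "\<dots> \<le> ?K * Suc (length (encode_segment e))" by (simp add: algebra_simps)
      also have "\<dots> \<le> ?K * Suc (length (encode_colored_segment b))" by (simp add: ek)
      finally show "Suc (sz (enc b)) \<le> ?K * Suc (length (encode_colored_segment b))" .
    qed simp
    have len: "length w = length (encode_list encode_cell cs) + length (encode_list encode_colored_segment bs)"
      by (simp add: wI)
    moreover have "0 < length (encode_list encode_cell cs)" by (simp add: encode_list_def)
    ultimately have "1 \<le> length w" by linarith
    have "sz (enc (?tc, bs)) \<le> 1 + ?K * length w"
      using 1 2 unfolding len by (simp add: add_mult_distrib2)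
    also have "\<dots> \<le> (2 * length ts + 2 * B + 10) * length w"
      using \<open>1 \<le> length w\<close> by (simp add: algebra_simps)
    finally show ?thesis .
  qed
  ultimately show ?thesis by blast
qed

theorem tiling_problem_NP:
  assumes "finite W" shows "tiling_problem W \<in> NP"
proof -
  obtain ts where ts: "set ts = W" using finite_list[OF assms] by blast
  define B where "B = (\<Sum>t\<leftarrow>ts. north t + south t + west t + east t)"
  have B: "side_color t s \<le> B" if "t \<in> set ts" for t s
  proof -
    have "side_color t s \<le> north t + south t + west t + east t" by (cases s) auto
    also have "\<dots> \<le> B" unfolding B_def using that by (intro member_le_sum_list) auto
    finally show ?thesis .
  qed
  obtain db :: "data \<Rightarrow> bool" where db: "readable db" using readable_bool by blast
  obtain dn :: "data \<Rightarrow> nat" where dn: "readable dn" using readable_nat by blast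
  obtain dbl :: "data \<Rightarrow> bool list" where dbl: "readable dbl" using readable_list[OF db] by blast
  obtain di :: "data \<Rightarrow> int" where di: "readable di" using readable_int[OF readable_prod[OF db dbl]] by blast
  obtain dc :: "data \<Rightarrow> cell" where dc: "readable dc" using readable_prod[OF di di] by blast
  obtain ds :: "data \<Rightarrow> segment" where ds: "readable ds" using readable_segment[OF readable_prod[OF db dc]] by blast
  obtain dec :: "data \<Rightarrow> (cell \<times> nat) list \<times> (segment \<times> nat) list" where dec: "readable dec"
    using readable_prod[OF readable_list[OF readable_prod[OF dc dn]] readable_list[OF readable_prod[OF ds dn]]] by blast
  have fdec: "fp (\<lambda>z :: bool list \<times> data. dec (snd z))"
    by (rule fp_comp[of dec]) (use dec in \<open>auto simp: readable_def intro: fp_intros\<close>)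
  show ?thesis
  proof (rule NP_certificate)
    show "fp (\<lambda>z :: bool list \<times> data. verify ts (fst z, dec (snd z)))"
      by (rule fp_comp[OF fp_verify]) (intro fp_intros fdec)
    show "w \<in> tiling_problem W" if "verify ts (fst (w, d), dec (snd (w, d)))" for w d
      using that verify_sound[of ts w "fst (dec d)" "snd (dec d)"] by (simp add: ts)
    show "\<exists>d. sz d \<le> (2 * length ts + 2 * B + 10) * length w \<and> verify ts (fst (w, d), dec (snd (w, d)))"
      if w: "w \<in> tiling_problem W" for w
    proof -
      obtain tc bs where "verify ts (w, tc, bs)" "sz (enc (tc, bs)) \<le> (2 * length ts + 2 * B + 10) * length w"
        using verify_complete[of w ts B] w B unfolding ts by blast
      moreover have "dec (enc (tc, bs)) = (tc, bs)" using dec unfolding readable_def by blast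
      ultimately show ?thesis by (intro exI[of _ "enc (tc, bs)"]) (simp del: enc_Pair)
    qed
  qed
qed

section \<open>Constraint satisfaction problems as tilings\<close>

text \<open>A constraint \<open>((i, A), (i', B))\<close> says that exactly one of \<open>X i \<in> A\<close> and \<open>X i' \<in> B\<close> holds.
  There is one column for every pair of an index and a value; the domain constraint
  \<open>((i, vs), (i, []))\<close> makes the true columns of index \<open>i\<close> the graph of an assignment.\<close>

type_synonym ('i, 'v) constraint = "('i \<times> 'v list) \<times> ('i \<times> 'v list)"

definition matches :: "('i, 'v) constraint \<Rightarrow> 'i \<times> 'v \<Rightarrow> bool" where
  "matches c x \<longleftrightarrow> (fst x = fst (fst c) \<and> snd x \<in> set (snd (fst c))) \<or>
     (fst x = fst (snd c) \<and> snd x \<in> set (snd (snd c)))"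

definition csp_vars :: "'i list \<Rightarrow> 'v list \<Rightarrow> ('i \<times> 'v) list" where
  "csp_vars ids vs = concat (map (\<lambda>i. map (\<lambda>v. (i, v)) vs) ids)"

text \<open>The patterns are reversed because the shift rows reverse the marks that they feed
  in.\<close>

definition csp_patterns :: "'i list \<Rightarrow> 'v list \<Rightarrow> ('i, 'v) constraint list \<Rightarrow> bool list list" where
  "csp_patterns ids vs cs =
     map (\<lambda>c. rev (map (\<lambda>x. matches c x) (csp_vars ids vs))) (map (\<lambda>i. ((i, vs), (i, []))) ids @ cs)"

definition csp_word :: "'i list \<Rightarrow> 'v list \<Rightarrow> ('i, 'v) constraint list \<Rightarrow> bool list" where
  "csp_word ids vs cs =
     encode_instance (rect_instance (length (csp_vars ids vs)) (program (csp_patterns ids vs cs)))"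

lemma fp_rect_instance:
  assumes "fp N" "fp R" shows "fp (\<lambda>x. rect_instance (N x) (R x))"
proof -
  have "fp (\<lambda>p. rect_instance (fst p) (snd p))"
    unfolding rect_instance_def by (intro fp_intros)
  from fp_comp[OF this fp_Pair[OF assms]] show ?thesis by simp
qed

lemma fp_program:
  assumes "fp ps" shows "fp (\<lambda>x. program (ps x))"
proof -
  have e: "4 + of_bool h = (if h then 5 else 4 :: nat)" for h by simp
  have "fp program" unfolding program_def e by (intro fp_intros)
  from fp_comp[OF this assms] show ?thesis .
qed

lemma fp_csp_word:
  assumes "fp ids" "fp cs" shows "fp (\<lambda>x. csp_word (ids x) vs (cs x))"
proof -
  have vars: "fp (\<lambda>x. csp_vars (ids x) vs)"
    unfolding csp_vars_def by (intro fp_intros assms)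
  have "fp (\<lambda>p. map (\<lambda>c. rev (map (\<lambda>x. matches c x) (fst p))) (snd p))"
    unfolding matches_def by (intro fp_intros)
  moreover have "fp (\<lambda>x. (csp_vars (ids x) vs, map (\<lambda>i. ((i, vs), (i, []))) (ids x) @ cs x))"
    by (intro fp_intros assms vars)
  ultimately have "fp (\<lambda>x. map (\<lambda>c. rev (map (\<lambda>y. matches c y) (fst (csp_vars (ids x) vs, map (\<lambda>i. ((i, vs), (i, []))) (ids x) @ cs x))))
     (snd (csp_vars (ids x) vs, map (\<lambda>i. ((i, vs), (i, []))) (ids x) @ cs x)))"
    by (rule fp_comp)
  then have "fp (\<lambda>x. csp_patterns (ids x) vs (cs x))"
    by (simp add: csp_patterns_def)
  then show ?thesis
    unfolding csp_word_def by (intro fp_intros fp_rect_instance fp_program vars)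
qed

lemma hits_map: "hits (map \<beta> xs) (map \<phi> xs) = length (filter (\<lambda>x. \<beta> x \<and> \<phi> x) xs)"
  by (induction xs) (auto simp: hits_def)

lemma map_surj:
  assumes "distinct xs" "length bs = length xs" shows "\<exists>\<beta>. bs = map \<beta> xs"
proof
  show "bs = map (\<lambda>x. the (map_of (zip xs bs) x)) xs"
    by (rule nth_equalityI) (use assms in \<open>auto simp: map_of_zip_nth\<close>)
qed

lemma ball_set_map: "(\<forall>y\<in>set (map f xs). P y) \<longleftrightarrow> (\<forall>x\<in>set xs. P (f x))"
  by simp

text \<open>The last part of \<open>good\<close> makes the two groups of columns of a constraint
  disjoint. With one true column per index, a group contains a true column iff its membership
  condition holds, so exactly one hit means that exactly one of the two conditions holds.\<close>

theorem csp_word_iff: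
  assumes ids: "distinct ids" "ids \<noteq> []" and vs: "distinct vs" "vs \<noteq> []"
    and good: "\<And>c. c \<in> set cs \<Longrightarrow> fst (fst c) \<in> set ids \<and> fst (snd c) \<in> set ids \<and>
      (fst (fst c) \<noteq> fst (snd c) \<or> snd (snd c) = [])"
  shows "csp_word ids vs cs \<in> tiling_problem tile_set \<longleftrightarrow> (\<exists>X. (\<forall>i\<in>set ids. X i \<in> set vs) \<and>
     (\<forall>c\<in>set cs. (X (fst (fst c)) \<in> set (snd (fst c))) \<noteq> (X (fst (snd c)) \<in> set (snd (snd c)))))"
    (is "?l \<longleftrightarrow> (\<exists>X. ?dom X \<and> ?sat X)")
proof -
  let ?vars = "csp_vars ids vs"
  let ?all = "map (\<lambda>i. ((i, vs), (i, []))) ids @ cs"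
  have svars: "set ?vars = set ids \<times> set vs" by (auto simp: csp_vars_def)
  have dvars: "distinct ?vars" unfolding csp_vars_def
    by (rule distinct_concat_map) (use ids vs in \<open>auto simp: distinct_map inj_on_def\<close>)
  have "?vars \<noteq> []"
  proof
    assume "?vars = []"
    then have "set ids \<times> set vs = {}" using svars by simp
    then show False using ids vs by (cases ids; cases vs) auto
  qed
  have len: "\<forall>p\<in>set (csp_patterns ids vs cs). length p = length ?vars"
    by (auto simp: csp_patterns_def)
  have "?l \<longleftrightarrow> rows tile_set (program (csp_patterns ids vs cs)) (replicate (length ?vars) 0) (replicate (length ?vars) 0)"
    unfolding csp_word_def
    by (rule rect_instance_correct) (use \<open>?vars \<noteq> []\<close> in \<open>simp_all add: program_def\<close>)
  also have "\<dots> \<longleftrightarrow> (\<exists>bs. length bs = length ?vars \<and> (\<forall>p\<in>set (csp_patterns ids vs cs). hits bs (rev p) = 1))"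
    by (rule rows_program[OF len])
  also have "\<dots> \<longleftrightarrow> (\<exists>bs. length bs = length ?vars \<and> (\<forall>c\<in>set ?all. hits bs (map (\<lambda>x. matches c x) ?vars) = 1))"
    unfolding csp_patterns_def ball_set_map rev_rev_ident ..
  also have "\<dots> \<longleftrightarrow> (\<exists>\<beta>. \<forall>c\<in>set ?all. hits (map \<beta> ?vars) (map (\<lambda>x. matches c x) ?vars) = 1)"
  proof
    assume "\<exists>bs. length bs = length ?vars \<and> (\<forall>c\<in>set ?all. hits bs (map (\<lambda>x. matches c x) ?vars) = 1)"
    then obtain bs where bs: "length bs = length ?vars" "\<forall>c\<in>set ?all. hits bs (map (\<lambda>x. matches c x) ?vars) = 1" by blast
    obtain \<beta> where "bs = map \<beta> ?vars" using map_surj[OF dvars bs(1)] by blast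
    with bs(2) show "\<exists>\<beta>. \<forall>c\<in>set ?all. hits (map \<beta> ?vars) (map (\<lambda>x. matches c x) ?vars) = 1" by blast
  next
    assume "\<exists>\<beta>. \<forall>c\<in>set ?all. hits (map \<beta> ?vars) (map (\<lambda>x. matches c x) ?vars) = 1"
    then obtain \<beta> where "\<forall>c\<in>set ?all. hits (map \<beta> ?vars) (map (\<lambda>x. matches c x) ?vars) = 1" by blast
    then show "\<exists>bs. length bs = length ?vars \<and> (\<forall>c\<in>set ?all. hits bs (map (\<lambda>x. matches c x) ?vars) = 1)"
      by (intro exI[of _ "map \<beta> ?vars"]) simp
  qed
  also have "\<dots> \<longleftrightarrow> (\<exists>\<beta>. \<forall>c\<in>set ?all. card {x \<in> set ids \<times> set vs. \<beta> x \<and> matches c x} = 1)"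
    unfolding hits_map using distinct_length_filter[OF dvars]
    by (simp add: svars Int_def conj_commute)
  also have "\<dots> \<longleftrightarrow> (\<exists>X. ?dom X \<and> ?sat X)"
  proof
    assume "\<exists>\<beta>. \<forall>c\<in>set ?all. card {x \<in> set ids \<times> set vs. \<beta> x \<and> matches c x} = 1"
    then obtain \<beta> where \<beta>: "\<And>c. c \<in> set ?all \<Longrightarrow> card {x \<in> set ids \<times> set vs. \<beta> x \<and> matches c x} = 1" by blast
    \<comment> \<open>The domain constraint leaves one true column with index \<open>i\<close>; its
      value becomes \<open>X i\<close>.\<close>
    define S where "S i = {x \<in> set ids \<times> set vs. \<beta> x \<and> matches ((i, vs), (i, [])) x}" for i
    have ex: "\<forall>i\<in>set ids. \<exists>v. S i = {(i, v)}"
    proof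
      fix i assume i: "i \<in> set ids"
      have "card {x \<in> set ids \<times> set vs. \<beta> x \<and> matches ((i, vs), (i, [])) x} = 1" by (rule \<beta>) (use i in auto)
      then obtain y where y: "{x \<in> set ids \<times> set vs. \<beta> x \<and> matches ((i, vs), (i, [])) x} = {y}" by (rule card_1_singletonE)
      then have "matches ((i, vs), (i, [])) y" by blast
      then have "fst y = i" by (auto simp: matches_def)
      then have "y = (i, snd y)" by (simp add: prod_eq_iff)
      then show "\<exists>v. S i = {(i, v)}" using y unfolding S_def by (intro exI[of _ "snd y"]) simp
    qed
    from bchoice[OF ex] obtain X where X: "\<forall>i\<in>set ids. S i = {(i, X i)}" by (rule exE)
    have dom: "X i \<in> set vs" if "i \<in> set ids" for i
    proof -
      have "(i, X i) \<in> S i" using X that by simp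
      then show ?thesis unfolding S_def by simp
    qed
    have bX: "\<beta> (i, v) \<longleftrightarrow> v = X i" if "i \<in> set ids" "v \<in> set vs" for i v
    proof -
      have "(i, v) \<in> S i \<longleftrightarrow> \<beta> (i, v)"
        using that by (auto simp: matches_def S_def)
      then show ?thesis using X that(1) by auto
    qed
    have "?sat X"
    proof
      fix c assume c: "c \<in> set cs"
      obtain i A i' B where e: "c = ((i, A), (i', B))" by (metis surj_pair)
      have g: "i \<in> set ids" "i' \<in> set ids" "i \<noteq> i' \<or> B = []" using good[OF c] e by auto
      have "{x \<in> set ids \<times> set vs. \<beta> x \<and> matches c x} =
          (if X i \<in> set A then {(i, X i)} else {}) \<union> (if X i' \<in> set B then {(i', X i')} else {})"
        using g dom bX by (auto simp: e matches_def)
      moreover have "card {x \<in> set ids \<times> set vs. \<beta> x \<and> matches c x} = 1" using \<beta> c by simp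
      ultimately show "(X (fst (fst c)) \<in> set (snd (fst c))) \<noteq> (X (fst (snd c)) \<in> set (snd (snd c)))"
        using g by (auto simp: e split: if_splits)
    qed
    then show "\<exists>X. ?dom X \<and> ?sat X" using dom by blast
  next
    assume "\<exists>X. ?dom X \<and> ?sat X"
    then obtain X where dom: "?dom X" and sat: "?sat X" by blast
    show "\<exists>\<beta>. \<forall>c\<in>set ?all. card {x \<in> set ids \<times> set vs. \<beta> x \<and> matches c x} = 1"
    proof (intro exI[of _ "\<lambda>x. snd x = X (fst x)"] ballI)
      fix c assume c: "c \<in> set ?all"
      obtain i A i' B where e: "c = ((i, A), (i', B))" by (metis surj_pair)
      have g: "i \<in> set ids" "i' \<in> set ids" "(X i \<in> set A) \<noteq> (X i' \<in> set B)"
        using c good[of c] dom sat e by fastforce+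
      have "{x \<in> set ids \<times> set vs. snd x = X (fst x) \<and> matches c x} =
          (if X i \<in> set A then {(i, X i)} else {(i', X i')})"
        using g dom by (auto simp: e matches_def)
      then show "card {x \<in> set ids \<times> set vs. snd x = X (fst x) \<and> matches c x} = 1" by simp
    qed
  qed
  finally show ?thesis .
qed

text \<open>Equality of \<open>f (X p)\<close> and \<open>g (X q)\<close>: for every \<open>a\<close> exactly one of \<open>f (X p) = a\<close> and
  \<open>g (X q) \<noteq> a\<close> holds.\<close>

definition eq_table :: "'v list \<Rightarrow> ('v \<Rightarrow> 'c) \<Rightarrow> ('v \<Rightarrow> 'c) \<Rightarrow> ('v list \<times> 'v list) list" where
  "eq_table vs f g = map (\<lambda>a. (filter (\<lambda>v. f v = a) vs, filter (\<lambda>v. g v \<noteq> a) vs)) (map f vs)"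

definition link_all :: "('v list \<times> 'v list) list \<Rightarrow> 'i \<Rightarrow> 'i \<Rightarrow> ('i, 'v) constraint list" where
  "link_all T p q = map (\<lambda>t. ((p, fst t), (q, snd t))) T"

lemma fp_link_all [fp_intros]: "fp f \<Longrightarrow> fp g \<Longrightarrow> fp (\<lambda>x. link_all T (f x) (g x))"
proof -
  assume fg: "fp f" "fp g"
  have "fp (\<lambda>p. link_all T (fst p) (snd p))" unfolding link_all_def by (intro fp_intros)
  from fp_comp[OF this fp_Pair[OF fg]] show ?thesis by simp
qed

text \<open>The table ranges only over values of \<open>f\<close>. This suffices, since the entry
  for a = \<open>f (X p)\<close> alone forces equality.\<close>

lemma link_all_sat:
  assumes "X p \<in> set vs" "X q \<in> set vs"
  shows "(\<forall>c\<in>set (link_all (eq_table vs f g) p q).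
      (X (fst (fst c)) \<in> set (snd (fst c))) \<noteq> (X (fst (snd c)) \<in> set (snd (snd c)))) \<longleftrightarrow> f (X p) = g (X q)"
  using assms by (auto simp: link_all_def eq_table_def)

section \<open>Nondeterministic computations as tableaus\<close>

type_synonym tableau_cell = "transition \<times> nat \<times> bool \<times> bool \<times> bool"

text \<open>The cell of tape \<open>j\<close> at time \<open>t\<close> holds the transition used at time \<open>t\<close>, the symbol, and
  whether the head is here, on the left neighbour, or on the right neighbour.\<close>

abbreviation cell_trans :: "tableau_cell \<Rightarrow> transition" where "cell_trans v \<equiv> fst v"
abbreviation cell_symbol :: "tableau_cell \<Rightarrow> nat" where "cell_symbol v \<equiv> fst (snd v)"
abbreviation head_here :: "tableau_cell \<Rightarrow> bool" where "head_here v \<equiv> fst (snd (snd v))"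
abbreviation head_left :: "tableau_cell \<Rightarrow> bool" where "head_left v \<equiv> fst (snd (snd (snd v)))"
abbreviation head_right :: "tableau_cell \<Rightarrow> bool" where "head_right v \<equiv> snd (snd (snd (snd v)))"

abbreviation t_source :: "transition \<Rightarrow> nat" where "t_source \<tau> \<equiv> fst \<tau>"
abbreviation t_reads :: "transition \<Rightarrow> nat list" where "t_reads \<tau> \<equiv> fst (snd \<tau>)"
abbreviation t_target :: "transition \<Rightarrow> nat" where "t_target \<tau> \<equiv> fst (snd (snd \<tau>))"
abbreviation t_acts :: "transition \<Rightarrow> (nat \<times> move) list" where "t_acts \<tau> \<equiv> snd (snd (snd \<tau>))"

definition next_symbol :: "nat \<Rightarrow> tableau_cell \<Rightarrow> nat" where
  "next_symbol j v = (if head_here v then fst (t_acts (cell_trans v) ! j) else cell_symbol v)"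

text \<open>A head arrives by a move to the left from the right neighbour, and symmetrically. Thanks
  to the neighbour flags this depends on one cell only, so successive times are related by an
  equation between two cells instead of a condition on four.\<close>

definition next_head :: "nat \<Rightarrow> tableau_cell \<Rightarrow> bool" where
  "next_head j v = (case snd (t_acts (cell_trans v) ! j) of
     Left_Move \<Rightarrow> head_right v | No_Move \<Rightarrow> head_here v | Right_Move \<Rightarrow> head_left v)"

text \<open>Index i stands for tape position i - N. The margins of width N on both sides leave room
  for every head excursion of up to N steps.\<close>

definition initial_row :: "bool list \<Rightarrow> nat \<Rightarrow> nat \<Rightarrow> nat list" where
  "initial_row w N j = (if j = 0 then replicate N 0 @ map bit_symbol w @ replicate (Suc N) 0
     else replicate (Suc (2 * N + length w)) 0)"

lemma length_initial_row [simp]: "length (initial_row w N j) = Suc (2 * N + length w)"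
  by (simp add: initial_row_def)

lemma initial_row_0:
  "i \<le> 2 * N + length w \<Longrightarrow> initial_row w N 0 ! i = word_contents w (int i - int N)"
  by (auto simp: initial_row_def word_contents_def nth_append nat_diff_distrib simp del: replicate.simps)

section \<open>Acceptance as existence of a path of prescribed length\<close>

locale ntm =
  fixes M :: tm
  assumes wf: "wf_tm M"
begin

abbreviation k :: nat where "k \<equiv> tapes M"

definition Sig :: "nat set" where
  "Sig = {0, 1, 2} \<union> (\<Union>\<tau>\<in>delta M. set (t_reads \<tau>) \<union> fst ` set (t_acts \<tau>))"

text \<open>Idle steps in the halted accepting configurations. A computation path of the original
  machine is accepting iff it can be prolonged by idle steps beyond the time bound.\<close>

definition D :: "transition set" where
  "D = delta M \<union> {(accept M, rs, accept M, map (\<lambda>s. (s, No_Move)) rs) | rs.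
     length rs = k \<and> set rs \<subseteq> Sig \<and> (\<forall>q' as. (accept M, rs, q', as) \<notin> delta M)}"

definition ext :: tm where "ext = M\<lparr>delta := D\<rparr>"

lemma k_pos: "0 < k" and fin: "finite (delta M)"
  and wf_len: "(q, rs, q', as) \<in> delta M \<Longrightarrow> length rs = k \<and> length as = k"
  using wf by (auto simp: wf_tm_def)

lemma finite_Sig: "finite Sig"
  using fin by (auto simp: Sig_def)

lemma finite_D: "finite D"
proof -
  let ?L = "{rs. set rs \<subseteq> Sig \<and> length rs = k}"
  have "D \<subseteq> delta M \<union> (\<lambda>rs. (accept M, rs, accept M, map (\<lambda>s. (s, No_Move)) rs)) ` ?L"
    by (auto simp: D_def)
  then show ?thesis using fin finite_lists_length_eq[OF finite_Sig] finite_subset by blast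
qed

lemma D_wf:
  assumes "(q, rs, q', as) \<in> D"
  shows "length rs = k" "length as = k" "set rs \<subseteq> Sig" "fst ` set as \<subseteq> Sig"
proof -
  have "length rs = k \<and> length as = k \<and> set rs \<subseteq> Sig \<and> fst ` set as \<subseteq> Sig"
  proof (cases "(q, rs, q', as) \<in> delta M")
    case True
    then show ?thesis using wf_len[OF True] unfolding Sig_def by fastforce
  next
    case False
    then show ?thesis using assms by (auto simp: D_def)
  qed
  then show "length rs = k" "length as = k" "set rs \<subseteq> Sig" "fst ` set as \<subseteq> Sig" by auto
qed

text \<open>Idle transitions are provided only for readings over \<open>Sig\<close>, so the tapes
  must never leave that alphabet.\<close>

definition ok :: "config \<Rightarrow> bool" where
  "ok c \<longleftrightarrow> length (snd c) = k \<and> (\<forall>j<k. \<forall>x. snd (snd c ! j) x \<in> Sig)"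

lemma ok_initial: "ok (initial M w)"
proof -
  have "0 \<in> Sig" "1 \<in> Sig" "2 \<in> Sig" by (auto simp: Sig_def)
  then have "word_contents w x \<in> Sig" for x by (simp add: word_contents_def bit_symbol_def)
  then show ?thesis using k_pos \<open>0 \<in> Sig\<close>
    by (auto simp: ok_def initial_def nth_Cons split: nat.splits)
qed

lemma read_tape_alt: "read_tape T = snd T (fst T)"
  by (cases T) auto

lemma act_alt: "act a T = (fst T + displacement (snd a), (snd T)(fst T := fst a))"
  by (cases a; cases T) auto

lemma step_ext_iff: "step ext (q, ts) c \<longleftrightarrow> (\<exists>q' as. (q, map read_tape ts, q', as) \<in> D \<and> c = (q', map2 act as ts))"
  by (simp add: step_iff ext_def)

lemma ok_step: assumes "ok c" "step ext c d" shows "ok d"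
proof -
  obtain q ts where c: "c = (q, ts)" by force
  obtain q' as where d: "(q, map read_tape ts, q', as) \<in> D" "d = (q', map2 act as ts)"
    using assms(2) unfolding c step_ext_iff by blast
  have "fst (as ! j) \<in> Sig" if "j < k" for j
    using D_wf[OF d(1)] that by (metis image_eqI nth_mem subsetD)
  then show ?thesis using assms(1) D_wf(2)[OF d(1)]
    by (auto simp: ok_def c d(2) act_alt)
qed

lemma step_M_ext: "step M c d \<Longrightarrow> step ext c d"
  by (cases c) (auto simp: step_iff ext_def D_def)

lemma step_ext_cases:
  assumes "step ext c d" shows "step M c d \<or> (halted M c \<and> fst c = accept M)"
proof -
  obtain q ts where c: "c = (q, ts)" by force
  obtain q' as where d: "(q, map read_tape ts, q', as) \<in> D" "d = (q', map2 act as ts)"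
    using assms unfolding c step_ext_iff by blast
  show ?thesis
  proof (cases "(q, map read_tape ts, q', as) \<in> delta M")
    case True
    then show ?thesis using d(2) by (auto simp: c step_iff)
  next
    case False
    then have "q = accept M" "\<forall>q' as. (accept M, map read_tape ts, q', as) \<notin> delta M"
      using d(1) by (auto simp: D_def)
    then show ?thesis by (auto simp: c halted_def step_iff)
  qed
qed

lemma idle_step:
  assumes "ok c" "halted M c" "fst c = accept M" shows "step ext c c"
proof -
  obtain ts where c: "c = (accept M, ts)" using assms(3) by (cases c) auto
  let ?rs = "map read_tape ts"
  have "(accept M, ?rs, q', as) \<notin> delta M" for q' as
  proof
    assume "(accept M, ?rs, q', as) \<in> delta M"
    then have "step M c (q', map2 act as ts)" by (auto simp: c step_iff)
    then show False using assms(2) unfolding halted_def by blast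
  qed
  moreover have "length ?rs = k" "set ?rs \<subseteq> Sig"
    using assms(1) by (auto simp: ok_def c read_tape_alt in_set_conv_nth) (metis snd_conv)
  ultimately have "(accept M, ?rs, accept M, map (\<lambda>s. (s, No_Move)) ?rs) \<in> D"
    unfolding D_def by blast
  moreover have "map2 act (map (\<lambda>s. (s, No_Move)) (map read_tape ts)) ts = ts"
    by (rule nth_equalityI) auto
  ultimately show ?thesis unfolding c step_ext_iff by metis
qed

text \<open>No path of \<open>M\<close> is longer than the time bound, so a path of
  \<open>ext\<close> with one more step contains an idle step, and those exist only where
  \<open>M\<close> has halted in the accepting state. A tableau therefore needs no condition on its
  last row.\<close>

lemma accepts_iff:
  assumes "decides_in_time M L T"
  shows "w \<in> L \<longleftrightarrow> (\<exists>c. (step ext ^^ Suc (T (length w))) (initial M w) c)"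
proof
  have bound: "\<And>n c. (step M ^^ n) (initial M w) c \<Longrightarrow> n \<le> T (length w)"
    and acc: "w \<in> L \<longleftrightarrow> (\<exists>c. (step M)\<^sup>*\<^sup>* (initial M w) c \<and> halted M c \<and> fst c = accept M)"
    using assms unfolding decides_in_time_def by blast+
  {
    assume "w \<in> L"
    then obtain c n where c: "(step M ^^ n) (initial M w) c" "halted M c" "fst c = accept M"
      using acc rtranclp_imp_relpowp by metis
    have 1: "(step ext ^^ n) (initial M w) c \<and> ok c" using c(1)
    proof (induction n arbitrary: c)
      case (Suc n)
      then obtain d where d: "(step M ^^ n) (initial M w) d" "step M d c" by auto
      have "(step ext ^^ n) (initial M w) d" "ok d" using Suc.IH[OF d(1)] by auto
      moreover have "step ext d c" by (rule step_M_ext[OF d(2)])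
      ultimately show ?case using ok_step by (meson relpowp_Suc_I)
    qed (simp add: ok_initial)
    have idle: "step ext c c" by (rule idle_step) (use 1 c in auto)
    have "(step ext ^^ m) c c" for m
      by (induction m) (simp, meson idle relpowp_Suc_I)
    with 1 have "(step ext ^^ (n + (Suc (T (length w)) - n))) (initial M w) c"
      unfolding relpowp_add by blast
    then show "\<exists>c. (step ext ^^ Suc (T (length w))) (initial M w) c"
      using bound[OF c(1)] by (intro exI[of _ c]) (simp del: relpowp.simps)
  }
  assume "\<exists>c. (step ext ^^ Suc (T (length w))) (initial M w) c"
  then obtain c where c: "(step ext ^^ Suc (T (length w))) (initial M w) c" by blast
  have "(step ext ^^ n) a d \<Longrightarrow> (step M ^^ n) a d \<or> (\<exists>e. (step M)\<^sup>*\<^sup>* a e \<and> halted M e \<and> fst e = accept M)" for n a d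
  proof (induction n arbitrary: d)
    case (Suc n)
    then obtain e where e: "(step ext ^^ n) a e" "step ext e d" by auto
    show ?case
    proof (cases "(step M ^^ n) a e")
      case True
      from step_ext_cases[OF e(2)] show ?thesis
      proof
        assume "step M e d"
        then show ?thesis using True by (meson relpowp_Suc_I)
      next
        assume "halted M e \<and> fst e = accept M"
        then show ?thesis using relpowp_imp_rtranclp[OF True] by blast
      qed
    next
      case False
      then show ?thesis using Suc.IH[OF e(1)] by blast
    qed
  qed simp
  from this[OF c] show "w \<in> L" using bound acc by fastforce
qed

section \<open>Tableaus and computation paths\<close>

definition Vals :: "tableau_cell set" where
  "Vals = D \<times> Sig \<times> UNIV"

lemma finite_Vals: "finite Vals"
  unfolding Vals_def using finite_D finite_Sig by simp

text \<open>Every condition restricts a single cell or equates a function of one cell with a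
  function of another, as the constraint problem requires. The second kind spreads the transition
  along a row and across tapes, ties the flags of neighbours together, and links successive
  times.\<close>

definition tableau :: "(nat \<times> nat \<times> nat \<Rightarrow> tableau_cell) \<Rightarrow> bool list \<Rightarrow> nat \<Rightarrow> bool" where
  "tableau X w T \<longleftrightarrow> (let N = Suc T; W = 2 * N + length w in
     (\<forall>t<N. \<forall>j<k. \<forall>i\<le>W. X (t, j, i) \<in> Vals) \<and>
     (\<forall>t<N. \<forall>j<k. \<forall>i\<le>W. head_here (X (t, j, i)) \<longrightarrow> cell_symbol (X (t, j, i)) = t_reads (cell_trans (X (t, j, i))) ! j) \<and>
     (\<forall>t<N. \<forall>j<k. \<not> head_left (X (t, j, 0)) \<and> \<not> head_right (X (t, j, W))) \<and>
     (\<forall>t<N. \<forall>j<k. \<forall>i<W. (cell_trans (X (t, j, i)), head_here (X (t, j, i)), head_right (X (t, j, i))) =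
        (cell_trans (X (t, j, Suc i)), head_left (X (t, j, Suc i)), head_here (X (t, j, Suc i)))) \<and>
     (\<forall>t<N. \<forall>j<k - 1. cell_trans (X (t, j, 0)) = cell_trans (X (t, Suc j, 0))) \<and>
     (\<forall>t<T. \<forall>j<k. \<forall>i\<le>W. (t_target (cell_trans (X (t, j, i))), next_symbol j (X (t, j, i)), next_head j (X (t, j, i))) =
        (t_source (cell_trans (X (Suc t, j, i))), cell_symbol (X (Suc t, j, i)), head_here (X (Suc t, j, i)))) \<and>
     (\<forall>j<k. \<forall>i\<le>W. t_source (cell_trans (X (0, j, i))) = start M \<and> cell_symbol (X (0, j, i)) = initial_row w N j ! i \<and>
        (head_here (X (0, j, i)) \<longleftrightarrow> i = N)))"

lemma initial_tapes:
  "j < k \<Longrightarrow> snd (initial M w) ! j = (0, if j = 0 then word_contents w else (\<lambda>_. 0))"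
  by (auto simp: initial_def nth_Cons split: nat.splits)

lemma initial_row_contents:
  assumes "j < k" "i \<le> 2 * N + length w"
  shows "initial_row w N j ! i = snd (snd (initial M w) ! j) (int i - int N)"
proof (cases "j = 0")
  case True
  then show ?thesis using assms initial_row_0 by (simp add: initial_tapes)
next
  case False
  then show ?thesis using assms by (simp add: initial_tapes initial_row_def del: replicate.simps)
qed

lemma displacement_cases: "displacement m = -1 \<and> m = Left_Move \<or> displacement m = 0 \<and> m = No_Move \<or>
    displacement m = 1 \<and> m = Right_Move"
  by (cases m) auto

lemma path_imp_tableau:
  assumes "(step ext ^^ Suc T) (initial M w) c"
  shows "\<exists>X. tableau X w T"
proof -
  let ?N = "Suc T"
  obtain C where C0: "C 0 = initial M w" and Cs: "\<And>t. t < ?N \<Longrightarrow> step ext (C t) (C (Suc t))"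
    using assms unfolding relpowp_fun_conv by blast
  have "\<forall>t. \<exists>\<tau>. t < ?N \<longrightarrow> \<tau> \<in> D \<and> t_source \<tau> = fst (C t) \<and> t_reads \<tau> = map read_tape (snd (C t)) \<and>
      C (Suc t) = (t_target \<tau>, map2 act (t_acts \<tau>) (snd (C t)))"
  proof
    fix t show "\<exists>\<tau>. t < ?N \<longrightarrow> \<tau> \<in> D \<and> t_source \<tau> = fst (C t) \<and> t_reads \<tau> = map read_tape (snd (C t)) \<and>
      C (Suc t) = (t_target \<tau>, map2 act (t_acts \<tau>) (snd (C t)))"
    proof (cases "t < ?N")
      case True
      obtain q ts where e: "C t = (q, ts)" by force
      then obtain q' as where "(q, map read_tape ts, q', as) \<in> D" "C (Suc t) = (q', map2 act as ts)"
        using Cs[OF True] step_ext_iff by metis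
      then show ?thesis using e by (intro exI[of _ "(q, map read_tape ts, q', as)"]) simp
    qed simp
  qed
  then obtain \<tau> where \<tau>: "\<And>t. t < ?N \<Longrightarrow> \<tau> t \<in> D \<and> t_source (\<tau> t) = fst (C t) \<and>
      t_reads (\<tau> t) = map read_tape (snd (C t)) \<and> C (Suc t) = (t_target (\<tau> t), map2 act (t_acts (\<tau> t)) (snd (C t)))"
    by metis
  define pos where "pos t j = fst (snd (C t) ! j)" for t j
  define cont where "cont t j = snd (snd (C t) ! j)" for t j
  have okC: "t \<le> ?N \<Longrightarrow> ok (C t)" for t
    by (induction t) (use C0 ok_initial Cs ok_step in auto)
  have len: "length (t_acts (\<tau> t)) = k" if "t < ?N" for t
    using \<tau>[OF that] D_wf(2) by (metis prod.collapse)
  have nxt: "pos (Suc t) j = pos t j + displacement (snd (t_acts (\<tau> t) ! j)) \<and>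
      cont (Suc t) j = (cont t j)(pos t j := fst (t_acts (\<tau> t) ! j))" if "t < ?N" "j < k" for t j
    using \<tau>[OF that(1)] len[OF that(1)] okC[of t] that
    by (simp add: pos_def cont_def ok_def act_alt)
  \<comment> \<open>A head moves at most one cell per step, and the window covers the positions from
    -N to N + \<open>length w\<close>, so no head leaves it.\<close>
  have pos: "\<bar>pos t j\<bar> \<le> int t" if "t \<le> ?N" "j < k" for t j
    using that
  proof (induction t)
    case 0
    then show ?case by (simp add: pos_def C0 initial_tapes)
  next
    case (Suc t)
    then have "\<bar>pos t j\<bar> \<le> int t" "pos (Suc t) j = pos t j + displacement (snd (t_acts (\<tau> t) ! j))"
      using nxt[of t j] by auto
    then show ?case using displacement_cases[of "snd (t_acts (\<tau> t) ! j)"] by auto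
  qed
  define X where "X = (\<lambda>(t, j, i). (\<tau> t, cont t j (int i - int ?N), pos t j = int i - int ?N,
     pos t j = int i - 1 - int ?N, pos t j = int i + 1 - int ?N))"
  have "tableau X w T"
    unfolding tableau_def Let_def
  proof (intro conjI allI impI)
    let ?W = "2 * ?N + length w"
    show "X (t, j, i) \<in> Vals" if "t < ?N" "j < k" "i \<le> ?W" for t j i
      using that \<tau>[of t] okC[of t] by (simp add: X_def Vals_def ok_def cont_def)
    show "cell_symbol (X (t, j, i)) = t_reads (cell_trans (X (t, j, i))) ! j"
      if "t < ?N" "j < k" "i \<le> ?W" "head_here (X (t, j, i))" for t j i
      using that \<tau>[of t] okC[of t] by (simp add: X_def ok_def cont_def pos_def read_tape_alt)
    show "\<not> head_left (X (t, j, 0))" "\<not> head_right (X (t, j, ?W))" if "t < ?N" "j < k" for t j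
      using pos[of t j] that by (auto simp: X_def)
    show "(cell_trans (X (t, j, i)), head_here (X (t, j, i)), head_right (X (t, j, i))) =
        (cell_trans (X (t, j, Suc i)), head_left (X (t, j, Suc i)), head_here (X (t, j, Suc i)))" for t j i
      by (auto simp: X_def)
    show "cell_trans (X (t, j, 0)) = cell_trans (X (t, Suc j, 0))" for t j by (simp add: X_def)
    show "(t_target (cell_trans (X (t, j, i))), next_symbol j (X (t, j, i)), next_head j (X (t, j, i))) =
        (t_source (cell_trans (X (Suc t, j, i))), cell_symbol (X (Suc t, j, i)), head_here (X (Suc t, j, i)))"
      if "t < T" "j < k" "i \<le> ?W" for t j i
    proof -
      have t: "t < ?N" "Suc t < ?N" using that by auto
      have "t_source (\<tau> (Suc t)) = t_target (\<tau> t)" using \<tau>[OF t(1)] \<tau>[OF t(2)] by simp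
      moreover have "next_head j (X (t, j, i)) \<longleftrightarrow> pos (Suc t) j = int i - int ?N"
        using nxt[OF t(1) that(2)] displacement_cases[of "snd (t_acts (\<tau> t) ! j)"]
        by (auto simp: next_head_def X_def)
      ultimately show ?thesis
        using nxt[OF t(1) that(2)] by (auto simp: X_def next_symbol_def)
    qed
    fix j i assume ji: "j < k" "i \<le> ?W"
    have "fst (initial M w) = start M" by (simp add: initial_def)
    then show "t_source (cell_trans (X (0, j, i))) = start M" using \<tau>[of 0] by (simp add: X_def C0)
    show "cell_symbol (X (0, j, i)) = initial_row w ?N j ! i"
      unfolding initial_row_contents[OF ji] by (simp add: X_def cont_def C0)
    show "head_here (X (0, j, i)) \<longleftrightarrow> i = ?N"
      using ji by (auto simp: X_def pos_def C0 initial_tapes)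
  qed
  then show ?thesis by blast
qed

lemma tableau_imp_path:
  assumes "tableau X w T"
  shows "\<exists>c. (step ext ^^ Suc T) (initial M w) c"
proof -
  let ?N = "Suc T"
  let ?W = "2 * ?N + length w"
  have vals: "\<And>t j i. t < ?N \<Longrightarrow> j < k \<Longrightarrow> i \<le> ?W \<Longrightarrow> X (t, j, i) \<in> Vals"
    and loc: "\<And>t j i. t < ?N \<Longrightarrow> j < k \<Longrightarrow> i \<le> ?W \<Longrightarrow> head_here (X (t, j, i)) \<Longrightarrow>
      cell_symbol (X (t, j, i)) = t_reads (cell_trans (X (t, j, i))) ! j"
    and border: "\<And>t j. t < ?N \<Longrightarrow> j < k \<Longrightarrow> \<not> head_left (X (t, j, 0))"
      "\<And>t j. t < ?N \<Longrightarrow> j < k \<Longrightarrow> \<not> head_right (X (t, j, ?W))"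
    and horiz: "\<And>t j i. t < ?N \<Longrightarrow> j < k \<Longrightarrow> i < ?W \<Longrightarrow>
      cell_trans (X (t, j, i)) = cell_trans (X (t, j, Suc i)) \<and> head_here (X (t, j, i)) = head_left (X (t, j, Suc i)) \<and>
      head_right (X (t, j, i)) = head_here (X (t, j, Suc i))"
    and cross: "\<And>t j. t < ?N \<Longrightarrow> Suc j < k \<Longrightarrow> cell_trans (X (t, j, 0)) = cell_trans (X (t, Suc j, 0))"
    and time: "\<And>t j i. t < T \<Longrightarrow> j < k \<Longrightarrow> i \<le> ?W \<Longrightarrow>
      t_target (cell_trans (X (t, j, i))) = t_source (cell_trans (X (Suc t, j, i))) \<and>
      next_symbol j (X (t, j, i)) = cell_symbol (X (Suc t, j, i)) \<and> next_head j (X (t, j, i)) = head_here (X (Suc t, j, i))"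
    and init: "\<And>j i. j < k \<Longrightarrow> i \<le> ?W \<Longrightarrow> t_source (cell_trans (X (0, j, i))) = start M \<and>
      cell_symbol (X (0, j, i)) = initial_row w ?N j ! i \<and> (head_here (X (0, j, i)) \<longleftrightarrow> i = ?N)"
    using assms unfolding tableau_def Let_def by (auto simp: less_diff_conv)
  define \<tau> where "\<tau> t = cell_trans (X (t, 0, 0))" for t
  have row0: "cell_trans (X (t, j, 0)) = \<tau> t" if "t < ?N" "j < k" for t j
    using that(2) by (induction j) (use cross that(1) in \<open>auto simp: \<tau>_def\<close>)
  have tau: "cell_trans (X (t, j, i)) = \<tau> t" if "t < ?N" "j < k" "i \<le> ?W" for t j i
    using that(3) by (induction i) (use horiz row0 that in auto)
  have tauD: "\<tau> t \<in> D" if "t < ?N" for t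
    using vals[OF that k_pos, of 0] by (auto simp: \<tau>_def Vals_def)
  \<comment> \<open>Row \<open>t\<close> describes the configuration at time \<open>t\<close>. There
    are rows only for times below \<open>?N\<close>; at time \<open>?N\<close> itself only the
    existence of the path is claimed, the last row having supplied one more step.\<close>
  have main: "t \<le> ?N \<Longrightarrow> \<exists>q ts. (step ext ^^ t) (initial M w) (q, ts) \<and> length ts = k \<and>
      (\<forall>j<k. \<bar>fst (ts ! j)\<bar> \<le> int t) \<and> (t < ?N \<longrightarrow> q = t_source (\<tau> t) \<and>
      (\<forall>j<k. \<forall>i\<le>?W. cell_symbol (X (t, j, i)) = snd (ts ! j) (int i - int ?N) \<and>
         (head_here (X (t, j, i)) \<longleftrightarrow> fst (ts ! j) = int i - int ?N)))" for t
  proof (induction t)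
    case 0
    have "snd (initial M w) ! j = (0, if j = 0 then word_contents w else (\<lambda>_. 0))" if "j < k" for j
      by (rule initial_tapes[OF that])
    moreover have "length (snd (initial M w)) = k" using ok_initial[of w] by (simp add: ok_def)
    moreover have "fst (initial M w) = t_source (\<tau> 0)"
      using init[OF k_pos, of 0] by (simp add: \<tau>_def initial_def)
    ultimately show ?case using init initial_row_contents
      by (intro exI[of _ "fst (initial M w)"] exI[of _ "snd (initial M w)"]) (auto simp: prod_eq_iff)
  next
    case (Suc t)
    then have t: "t < ?N" by simp
    from Suc obtain q ts where path: "(step ext ^^ t) (initial M w) (q, ts)" and len: "length ts = k"
      and pos: "\<And>j. j < k \<Longrightarrow> \<bar>fst (ts ! j)\<bar> \<le> int t" and q: "q = t_source (\<tau> t)"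
      and sym: "\<And>j i. j < k \<Longrightarrow> i \<le> ?W \<Longrightarrow> cell_symbol (X (t, j, i)) = snd (ts ! j) (int i - int ?N)"
      and hh: "\<And>j i. j < k \<Longrightarrow> i \<le> ?W \<Longrightarrow> head_here (X (t, j, i)) \<longleftrightarrow> fst (ts ! j) = int i - int ?N"
      by auto
    \<comment> \<open>The flag is a copy of \<open>head_here\<close> one cell over. At the end of
      the window, where that cell is missing, the border condition makes the left side false and the
      bound on the head position the right side.\<close>
    have hl: "head_left (X (t, j, i)) \<longleftrightarrow> fst (ts ! j) = int i - 1 - int ?N" if "j < k" "i \<le> ?W" for j i
    proof (cases i)
      case 0
      then show ?thesis using border(1)[OF t that(1)] pos[OF that(1)] t by auto
    next
      case (Suc i')
      then show ?thesis using horiz[OF t that(1), of i'] hh[OF that(1), of i'] that(2) by auto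
    qed
    have hr: "head_right (X (t, j, i)) \<longleftrightarrow> fst (ts ! j) = int i + 1 - int ?N" if "j < k" "i \<le> ?W" for j i
    proof (cases "i = ?W")
      case True
      then show ?thesis using border(2)[OF t that(1)] pos[OF that(1)] t by auto
    next
      case False
      then show ?thesis using horiz[OF t that(1), of i] hh[OF that(1), of "Suc i"] that(2) by auto
    qed
    obtain q0 rs q' as where e: "\<tau> t = (q0, rs, q', as)" by (metis surj_pair)
    note Dt = tauD[OF t, unfolded e]
    \<comment> \<open>Each head lies inside the window, so some cell carries it; the local condition
      at that cell shows that the transition reads the right symbol.\<close>
    have reads: "map read_tape ts = rs"
    proof (rule nth_equalityI)
      show "length (map read_tape ts) = length rs" using D_wf(1)[OF Dt] len by simp
      fix j assume "j < length (map read_tape ts)"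
      then have j: "j < k" using len by simp
      define i where "i = nat (fst (ts ! j) + int ?N)"
      have i: "int i - int ?N = fst (ts ! j)" "i \<le> ?W" using pos[OF j] t by (auto simp: i_def)
      then have "head_here (X (t, j, i))" using hh[OF j i(2)] by simp
      then have "cell_symbol (X (t, j, i)) = rs ! j" using loc[OF t j i(2)] tau[OF t j i(2)] e by simp
      then show "map read_tape ts ! j = rs ! j" using sym[OF j i(2)] j len i(1) by (simp add: read_tape_alt)
    qed
    let ?ts = "map2 act as ts"
    have "step ext (q, ts) (q', ?ts)" unfolding step_ext_iff reads using Dt q e by auto
    then have path': "(step ext ^^ Suc t) (initial M w) (q', ?ts)" using path by auto
    have nth: "?ts ! j = (fst (ts ! j) + displacement (snd (as ! j)), (snd (ts ! j))(fst (ts ! j) := fst (as ! j)))"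
      if "j < k" for j
      using D_wf(2)[OF Dt] len that by (simp add: act_alt)
    have pos': "\<bar>fst (?ts ! j)\<bar> \<le> int (Suc t)" if "j < k" for j
      using pos[OF that] displacement_cases[of "snd (as ! j)"] by (auto simp: nth[OF that])
    have "q' = t_source (\<tau> (Suc t)) \<and> (\<forall>j<k. \<forall>i\<le>?W. cell_symbol (X (Suc t, j, i)) = snd (?ts ! j) (int i - int ?N) \<and>
         (head_here (X (Suc t, j, i)) \<longleftrightarrow> fst (?ts ! j) = int i - int ?N))" if "Suc t < ?N"
    proof -
      have tT: "t < T" using that by simp
      have "q' = t_source (\<tau> (Suc t))"
        using time[OF tT k_pos, of 0] e unfolding \<tau>_def by simp
      moreover have "cell_symbol (X (Suc t, j, i)) = snd (?ts ! j) (int i - int ?N) \<and>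
         (head_here (X (Suc t, j, i)) \<longleftrightarrow> fst (?ts ! j) = int i - int ?N)" if ji: "j < k" "i \<le> ?W" for j i
      proof
        note tm = time[OF tT ji] and ta = tau[OF t ji]
        have "cell_symbol (X (Suc t, j, i)) = next_symbol j (X (t, j, i))" using tm by simp
        also have "\<dots> = snd (?ts ! j) (int i - int ?N)"
          unfolding next_symbol_def nth[OF ji(1)] ta e hh[OF ji] sym[OF ji] by (simp add: eq_commute)
        finally show "cell_symbol (X (Suc t, j, i)) = snd (?ts ! j) (int i - int ?N)" .
        have "head_here (X (Suc t, j, i)) = next_head j (X (t, j, i))" using tm by simp
        also have "\<dots> \<longleftrightarrow> fst (?ts ! j) = int i - int ?N"
          unfolding next_head_def nth[OF ji(1)] ta e using hh[OF ji] hl[OF ji] hr[OF ji]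
          by (cases "snd (as ! j)") auto
        finally show "head_here (X (Suc t, j, i)) \<longleftrightarrow> fst (?ts ! j) = int i - int ?N" .
      qed
      ultimately show ?thesis by blast
    qed
    then show ?case using path' pos' D_wf(2)[OF Dt] len
      by (intro exI[of _ q'] exI[of _ ?ts]) auto
  qed
  from main[of ?N] show ?thesis by blast
qed

end

section \<open>The reduction\<close>

instantiation move :: enc begin
fun enc_move where
  "enc_move Left_Move = enc (0 :: nat)"
| "enc_move No_Move = enc (1 :: nat)"
| "enc_move Right_Move = enc (2 :: nat)"
instance
proof
  fix m n :: move
  show "enc m = enc n \<longleftrightarrow> m = n" by (cases m; cases n) (auto simp del: enc_inject simp: enc_nat_def numeral_2_eq_2)
qed
end

context ntm
begin

text \<open>Any enumeration will do. It depends only on the machine and enters the reduction as a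
  constant.\<close>

definition vals :: "tableau_cell list" where
  "vals = (SOME vs. set vs = Vals \<and> distinct vs)"

lemma vals: "set vals = Vals" "distinct vals"
  using someI_ex[OF finite_distinct_list[OF finite_Vals]] by (auto simp: vals_def)

text \<open>With an empty second list, "exactly one" says just that the first condition
  holds.\<close>

definition unary :: "'i \<Rightarrow> (tableau_cell \<Rightarrow> bool) \<Rightarrow> ('i, tableau_cell) constraint" where
  "unary p P = ((p, filter P vals), (p, []))"

definition initial_cell :: "bool \<Rightarrow> nat \<Rightarrow> tableau_cell \<Rightarrow> bool" where
  "initial_cell b s v \<longleftrightarrow> t_source (cell_trans v) = start M \<and> cell_symbol v = s \<and> head_here v = b"

definition cells :: "nat \<Rightarrow> nat \<Rightarrow> (nat \<times> nat \<times> nat) list" where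
  "cells n T = concat (map (\<lambda>j. concat (map (\<lambda>t. map (\<lambda>i. (t, j, i)) [0..<Suc (2 * Suc T + n)]) [0..<Suc T])) [0..<k])"

definition local_constraints :: "nat \<Rightarrow> nat \<Rightarrow> (nat \<times> nat \<times> nat, tableau_cell) constraint list" where
  "local_constraints n T =
     concat (map (\<lambda>j. concat (map (\<lambda>t.
       map (\<lambda>i. unary (t, j, i) (\<lambda>v. head_here v \<longrightarrow> cell_symbol v = t_reads (cell_trans v) ! j)) [0..<Suc (2 * Suc T + n)] @
       [unary (t, j, 0) (\<lambda>v. \<not> head_left v), unary (t, j, 2 * Suc T + n) (\<lambda>v. \<not> head_right v)] @
       concat (map (\<lambda>i. link_all (eq_table vals (\<lambda>v. (cell_trans v, head_here v, head_right v))
         (\<lambda>v. (cell_trans v, head_left v, head_here v))) (t, j, i) (t, j, Suc i)) [0..<2 * Suc T + n])) [0..<Suc T])) [0..<k])"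

definition tape_constraints :: "nat \<Rightarrow> (nat \<times> nat \<times> nat, tableau_cell) constraint list" where
  "tape_constraints T = concat (map (\<lambda>j. concat (map (\<lambda>t.
     link_all (eq_table vals (\<lambda>v. cell_trans v) (\<lambda>v. cell_trans v)) (t, j, 0) (t, Suc j, 0)) [0..<Suc T])) [0..<k - 1])"

definition time_constraints :: "nat \<Rightarrow> nat \<Rightarrow> (nat \<times> nat \<times> nat, tableau_cell) constraint list" where
  "time_constraints n T = concat (map (\<lambda>j. concat (map (\<lambda>t. concat (map (\<lambda>i.
     link_all (eq_table vals (\<lambda>v. (t_target (cell_trans v), next_symbol j v, next_head j v))
       (\<lambda>v. (t_source (cell_trans v), cell_symbol v, head_here v))) (t, j, i) (Suc t, j, i))
     [0..<Suc (2 * Suc T + n)])) [0..<T])) [0..<k])"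

text \<open>Initial rows contain only the blank and the two input symbols, all below 3. For each of
  the two values of the head flag the list of admissible cell values is thus a finite table in the
  symbol.\<close>

definition initial_constraints :: "bool list \<Rightarrow> nat \<Rightarrow> (nat \<times> nat \<times> nat, tableau_cell) constraint list" where
  "initial_constraints w T = concat (map (\<lambda>j. map (\<lambda>x.
     (((0, j, fst x), if snd x < 3 then (if fst x = Suc T then filter (initial_cell True (snd x)) vals
        else filter (initial_cell False (snd x)) vals) else []), ((0, j, fst x), [])))
     (List.enumerate 0 (initial_row w (Suc T) j))) [0..<k])"

definition constraints :: "bool list \<Rightarrow> nat \<Rightarrow> (nat \<times> nat \<times> nat, tableau_cell) constraint list" where
  "constraints w T = local_constraints (length w) T @ tape_constraints T @ time_constraints (length w) T @
     initial_constraints w T"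

lemma in_concat_map: "a \<in> set xs \<Longrightarrow> y \<in> set (f a) \<Longrightarrow> y \<in> set (concat (map f xs))"
  by auto

lemma set_cells: "set (cells n T) = {(t, j, i). t < Suc T \<and> j < k \<and> i \<le> 2 * Suc T + n}"
proof (rule set_eqI)
  fix p :: "nat \<times> nat \<times> nat"
  obtain t j i where p: "p = (t, j, i)" by (metis surj_pair)
  show "p \<in> set (cells n T) \<longleftrightarrow> p \<in> {(t, j, i). t < Suc T \<and> j < k \<and> i \<le> 2 * Suc T + n}"
  proof
    assume "p \<in> set (cells n T)"
    then show "p \<in> {(t, j, i). t < Suc T \<and> j < k \<and> i \<le> 2 * Suc T + n}"
      by (auto simp: p cells_def simp del: upt_Suc mult_Suc_right)
  next
    assume "p \<in> {(t, j, i). t < Suc T \<and> j < k \<and> i \<le> 2 * Suc T + n}"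
    then have t: "t \<in> set [0..<Suc T]" "j \<in> set [0..<k]" "i \<in> set [0..<Suc (2 * Suc T + n)]"
      by (simp_all add: p del: upt_Suc)
    have "p \<in> set (map (\<lambda>i. (t, j, i)) [0..<Suc (2 * Suc T + n)])"
      unfolding p set_map using t(3) by (rule imageI)
    then have "p \<in> set (concat (map (\<lambda>t. map (\<lambda>i. (t, j, i)) [0..<Suc (2 * Suc T + n)]) [0..<Suc T]))"
      by (rule in_concat_map[OF t(1)])
    then show "p \<in> set (cells n T)" unfolding cells_def by (rule in_concat_map[OF t(2)])
  qed
qed

lemma distinct_cells: "distinct (cells n T)"
  unfolding cells_def
  by (intro distinct_concat_map) (auto simp: distinct_map inj_on_def simp del: upt_Suc)

definition sat :: "('i \<Rightarrow> tableau_cell) \<Rightarrow> ('i, tableau_cell) constraint list \<Rightarrow> bool" where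
  "sat X cs \<longleftrightarrow> (\<forall>c\<in>set cs. (X (fst (fst c)) \<in> set (snd (fst c))) \<noteq> (X (fst (snd c)) \<in> set (snd (snd c))))"

lemma sat_Nil [simp]: "sat X []" by (simp add: sat_def)
lemma sat_append [simp]: "sat X (cs @ ds) \<longleftrightarrow> sat X cs \<and> sat X ds" by (auto simp: sat_def)
lemma sat_Cons: "sat X (c # cs) \<longleftrightarrow> sat X [c] \<and> sat X cs" by (auto simp: sat_def)
lemma sat_concat [simp]: "sat X (concat (map f xs)) \<longleftrightarrow> (\<forall>x\<in>set xs. sat X (f x))" by (auto simp: sat_def)
lemma sat_map: "sat X (map f xs) \<longleftrightarrow> (\<forall>x\<in>set xs. sat X [f x])" by (auto simp: sat_def)
lemma sat_unary: "X p \<in> Vals \<Longrightarrow> sat X [unary p P] \<longleftrightarrow> P (X p)"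
  using vals by (auto simp: sat_def unary_def)
lemma sat_link: "X p \<in> Vals \<Longrightarrow> X q \<in> Vals \<Longrightarrow> sat X (link_all (eq_table vals f g) p q) \<longleftrightarrow> f (X p) = g (X q)"
  unfolding sat_def by (rule link_all_sat) (simp_all add: vals)

lemma initial_row_symbols: "s \<in> set (initial_row w N j) \<Longrightarrow> s < 3"
  by (auto simp: initial_row_def bit_symbol_def split: if_splits)

lemma sat_initial:
  assumes X: "\<And>j i. j < k \<Longrightarrow> i \<le> 2 * Suc T + length w \<Longrightarrow> X (0, j, i) \<in> Vals"
  shows "sat X (initial_constraints w T) \<longleftrightarrow> (\<forall>j<k. \<forall>i\<le>2 * Suc T + length w.
     t_source (cell_trans (X (0, j, i))) = start M \<and> cell_symbol (X (0, j, i)) = initial_row w (Suc T) j ! i \<and>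
        (head_here (X (0, j, i)) \<longleftrightarrow> i = Suc T))"
proof -
  let ?c = "\<lambda>j x. (((0, j, fst x), if snd x < 3 then (if fst x = Suc T then filter (initial_cell True (snd x)) vals
        else filter (initial_cell False (snd x)) vals) else []), ((0, j, fst x), []))"
  have 1: "sat X [?c j (i, initial_row w (Suc T) j ! i)] \<longleftrightarrow>
      t_source (cell_trans (X (0, j, i))) = start M \<and> cell_symbol (X (0, j, i)) = initial_row w (Suc T) j ! i \<and>
        (head_here (X (0, j, i)) \<longleftrightarrow> i = Suc T)" if "j < k" "i \<le> 2 * Suc T + length w" for j i
  proof -
    have "initial_row w (Suc T) j ! i < 3" by (rule initial_row_symbols[OF nth_mem]) (use that in simp)
    then show ?thesis using X[OF that] by (auto simp: sat_def vals initial_cell_def)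
  qed
  have en: "set (List.enumerate 0 (initial_row w (Suc T) j)) = (\<lambda>i. (i, initial_row w (Suc T) j ! i)) ` {..2 * Suc T + length w}" for j
    by (auto simp: in_set_enumerate_eq set_eq_iff image_iff simp del: mult_Suc_right)
  show ?thesis
    unfolding initial_constraints_def sat_concat sat_map en using 1 by auto
qed

lemma sat_constraints:
  "(\<forall>p\<in>set (cells (length w) T). X p \<in> set vals) \<and> sat X (constraints w T) \<longleftrightarrow> tableau X w T"
proof (cases "\<forall>t<Suc T. \<forall>j<k. \<forall>i\<le>2 * Suc T + length w. X (t, j, i) \<in> Vals")
  case False
  then have "\<not> tableau X w T" unfolding tableau_def Let_def by blast
  moreover have "\<not> (\<forall>p\<in>set (cells (length w) T). X p \<in> set vals)"
    using False unfolding set_cells vals by auto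
  ultimately show ?thesis by blast
next
  case True
  let ?W = "2 * Suc T + length w"
  have V: "X (t, j, i) \<in> Vals" if "t < Suc T" "j < k" "i \<le> ?W" for t j i using True that by blast
  have dom: "\<forall>p\<in>set (cells (length w) T). X p \<in> set vals"
    using True unfolding set_cells vals by auto
  have loc: "sat X (local_constraints (length w) T) \<longleftrightarrow>
     (\<forall>t<Suc T. \<forall>j<k. \<forall>i\<le>?W. head_here (X (t, j, i)) \<longrightarrow> cell_symbol (X (t, j, i)) = t_reads (cell_trans (X (t, j, i))) ! j) \<and>
     (\<forall>t<Suc T. \<forall>j<k. \<not> head_left (X (t, j, 0)) \<and> \<not> head_right (X (t, j, ?W))) \<and>
     (\<forall>t<Suc T. \<forall>j<k. \<forall>i<?W. (cell_trans (X (t, j, i)), head_here (X (t, j, i)), head_right (X (t, j, i))) =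
        (cell_trans (X (t, j, Suc i)), head_left (X (t, j, Suc i)), head_here (X (t, j, Suc i))))"
  proof -
    have "sat X (local_constraints (length w) T) \<longleftrightarrow> (\<forall>j<k. \<forall>t<Suc T.
       (\<forall>i<Suc ?W. sat X [unary (t, j, i) (\<lambda>v. head_here v \<longrightarrow> cell_symbol v = t_reads (cell_trans v) ! j)]) \<and>
       sat X [unary (t, j, 0) (\<lambda>v. \<not> head_left v)] \<and> sat X [unary (t, j, ?W) (\<lambda>v. \<not> head_right v)] \<and>
       (\<forall>i<?W. sat X (link_all (eq_table vals (\<lambda>v. (cell_trans v, head_here v, head_right v))
         (\<lambda>v. (cell_trans v, head_left v, head_here v))) (t, j, i) (t, j, Suc i))))"
      unfolding local_constraints_def sat_concat sat_append sat_map
      by (simp only: sat_Cons[of _ _ "[_]"] set_upt Ball_def atLeastLessThan_iff) simp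
    also have "\<dots> \<longleftrightarrow> (\<forall>j<k. \<forall>t<Suc T.
       (\<forall>i<Suc ?W. head_here (X (t, j, i)) \<longrightarrow> cell_symbol (X (t, j, i)) = t_reads (cell_trans (X (t, j, i))) ! j) \<and>
       \<not> head_left (X (t, j, 0)) \<and> \<not> head_right (X (t, j, ?W)) \<and>
       (\<forall>i<?W. (cell_trans (X (t, j, i)), head_here (X (t, j, i)), head_right (X (t, j, i))) =
        (cell_trans (X (t, j, Suc i)), head_left (X (t, j, Suc i)), head_here (X (t, j, Suc i)))))"
      using V by (simp add: sat_unary sat_link Suc_le_eq less_Suc_eq_le del: Pair_inject prod.inject)
    finally show ?thesis unfolding less_Suc_eq_le by blast
  qed
  have cross: "sat X (tape_constraints T) \<longleftrightarrow>
     (\<forall>t<Suc T. \<forall>j<k - 1. cell_trans (X (t, j, 0)) = cell_trans (X (t, Suc j, 0)))"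
  proof -
    have "sat X (link_all (eq_table vals (\<lambda>v. cell_trans v) (\<lambda>v. cell_trans v)) (t, j, 0) (t, Suc j, 0)) \<longleftrightarrow>
        cell_trans (X (t, j, 0)) = cell_trans (X (t, Suc j, 0))" if "t < Suc T" "j < k - 1" for t j
      by (rule sat_link) (use V that in auto)
    then show ?thesis unfolding tape_constraints_def sat_concat set_upt Ball_def atLeastLessThan_iff by auto
  qed
  have time: "sat X (time_constraints (length w) T) \<longleftrightarrow>
     (\<forall>t<T. \<forall>j<k. \<forall>i\<le>?W. (t_target (cell_trans (X (t, j, i))), next_symbol j (X (t, j, i)), next_head j (X (t, j, i))) =
        (t_source (cell_trans (X (Suc t, j, i))), cell_symbol (X (Suc t, j, i)), head_here (X (Suc t, j, i))))"
  proof -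
    have "sat X (link_all (eq_table vals (\<lambda>v. (t_target (cell_trans v), next_symbol j v, next_head j v))
       (\<lambda>v. (t_source (cell_trans v), cell_symbol v, head_here v))) (t, j, i) (Suc t, j, i)) \<longleftrightarrow>
       (t_target (cell_trans (X (t, j, i))), next_symbol j (X (t, j, i)), next_head j (X (t, j, i))) =
        (t_source (cell_trans (X (Suc t, j, i))), cell_symbol (X (Suc t, j, i)), head_here (X (Suc t, j, i)))"
      if "t < T" "j < k" "i \<le> ?W" for t j i
      by (rule sat_link) (use V that in auto)
    then show ?thesis
      unfolding time_constraints_def sat_concat set_upt Ball_def atLeastLessThan_iff less_Suc_eq_le by blast
  qed
  have init: "sat X (initial_constraints w T) \<longleftrightarrow> (\<forall>j<k. \<forall>i\<le>?W.
     t_source (cell_trans (X (0, j, i))) = start M \<and> cell_symbol (X (0, j, i)) = initial_row w (Suc T) j ! i \<and>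
        (head_here (X (0, j, i)) \<longleftrightarrow> i = Suc T))"
    by (rule sat_initial) (use V in auto)
  show ?thesis
    unfolding constraints_def sat_append loc cross time init tableau_def Let_def using dom True by argo
qed

lemma constraints_good:
  assumes "c \<in> set (constraints w T)"
  shows "fst (fst c) \<in> set (cells (length w) T) \<and> fst (snd c) \<in> set (cells (length w) T) \<and>
    (fst (fst c) \<noteq> fst (snd c) \<or> snd (snd c) = [])"
proof -
  have l: "c \<in> set (link_all tab p q) \<Longrightarrow> fst (fst c) = p \<and> fst (snd c) = q" for tab p q
    by (auto simp: link_all_def)
  from assms consider "c \<in> set (local_constraints (length w) T)" | "c \<in> set (tape_constraints T)"
    | "c \<in> set (time_constraints (length w) T)" | "c \<in> set (initial_constraints w T)"
    unfolding constraints_def by auto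
  then show ?thesis
  proof cases
    case 1
    then show ?thesis unfolding local_constraints_def set_cells
      by (auto simp: unary_def dest!: l simp del: upt_Suc mult_Suc_right)
  next
    case 2
    then show ?thesis unfolding tape_constraints_def set_cells
      by (auto dest!: l simp del: upt_Suc mult_Suc_right)
  next
    case 3
    then show ?thesis unfolding time_constraints_def set_cells
      by (auto dest!: l simp del: upt_Suc mult_Suc_right)
  next
    case 4
    then show ?thesis unfolding initial_constraints_def set_cells
      by (auto simp: in_set_enumerate_eq simp del: upt_Suc mult_Suc_right)
  qed
qed

definition reduction :: "nat poly \<Rightarrow> bool list \<Rightarrow> bool list" where
  "reduction p w = csp_word (cells (length w) (poly p (length w))) vals (constraints w (poly p (length w)))"

lemma reduction_correct:
  assumes "decides_in_time M L (poly p)"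
  shows "w \<in> L \<longleftrightarrow> reduction p w \<in> tiling_problem tile_set"
proof -
  let ?T = "poly p (length w)"
  have acc: "w \<in> L \<longleftrightarrow> (\<exists>X. tableau X w ?T)"
    using accepts_iff[OF assms, of w] path_imp_tableau tableau_imp_path by blast
  show ?thesis
  proof (cases "vals = []")
    \<comment> \<open>Without cell values there is no tableau, and there are no columns either: the
      rectangle has no cell, so the instance is invalid and the two sides agree.\<close>
    case True
    have no: "\<not> tableau X w ?T" for X
    proof
      assume "tableau X w ?T"
      then have "\<forall>p\<in>set (cells (length w) ?T). X p \<in> set vals" using sat_constraints by blast
      moreover have "(0, 0, 0) \<in> set (cells (length w) ?T)" using k_pos by (simp add: set_cells)
      ultimately show False using True by auto
    qed
    have "csp_vars (cells (length w) ?T) vals = []" by (simp add: csp_vars_def True)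
    then have "fst (rect_instance (length (csp_vars (cells (length w) ?T) vals)) R) = []" for R
      by (auto simp: rect_instance_def)
    then have "\<not> valid_instance (rect_instance (length (csp_vars (cells (length w) ?T) vals)) R)" for R
    proof -
      have "valid_instance I \<Longrightarrow> fst I \<noteq> []" for I by (cases I) (auto simp: polyomino_def)
      then show ?thesis using \<open>\<And>R. fst (rect_instance (length (csp_vars (cells (length w) ?T) vals)) R) = []\<close> by blast
    qed
    then have "reduction p w \<notin> tiling_problem tile_set"
      unfolding reduction_def csp_word_def encode_instance_in_tiling_problem by blast
    then show ?thesis using acc no by blast
  next
    case False
    have "cells (length w) ?T \<noteq> []"
    proof
      assume "cells (length w) ?T = []"
      then have "(0, 0, 0) \<notin> set (cells (length w) ?T)" by simp
      then show False using k_pos by (simp add: set_cells)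
    qed
    from csp_word_iff[OF distinct_cells this vals(2) False constraints_good]
    have "reduction p w \<in> tiling_problem tile_set \<longleftrightarrow>
        (\<exists>X. (\<forall>i\<in>set (cells (length w) ?T). X i \<in> set vals) \<and> sat X (constraints w ?T))"
      unfolding reduction_def sat_def by blast
    then show ?thesis using acc sat_constraints by blast
  qed
qed

lemma fp_initial_row: "fp w \<Longrightarrow> fp N \<Longrightarrow> fp (\<lambda>x. initial_row (w x) (N x) j)"
proof -
  assume wN: "fp w" "fp N"
  have e: "bit_symbol b = (if b then 2 else 1)" for b by (simp add: bit_symbol_def)
  show ?thesis unfolding initial_row_def e by (cases "j = 0") (simp_all only: if_True if_False, (intro fp_intros wN)+)
qed

lemma fp_reduction: "fp (reduction p)"
proof -
  let ?T = "\<lambda>w :: bool list. poly p (length w)"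
  have T: "fp ?T" by (intro fp_intros)
  have "fp (\<lambda>w. cells (length w) (?T w))"
    unfolding cells_def by (rule fp_concat_const) (intro fp_intros)
  moreover have "fp (\<lambda>w. local_constraints (length w) (?T w))"
    unfolding local_constraints_def unary_def by (rule fp_concat_const) (intro fp_intros)
  moreover have "fp (\<lambda>w. tape_constraints (?T w))"
    unfolding tape_constraints_def by (rule fp_concat_const) (intro fp_intros)
  moreover have "fp (\<lambda>w. time_constraints (length w) (?T w))"
    unfolding time_constraints_def by (rule fp_concat_const) (intro fp_intros)
  moreover have "fp (\<lambda>w. initial_constraints w (?T w))"
    unfolding initial_constraints_def
  proof (rule fp_concat_const)
    fix j
    have sel: "fp (\<lambda>z :: bool list \<times> nat \<times> nat. if snd (snd z) < 3 then (if fst (snd z) = Suc (?T (fst z))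
        then filter (initial_cell True (snd (snd z))) vals else filter (initial_cell False (snd (snd z))) vals) else [])"
    proof -
      \<comment> \<open>The test that depends on the input is moved outside, which leaves in each
        branch a table in the symbol alone.\<close>
      have "fp (\<lambda>z :: bool list \<times> nat \<times> nat. if fst (snd z) = Suc (?T (fst z))
        then (if snd (snd z) < 3 then filter (initial_cell True (snd (snd z))) vals else [])
        else (if snd (snd z) < 3 then filter (initial_cell False (snd (snd z))) vals else []))"
      proof (rule fp_if)
        have s: "fp (\<lambda>z :: bool list \<times> nat \<times> nat. snd (snd z))" by (intro fp_intros)
        show "fp (\<lambda>z :: bool list \<times> nat \<times> nat. fst (snd z) = Suc (?T (fst z)))" by (intro fp_intros)
        note table = fp_finite_table[where h = "\<lambda>s. filter (initial_cell b s) vals" for b, OF s]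
        show "fp (\<lambda>z :: bool list \<times> nat \<times> nat. if snd (snd z) < 3 then filter (initial_cell True (snd (snd z))) vals else [])"
          by (rule table)
        show "fp (\<lambda>z :: bool list \<times> nat \<times> nat. if snd (snd z) < 3 then filter (initial_cell False (snd (snd z))) vals else [])"
          by (rule table)
      qed
      then show ?thesis by (rule fp_retype) auto
    qed
    show "fp (\<lambda>w. map (\<lambda>x. (((0, j, fst x), if snd x < 3 then (if fst x = Suc (?T w)
        then filter (initial_cell True (snd x)) vals else filter (initial_cell False (snd x)) vals) else []), ((0, j, fst x), [])))
        (List.enumerate 0 (initial_row w (Suc (?T w)) j)))"
      by (rule fp_map) (intro fp_intros sel fp_initial_row)+
  qed
  ultimately show ?thesis
    unfolding reduction_def constraints_def by (intro fp_csp_word fp_append)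
qed

end

theorem theorem3:
  shows "\<exists>W :: wang_tile set. card W = 23 \<and> NP_complete (tiling_problem W)"
proof (intro exI[of _ tile_set] conjI)
  show "card tile_set = 23" by (rule card_tile_set)
  have "A \<le>\<^sub>p tiling_problem tile_set" if A: "A \<in> NP" for A
  proof -
    obtain M p where M: "wf_tm M" "decides_in_time M A (poly p)" using A unfolding NP_def by blast
    interpret ntm M by unfold_locales (rule M(1))
    show ?thesis
      unfolding poly_reducible_def
      using fp_poly_time_computable[OF fp_reduction] reduction_correct[OF M(2)] by blast
  qed
  moreover have "tiling_problem tile_set \<in> NP"
    by (rule tiling_problem_NP) (simp add: tile_set_def)
  ultimately show "NP_complete (tiling_problem tile_set)" unfolding NP_complete_def by blast
qed

end
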